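(* Let $\alpha=1$, and let $V$ and $\zeta$ satisfy hypotheses (a)--(f) of the context. Let $(\psi_{0,\epsilon})_{\epsilon\ge 0}$ be a family in $H_1(S_T)$ and $C>0$ a constant such that $\|\psi_{0,\epsilon}\|_{H_1(S_T)}\le C$ for all $\epsilon\ge 0$, and suppose $\psi_{0,\epsilon}\to\psi_{0,0}$ in $H_1(S_T)$ as $\epsilon\to 0^+$. Let $\psi_\epsilon(x,t)$ be the unique $T$-periodic solution of the nonlocal Gross-Pitaevskii equation (NGP) with initial condition $\psi_{0,\epsilon}$, $\epsilon>0$, and let $\psi(x,t)$ be the unique $T$-periodic solution of the local Gross-Pitaevskii equation (GP) with initial condition $\psi_{0,0}$. Then there exist a constant $C_u>0$ and a function $\varrho(\tilde T;\epsilon,\epsilon')$, defined for $\tilde T>0$ and $\epsilon,\epsilon'\ge 0$, with $\lim_{\epsilon\to\epsilon'}\varrho(\tilde T;\epsilon,\epsilon')=0$, such that for every finite $\tilde T>0$ and every $t\in[0,\tilde T]$ $$\|\psi_\epsilon(\cdot,t)-\psi(\cdot,t)\|_{L^\infty(S_T)}\le\Big(\|\psi_{0,\epsilon}-\psi_{0,0}\|_{H_1(S_T)}+3C_u\tilde T\,\varrho(\tilde T;\epsilon,0)\Big)e^{3C_u^2\tilde T}.$$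
   Context: $S_T$ is the circle of circumference $T>0$; functions on it are $T$-periodic and complex-valued. With $e_j(x)=T^{-1/2}e^{-2\pi i jx/T}$ and $\hat f_j=\int_{-T/2}^{T/2}f\,\overline{e_j}\,dx$, $H_s(S_T)$ is the set of $f\in L^2(S_T)$ with $\|f\|_{H_s(S_T)}^2=\sum_{j\in\mathbb Z}\left(1+\frac{4\pi^2j^2}{T^2}\right)^s|\hat f_j|^2<\infty$. For $\epsilon>0$ put $R_\epsilon(x)=R(x;\epsilon)=\frac1\epsilon\zeta(\frac x\epsilon)$. (NGP): $i\partial_t\psi=-\frac12\partial_x^2\psi+\alpha\,\psi(x)\int_{-\infty}^\infty R(x-y;\epsilon)|\psi(y)|^2dy+V(x)\psi$. (GP): $i\partial_t\psi=-\frac12\partial_x^2\psi+\alpha|\psi|^2\psi+V(x)\psi$, regarded as the case $\epsilon=0$ of (NGP) (convolution with $R_0$ being the identity). Solutions are understood in the Duhamel (mild) sense: with $L_{sa}=-\frac12\partial_x^2+V$, $\psi_\epsilon(t)=e^{-iL_{sa}t}\psi_{0,\epsilon}-i\alpha\int_0^te^{-iL_{sa}(t-t')}\psi_\epsilon(t')\,\big(R_\epsilon*|\psi_\epsilon(t')|^2\big)dt'$, with $\psi_\epsilon\in L^\infty([0,\tilde T];H_1(S_T))$ for every $\tilde T>0$. Fourier transform on $\mathbb R$: $\hat h(\tilde s)=\int_{\mathbb R}e^{-i\tilde sx}h(x)dx$. Hypotheses: (a) $V$ is a smooth, $T$-periodic (real) function; (b) $\zeta\ge0$; (c) $\zeta\in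 L^1(\mathbb R)$ with $\|\zeta\|_{L^1}=\int_{\mathbb R}\zeta\,dx=1$; (d) $x\zeta(x)\in L^1(\mathbb R)$; (e) there are $\tilde\epsilon>0$ and $C_\zeta>0$ with $|\hat\zeta(\tilde s)|\le C_\zeta(1+|\tilde s|)^{-1/2-\tilde\epsilon}$ for all $\tilde s\in\mathbb R$; (f) $\zeta$ is even. *)

theory Defs
  imports "HOL-Analysis.Analysis" "HOL-Probability.Essential_Supremum"
begin

text \<open>
  Functions on the circle of circumference \<open>T\<close> are \<open>T\<close>-periodic functions on the real line.
  Elements of the spaces below are honest functions rather than classes modulo null sets, so
  identities between them are stated almost everywhere, or through seminorms.
\<close>

definition periodic :: "real \<Rightarrow> (real \<Rightarrow> 'a) \<Rightarrow> bool" where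
  "periodic T f \<longleftrightarrow> (\<forall>x. f (x + T) = f x)"

definition L2 :: "real \<Rightarrow> (real \<Rightarrow> complex) set" where
  "L2 T = {f. periodic T f \<and> f \<in> borel_measurable lebesgue \<and>
              set_integrable lebesgue {-T/2..T/2} (\<lambda>x. (cmod (f x))\<^sup>2)}"

definition L2_norm :: "real \<Rightarrow> (real \<Rightarrow> complex) \<Rightarrow> real" where
  "L2_norm T f = sqrt (LINT x:{-T/2..T/2}|lebesgue. (cmod (f x))\<^sup>2)"

definition Linf_norm :: "real \<Rightarrow> (real \<Rightarrow> complex) \<Rightarrow> ereal" where
  "Linf_norm T f = esssup (lebesgue_on {-T/2..T/2}) (\<lambda>x. ereal (cmod (f x)))"

definition basis_fun :: "real \<Rightarrow> int \<Rightarrow> real \<Rightarrow> complex" where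
  "basis_fun T j x = of_real (1 / sqrt T) * exp (- 2 * of_real pi * \<i> * of_int j * of_real (x / T))"

definition fourier_coeff :: "real \<Rightarrow> (real \<Rightarrow> complex) \<Rightarrow> int \<Rightarrow> complex" where
  "fourier_coeff T f j = (LINT x:{-T/2..T/2}|lebesgue. f x * cnj (basis_fun T j x))"

definition sobolev_term :: "real \<Rightarrow> real \<Rightarrow> (real \<Rightarrow> complex) \<Rightarrow> int \<Rightarrow> real" where
  "sobolev_term T s f j = (1 + 4 * pi\<^sup>2 * (of_int j)\<^sup>2 / T\<^sup>2) powr s * (cmod (fourier_coeff T f j))\<^sup>2"

definition sobolev :: "real \<Rightarrow> real \<Rightarrow> (real \<Rightarrow> complex) set" where
  "sobolev T s = {f \<in> L2 T. sobolev_term T s f summable_on UNIV}"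

definition sobolev_norm :: "real \<Rightarrow> real \<Rightarrow> (real \<Rightarrow> complex) \<Rightarrow> real" where
  "sobolev_norm T s f = sqrt (\<Sum>\<^sub>\<infinity>j. sobolev_term T s f j)"

text \<open>
  Second derivative on the circle (in the distributional sense): it multiplies the \<open>j\<close>-th
  Fourier coefficient by \<open>(- 2 \<pi> i j / T)\<^sup>2\<close>.
\<close>

definition has_second_deriv :: "real \<Rightarrow> (real \<Rightarrow> complex) \<Rightarrow> (real \<Rightarrow> complex) \<Rightarrow> bool" where
  "has_second_deriv T f h \<longleftrightarrow> h \<in> L2 T \<and>
     (\<forall>j. fourier_coeff T h j = - of_real ((2 * pi * of_int j / T)\<^sup>2) * fourier_coeff T f j)"

text \<open>
  The graph of the self-adjoint operator \<open>-1/2 \<partial>\<^sub>x\<^sup>2 + V\<close> in \<open>L\<^sup>2\<close>, with domain \<open>H\<^sub>2\<close>.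
\<close>

definition schroedinger_op ::
  "real \<Rightarrow> (real \<Rightarrow> real) \<Rightarrow> (real \<Rightarrow> complex) \<Rightarrow> (real \<Rightarrow> complex) \<Rightarrow> bool" where
  "schroedinger_op T V f g \<longleftrightarrow> f \<in> sobolev T 2 \<and> g \<in> L2 T \<and>
     (\<exists>h. has_second_deriv T f h \<and>
          (AE x in lebesgue. g x = - (1/2) * h x + of_real (V x) * f x))"

text \<open>
  Strongly continuous one-parameter unitary groups on \<open>L\<^sup>2\<close>. Surjectivity of the isometries and
  compatibility with equality almost everywhere follow from the other clauses.
\<close>

definition unitary_group :: "real \<Rightarrow> (real \<Rightarrow> (real \<Rightarrow> complex) \<Rightarrow> real \<Rightarrow> complex) \<Rightarrow> bool" where
  "unitary_group T U \<longleftrightarrow>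
     (\<forall>t. \<forall>f\<in>L2 T. U t f \<in> L2 T \<and> L2_norm T (U t f) = L2_norm T f) \<and>
     (\<forall>t a b. \<forall>f\<in>L2 T. \<forall>g\<in>L2 T.
        AE x in lebesgue. U t (\<lambda>y. a * f y + b * g y) x = a * U t f x + b * U t g x) \<and>
     (\<forall>f\<in>L2 T. AE x in lebesgue. U 0 f x = f x) \<and>
     (\<forall>s t. \<forall>f\<in>L2 T. AE x in lebesgue. U (s + t) f x = U s (U t f) x) \<and>
     (\<forall>f\<in>L2 T. ((\<lambda>t. L2_norm T (\<lambda>x. U t f x - f x)) \<longlongrightarrow> 0) (at 0))"

definition group_generator ::
  "real \<Rightarrow> (real \<Rightarrow> (real \<Rightarrow> complex) \<Rightarrow> real \<Rightarrow> complex) \<Rightarrow>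
   (real \<Rightarrow> complex) \<Rightarrow> (real \<Rightarrow> complex) \<Rightarrow> bool" where
  "group_generator T U f g \<longleftrightarrow> f \<in> L2 T \<and> g \<in> L2 T \<and>
     ((\<lambda>t. L2_norm T (\<lambda>x. (U t f x - f x) / of_real t - g x)) \<longlongrightarrow> 0) (at 0)"

text \<open>
  \<open>U t = exp (- i L t)\<close> for \<open>L = -1/2 \<partial>\<^sub>x\<^sup>2 + V\<close>, i.e. \<open>U\<close> is the unitary group whose generator is
  exactly \<open>- i L\<close>, domains included. By Stone's theorem there is one and only one such \<open>U\<close>, up to
  equality almost everywhere.
\<close>

definition schroedinger_group ::
  "real \<Rightarrow> (real \<Rightarrow> real) \<Rightarrow> (real \<Rightarrow> (real \<Rightarrow> complex) \<Rightarrow> real \<Rightarrow> complex) \<Rightarrow> bool" where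
  "schroedinger_group T V U \<longleftrightarrow> unitary_group T U \<and>
     (\<forall>f g. group_generator T U f g \<longleftrightarrow> schroedinger_op T V f (\<lambda>x. \<i> * g x))"

text \<open>
  Bochner measurability and the Bochner integral over a set \<open>S\<close> of times, for maps into a space
  \<open>X\<close> of functions with seminorm \<open>N\<close>. The library versions need a Banach space type, whereas
  \<open>L\<^sup>2\<close> and the Sobolev spaces here depend on \<open>T\<close>; the definitions follow
  those of \<^const>\<open>has_bochner_integral\<close>.
\<close>

definition simple_map ::
  "(real \<Rightarrow> complex) set \<Rightarrow> real set \<Rightarrow> (real \<Rightarrow> real \<Rightarrow> complex) \<Rightarrow> bool" where
  "simple_map X S F \<longleftrightarrow> simple_function (lebesgue_on S) F \<and> F ` S \<subseteq> X"

definition simple_map_integral :: "real set \<Rightarrow> (real \<Rightarrow> real \<Rightarrow> complex) \<Rightarrow> real \<Rightarrow> complex" where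
  "simple_map_integral S F x = (\<Sum>c\<in>F ` S. of_real (measure lebesgue {t \<in> S. F t = c}) * c x)"

definition strongly_measurable ::
  "(real \<Rightarrow> complex) set \<Rightarrow> ((real \<Rightarrow> complex) \<Rightarrow> real) \<Rightarrow> real set \<Rightarrow>
   (real \<Rightarrow> real \<Rightarrow> complex) \<Rightarrow> bool" where
  "strongly_measurable X N S F \<longleftrightarrow>
     (\<exists>s. (\<forall>n. simple_map X S (s n)) \<and>
          (AE t in lebesgue_on S. F t \<in> X \<and> (\<lambda>n::nat. N (\<lambda>x. F t x - s n t x)) \<longlonglongrightarrow> 0))"

text \<open>
  For use with sets \<open>S\<close> of finite measure only, so that simple maps are integrable.
\<close>

definition has_space_integral ::
  "(real \<Rightarrow> complex) set \<Rightarrow> ((real \<Rightarrow> complex) \<Rightarrow> real) \<Rightarrow> real set \<Rightarrow>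
   (real \<Rightarrow> real \<Rightarrow> complex) \<Rightarrow> (real \<Rightarrow> complex) \<Rightarrow> bool" where
  "has_space_integral X N S F G \<longleftrightarrow>
     strongly_measurable X N S F \<and> G \<in> X \<and>
     (\<exists>s. (\<forall>n. simple_map X S (s n)) \<and>
          (\<forall>n. (\<lambda>t. N (\<lambda>x. F t x - s n t x)) \<in> borel_measurable (lebesgue_on S)) \<and>
          (\<lambda>n::nat. \<integral>\<^sup>+t. ennreal (N (\<lambda>x. F t x - s n t x)) \<partial>lebesgue_on S) \<longlonglongrightarrow> 0 \<and>
          (\<lambda>n. N (\<lambda>x. simple_map_integral S (s n) x - G x)) \<longlonglongrightarrow> 0)"

definition scaled_kernel :: "(real \<Rightarrow> real) \<Rightarrow> real \<Rightarrow> real \<Rightarrow> real" where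
  "scaled_kernel \<zeta> \<epsilon> x = 1 / \<epsilon> * \<zeta> (x / \<epsilon>)"

text \<open>Convolution with \<open>R\<^sub>\<epsilon>\<close>; for \<open>\<epsilon> = 0\<close> it is the identity.\<close>

definition kernel_conv :: "(real \<Rightarrow> real) \<Rightarrow> real \<Rightarrow> (real \<Rightarrow> real) \<Rightarrow> real \<Rightarrow> real" where
  "kernel_conv \<zeta> \<epsilon> g x =
     (if \<epsilon> = 0 then g x else (LINT y|lebesgue. scaled_kernel \<zeta> \<epsilon> (x - y) * g y))"

definition nonlinearity :: "(real \<Rightarrow> real) \<Rightarrow> real \<Rightarrow> (real \<Rightarrow> complex) \<Rightarrow> real \<Rightarrow> complex" where
  "nonlinearity \<zeta> \<epsilon> f x = f x * of_real (kernel_conv \<zeta> \<epsilon> (\<lambda>y. (cmod (f y))\<^sup>2) x)"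

text \<open>
  Mild solutions on \<open>[0, \<infinity>)\<close> of the nonlocal (\<open>\<epsilon> > 0\<close>) or local (\<open>\<epsilon> = 0\<close>) equation;
  \<open>\<psi> t x\<close> is the value at time \<open>t\<close> and point \<open>x\<close>, and \<open>U\<close> is the linear propagator.
\<close>

definition Linf_H1 :: "real \<Rightarrow> real \<Rightarrow> (real \<Rightarrow> real \<Rightarrow> complex) \<Rightarrow> bool" where
  "Linf_H1 T T' \<psi> \<longleftrightarrow>
     strongly_measurable (sobolev T 1) (sobolev_norm T 1) {0..T'} \<psi> \<and>
     (\<exists>M. AE t in lebesgue_on {0..T'}. sobolev_norm T 1 (\<psi> t) \<le> M)"

definition mild_solution ::
  "real \<Rightarrow> (real \<Rightarrow> (real \<Rightarrow> complex) \<Rightarrow> real \<Rightarrow> complex) \<Rightarrow> (real \<Rightarrow> real) \<Rightarrow> real \<Rightarrow> real \<Rightarrow>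
   (real \<Rightarrow> complex) \<Rightarrow> (real \<Rightarrow> real \<Rightarrow> complex) \<Rightarrow> bool" where
  "mild_solution T U \<zeta> \<alpha> \<epsilon> \<psi>0 \<psi> \<longleftrightarrow>
     (\<forall>T'>0. Linf_H1 T T' \<psi>) \<and>
     (\<forall>t\<ge>0. \<psi> t \<in> L2 T \<and>
        (\<exists>G. has_space_integral (L2 T) (L2_norm T) {0..t}
               (\<lambda>t'. U (t - t') (nonlinearity \<zeta> \<epsilon> (\<psi> t'))) G \<and>
             (AE x in lebesgue. \<psi> t x = U t \<psi>0 x - \<i> * of_real \<alpha> * G x)))"

definition smooth :: "(real \<Rightarrow> real) \<Rightarrow> bool" where
  "smooth f \<longleftrightarrow> (\<forall>n. (deriv ^^ n) f differentiable_on UNIV)"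

definition fourier_transform :: "(real \<Rightarrow> real) \<Rightarrow> real \<Rightarrow> complex" where
  "fourier_transform h s = (LINT x|lebesgue. exp (- \<i> * of_real (s * x)) * of_real (h x))"

end

theory Submission
  imports Defs
begin

text \<open>
  The estimates are made in the Wiener algebra of functions with absolutely summable Fourier
  coefficients. It contains \<open>H\<^sub>1\<close>, it controls the sup norm, convolution with \<open>R\<^sub>\<epsilon>\<close> is
  a contraction on it (a Fourier multiplier \<open>m\<^sub>\<epsilon>\<close> with \<open>\<bar>m\<^sub>\<epsilon>\<bar> \<le> 1\<close>), and the
  propagator is bounded on it, locally uniformly in time. The first moment of \<open>\<zeta>\<close> gives
  \<open>\<bar>m\<^sub>\<epsilon>(k) - 1\<bar> \<le> min 2 (c \<epsilon> \<bar>k\<bar>)\<close>, a subadditive weight in \<open>k\<close>, so on the local solution,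
  which is bounded in \<open>H\<^sub>1\<close>, the two nonlinearities differ by \<open>O(\<epsilon>\<^bsup>1/4\<^esup>)\<close>. The Wiener norm \<open>h\<close>
  of the difference of the two solutions then satisfies
  \<open>h(t) \<le> a\<^sub>\<epsilon> + L \<integral>\<^sub>0\<^sup>t h (m + h)\<^sup>2\<close> with \<open>a\<^sub>\<epsilon> \<rightarrow> 0\<close> and \<open>L\<close>, \<open>m\<close> depending on the local solution
  only, and a continuity argument gives \<open>h \<le> a\<^sub>\<epsilon> exp (L (m + 1)\<^sup>2 t)\<close> once \<open>\<epsilon>\<close> is small. No bound
  on the nonlocal solutions uniform in \<open>\<epsilon>\<close> is used. The required \<open>\<rho>\<close> is a bound on the sup
  norm of the difference over \<open>[0, T']\<close>, divided by \<open>3 T'\<close>.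
\<close>

section \<open>Fourier coefficients on the circle\<close>

text \<open>The propagator is given only as an abstract unitary group on L2, identified by its
  generator; neither its eigenfunctions nor a bound in any Sobolev norm is at hand. This favours an
  l1-type norm: an operator bound on l1 can be checked on the basis functions, provided it is
  uniform in their index. Each exponential lies in the domain of the generator, so the coefficients
  of its orbit are differentiable; the kinetic part merely rotates their phases, and multiplication
  by the smooth potential is bounded on the algebra. The time integral in the mild equation
  converges only in L2. Coefficients are continuous functionals on L2, so the equation is read one
  coefficient at a time, and the sum over frequencies is then moved inside the time integral by
  Tonelli. The power 1/4 of \<epsilon> is an interpolation: a weight growing like |k| asks for more
  than one derivative, so the truncated weight is bounded by a multiple of (\<epsilon> |k|)^(1/4),
  which the H1 norm does control.\<close>

locale circle =
  fixes T :: real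
  assumes T_pos: "T > 0"
begin

definition \<mu> :: "real measure" where "\<mu> = lebesgue_on {-T/2..T/2}"

lemma space_\<mu>: "space \<mu> = {-T/2..T/2}"
  by (simp add: \<mu>_def)

lemma emeasure_\<mu>: "emeasure \<mu> (space \<mu>) = ennreal T"
  using T_pos by (simp add: \<mu>_def emeasure_restrict_space)

sublocale \<mu>: finite_measure \<mu>
  by standard (simp add: emeasure_\<mu>)

lemma measure_\<mu>: "measure \<mu> (space \<mu>) = T"
  using T_pos by (simp add: measure_def emeasure_\<mu>)

lemma set_integrable_iff_\<mu>:
  fixes f :: "real \<Rightarrow> 'a::{banach, second_countable_topology}"
  shows "set_integrable lebesgue {-T/2..T/2} f \<longleftrightarrow> integrable \<mu> f"
  unfolding \<mu>_def set_integrable_def by (subst integrable_restrict_space) auto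

lemma set_integral_\<mu>:
  fixes f :: "real \<Rightarrow> 'a::{banach, second_countable_topology}"
  shows "(LINT x:{-T/2..T/2}|lebesgue. f x) = integral\<^sup>L \<mu> f"
  unfolding \<mu>_def set_lebesgue_integral_def by (subst integral_restrict_space) auto

lemma measurable_\<mu>: "f \<in> borel_measurable lebesgue \<Longrightarrow> f \<in> borel_measurable \<mu>"
  unfolding \<mu>_def by (rule measurable_restrict_space1)

lemma AE_\<mu>: "AE x in lebesgue. P x \<Longrightarrow> AE x in \<mu>. P x"
  unfolding \<mu>_def by (subst AE_restrict_space_iff) auto

abbreviation fc :: "(real \<Rightarrow> complex) \<Rightarrow> int \<Rightarrow> complex" where
  "fc \<equiv> fourier_coeff T"

abbreviation bas :: "int \<Rightarrow> real \<Rightarrow> complex" where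
  "bas \<equiv> basis_fun T"

abbreviation H1 :: "(real \<Rightarrow> complex) set" where
  "H1 \<equiv> sobolev T 1"

abbreviation H1norm :: "(real \<Rightarrow> complex) \<Rightarrow> real" where
  "H1norm \<equiv> sobolev_norm T 1"

lemma fourier_coeff_eq: "fc f j = (LINT x|\<mu>. f x * cnj (bas j x))"
  unfolding fourier_coeff_def set_integral_\<mu> ..

lemma L2_norm_eq: "L2_norm T f = sqrt (LINT x|\<mu>. (cmod (f x))\<^sup>2)"
  unfolding L2_norm_def set_integral_\<mu> ..

lemma L2_iff: "f \<in> L2 T \<longleftrightarrow> periodic T f \<and> f \<in> borel_measurable lebesgue \<and> integrable \<mu> (\<lambda>x. (cmod (f x))\<^sup>2)"
  unfolding L2_def set_integrable_iff_\<mu> by simp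

lemma basis_fun_eq: "bas j x = of_real (1 / sqrt T) * cis (- 2 * pi * of_int j * x / T)"
  unfolding basis_fun_def cis_conv_exp by (simp add: algebra_simps)

lemma cmod_basis [simp]: "cmod (bas j x) = 1 / sqrt T"
  using T_pos by (simp add: basis_fun_eq norm_mult norm_divide)

lemma cnj_basis: "cnj (bas j x) = bas (-j) x"
  by (simp add: basis_fun_eq cis_cnj)

lemma basis_mult: "bas j x * bas k x = of_real (1 / sqrt T) * bas (j + k) x"
  by (simp add: basis_fun_eq cis_mult add_divide_distrib diff_divide_distrib ring_distribs flip: of_real_mult)

lemma basis_periodic: "periodic T (bas j)"
proof -
  have "bas j (x + T) = bas j x" for x
  proof -
    have "- 2 * pi * of_int j * (x + T) / T = - 2 * pi * of_int j * x / T + 2 * pi * of_int (-j)"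
      using T_pos by (simp add: field_simps)
    then have "cis (- 2 * pi * of_int j * (x + T) / T) = cis (- 2 * pi * of_int j * x / T) * cis (2 * pi * of_int (-j))"
      by (simp only: cis_mult)
    also have "cis (2 * pi * of_int (-j)) = 1" by (rule cis_multiple_2pi) simp
    finally show ?thesis by (simp only: basis_fun_eq mult_1_right)
  qed
  then show ?thesis by (simp add: periodic_def)
qed

lemma continuous_basis: "continuous_on UNIV (bas j)"
  unfolding basis_fun_def using T_pos by (intro continuous_intros) auto

lemma basis_measurable [measurable]: "bas j \<in> borel_measurable lebesgue"
proof -
  have "bas j \<in> borel_measurable borel"
    by (rule borel_measurable_continuous_onI[OF continuous_basis])
  then show ?thesis by (simp add: measurable_completion)
qed

lemma basis_measurable_\<mu> [measurable]: "bas j \<in> borel_measurable \<mu>"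
  by (rule measurable_\<mu>) simp

lemma integrable_mult_bounded:
  fixes f g :: "real \<Rightarrow> complex"
  assumes "integrable \<mu> f" "g \<in> borel_measurable \<mu>" "AE x in \<mu>. norm (g x) \<le> B"
  shows "integrable \<mu> (\<lambda>x. f x * g x)"
proof (rule Bochner_Integration.integrable_bound[of _ "\<lambda>x. B * norm (f x)"])
  show "AE x in \<mu>. norm (f x * g x) \<le> norm (B * norm (f x))"
    using assms(3)
  proof eventually_elim
    case (elim x)
    then have "norm (f x) * norm (g x) \<le> norm (f x) * B" by (intro mult_left_mono) auto
    also have "\<dots> \<le> \<bar>B * norm (f x)\<bar>" by (simp add: mult.commute)
    finally show ?case by (simp add: norm_mult)
  qed
qed (use assms in auto)

lemma integrable_mult_basis:
  assumes "integrable \<mu> f"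
  shows "integrable \<mu> (\<lambda>x. f x * bas j x)" "integrable \<mu> (\<lambda>x. f x * cnj (bas j x))"
  unfolding cnj_basis
  by (rule integrable_mult_bounded[where B="1 / sqrt T"]; use assms in simp)+

section \<open>Square integrable functions on one period\<close>

lemma L2_measurable: "f \<in> L2 T \<Longrightarrow> f \<in> borel_measurable lebesgue"
  and L2_periodic: "f \<in> L2 T \<Longrightarrow> periodic T f"
  by (auto simp: L2_iff)

lemma L2_square_integrable: "f \<in> L2 T \<Longrightarrow> integrable \<mu> (\<lambda>x. (cmod (f x))\<^sup>2)"
  by (simp add: L2_iff)

lemma L2_integrable:
  assumes "f \<in> L2 T" shows "integrable \<mu> f"
proof (rule Bochner_Integration.integrable_bound[of _ "\<lambda>x. 1 + (cmod (f x))\<^sup>2"])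
  show "AE x in \<mu>. norm (f x) \<le> norm (1 + (cmod (f x))\<^sup>2)"
  proof (rule AE_I2)
    fix x
    have "0 \<le> (cmod (f x) - 1)\<^sup>2 + (cmod (f x))\<^sup>2 + 1" by auto
    then show "norm (f x) \<le> norm (1 + (cmod (f x))\<^sup>2)"
      by (simp add: power2_eq_square algebra_simps)
  qed
qed (use assms L2_measurable measurable_\<mu> L2_square_integrable in auto)

lemma L2_lin:
  assumes "f \<in> L2 T" "g \<in> L2 T" shows "(\<lambda>x. a * f x + b * g x) \<in> L2 T"
  unfolding L2_iff
proof (intro conjI)
  have [measurable]: "f \<in> borel_measurable lebesgue" "g \<in> borel_measurable lebesgue"
    using assms L2_measurable by auto
  show m: "(\<lambda>x. a * f x + b * g x) \<in> borel_measurable lebesgue" by measurable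
  show "periodic T (\<lambda>x. a * f x + b * g x)"
    using assms[THEN L2_periodic] by (simp add: periodic_def)
  show "integrable \<mu> (\<lambda>x. (cmod (a * f x + b * g x))\<^sup>2)"
  proof (rule Bochner_Integration.integrable_bound[of _ "\<lambda>x. 2 * (cmod a)\<^sup>2 * (cmod (f x))\<^sup>2 + 2 * (cmod b)\<^sup>2 * (cmod (g x))\<^sup>2"])
    show "AE x in \<mu>. norm ((cmod (a * f x + b * g x))\<^sup>2) \<le> norm (2 * (cmod a)\<^sup>2 * (cmod (f x))\<^sup>2 + 2 * (cmod b)\<^sup>2 * (cmod (g x))\<^sup>2)"
    proof (rule AE_I2)
      fix x
      have "(cmod (a * f x + b * g x))\<^sup>2 \<le> (cmod (a * f x) + cmod (b * g x))\<^sup>2"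
        by (intro power_mono norm_triangle_ineq) auto
      also have "\<dots> \<le> 2 * (cmod (a * f x))\<^sup>2 + 2 * (cmod (b * g x))\<^sup>2"
        using sum_squares_ge_zero[of "cmod (a * f x) - cmod (b * g x)" 0]
        by (simp add: power2_eq_square algebra_simps)
      finally show "norm ((cmod (a * f x + b * g x))\<^sup>2) \<le> norm (2 * (cmod a)\<^sup>2 * (cmod (f x))\<^sup>2 + 2 * (cmod b)\<^sup>2 * (cmod (g x))\<^sup>2)"
        by (simp add: norm_mult power_mult_distrib)
    qed
    show "(\<lambda>x. (cmod (a * f x + b * g x))\<^sup>2) \<in> borel_measurable \<mu>"
      using measurable_\<mu>[OF m] by measurable
  qed (use assms L2_square_integrable in auto)
qed

lemma L2_diff: "f \<in> L2 T \<Longrightarrow> g \<in> L2 T \<Longrightarrow> (\<lambda>x. f x - g x) \<in> L2 T"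
  using L2_lin[of f g 1 "-1"] by simp

lemma L2_cmult: "f \<in> L2 T \<Longrightarrow> (\<lambda>x. a * f x) \<in> L2 T"
  using L2_lin[of f f a 0] by simp

lemma L2_zero: "(\<lambda>x. 0) \<in> L2 T"
  by (simp add: L2_iff periodic_def)

lemma L2_sum:
  assumes "finite J" "\<And>k. k \<in> J \<Longrightarrow> f k \<in> L2 T"
  shows "(\<lambda>x. \<Sum>k\<in>J. c k * f k x) \<in> L2 T"
  using assms
proof (induction J rule: finite_induct)
  case empty then show ?case by (simp add: L2_zero)
next
  case (insert k J)
  then show ?case using L2_lin[of "f k" "\<lambda>x. \<Sum>k\<in>J. c k * f k x" "c k" 1] by simp
qed

lemma L2_bounded:
  assumes "periodic T f" "f \<in> borel_measurable lebesgue" "AE x in \<mu>. cmod (f x) \<le> B"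
  shows "f \<in> L2 T"
  unfolding L2_iff
proof (intro conjI)
  show "integrable \<mu> (\<lambda>x. (cmod (f x))\<^sup>2)"
  proof (rule \<mu>.integrable_const_bound[of _ "B\<^sup>2"])
    show "AE x in \<mu>. norm ((cmod (f x))\<^sup>2) \<le> B\<^sup>2"
      using assms(3) by eventually_elim (auto intro!: power_mono)
    show "(\<lambda>x. (cmod (f x))\<^sup>2) \<in> borel_measurable \<mu>"
      using measurable_\<mu>[OF assms(2)] by measurable
  qed
qed (use assms in auto)

lemma L2_mult_bounded:
  assumes f: "f \<in> L2 T" and g: "periodic T g" "g \<in> borel_measurable lebesgue" "AE x in \<mu>. cmod (g x) \<le> B"
    and B: "B \<ge> 0"
  shows "(\<lambda>x. g x * f x) \<in> L2 T" "L2_norm T (\<lambda>x. g x * f x) \<le> B * L2_norm T f"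
proof -
  have m [measurable]: "f \<in> borel_measurable \<mu>" "g \<in> borel_measurable \<mu>"
    using f g L2_measurable measurable_\<mu> by auto
  have le: "AE x in \<mu>. (cmod (g x * f x))\<^sup>2 \<le> B\<^sup>2 * (cmod (f x))\<^sup>2"
    using g(3) by eventually_elim (auto simp: norm_mult power_mult_distrib intro!: mult_right_mono power_mono)
  have i: "integrable \<mu> (\<lambda>x. (cmod (g x * f x))\<^sup>2)"
  proof (rule Bochner_Integration.integrable_bound[of _ "\<lambda>x. B\<^sup>2 * (cmod (f x))\<^sup>2"])
    show "AE x in \<mu>. norm ((cmod (g x * f x))\<^sup>2) \<le> norm (B\<^sup>2 * (cmod (f x))\<^sup>2)"
      using le by simp
  qed (use f L2_square_integrable in auto)
  show "(\<lambda>x. g x * f x) \<in> L2 T"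
    unfolding L2_iff using i f g L2_measurable[OF f] L2_periodic[OF f] by (auto simp: periodic_def)
  have "(LINT x|\<mu>. (cmod (g x * f x))\<^sup>2) \<le> (LINT x|\<mu>. B\<^sup>2 * (cmod (f x))\<^sup>2)"
    by (rule integral_mono_AE[OF i _ le]) (use f L2_square_integrable in auto)
  then have "sqrt (LINT x|\<mu>. (cmod (g x * f x))\<^sup>2) \<le> sqrt (B\<^sup>2 * (LINT x|\<mu>. (cmod (f x))\<^sup>2))"
    by simp
  then show "L2_norm T (\<lambda>x. g x * f x) \<le> B * L2_norm T f"
    unfolding L2_norm_eq using B by (simp add: real_sqrt_mult)
qed

lemma basis_L2: "bas j \<in> L2 T"
  by (rule L2_bounded[of _ "1 / sqrt T"]) (auto simp: basis_periodic)

section \<open>Elementary properties of the coefficients\<close>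

lemma fourier_coeff_cong:
  assumes "AE x in lebesgue. f x = g x"
    and "f \<in> borel_measurable lebesgue" "g \<in> borel_measurable lebesgue"
  shows "fc f j = fc g j"
proof -
  note [measurable] = assms(2,3)[THEN measurable_\<mu>]
  show ?thesis
    unfolding fourier_coeff_eq cnj_basis using AE_\<mu>[OF assms(1)]
    by (intro integral_cong_AE) auto
qed

lemma L2_norm_cong:
  assumes "AE x in lebesgue. f x = g x"
    and "f \<in> borel_measurable lebesgue" "g \<in> borel_measurable lebesgue"
  shows "L2_norm T f = L2_norm T g"
  unfolding L2_norm_eq using AE_\<mu>[OF assms(1)] assms(2,3)[THEN measurable_\<mu>]
  by (intro arg_cong[where f=sqrt] integral_cong_AE) auto

lemma fourier_coeff_lin:
  assumes "integrable \<mu> f" "integrable \<mu> g"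
  shows "fc (\<lambda>x. a * f x + b * g x) j = a * fc f j + b * fc g j"
proof -
  have "fc (\<lambda>x. a * f x + b * g x) j
      = (LINT x|\<mu>. a * (f x * cnj (bas j x)) + b * (g x * cnj (bas j x)))"
    unfolding fourier_coeff_eq by (simp add: algebra_simps)
  also have "\<dots> = a * fc f j + b * fc g j"
    unfolding fourier_coeff_eq using assms[THEN integrable_mult_basis(2)] by simp
  finally show ?thesis .
qed

lemma fourier_coeff_diff:
  assumes "integrable \<mu> f" "integrable \<mu> g"
  shows "fc (\<lambda>x. f x - g x) j = fc f j - fc g j"
  using fourier_coeff_lin[OF assms, of 1 "-1"] by simp

lemma fourier_coeff_cmult:
  "fc (\<lambda>x. a * f x) j = a * fc f j"
  unfolding fourier_coeff_eq by (simp add: mult.assoc)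

lemma fourier_coeff_sum:
  assumes "finite J" "\<And>k. k \<in> J \<Longrightarrow> f k \<in> L2 T"
  shows "fc (\<lambda>x. \<Sum>k\<in>J. c k * f k x) j = (\<Sum>k\<in>J. c k * fc (f k) j)"
  using assms
proof (induction J rule: finite_induct)
  case empty then show ?case by (simp add: fourier_coeff_eq)
next
  case (insert k J)
  then show ?case
    using fourier_coeff_lin[of "f k" "\<lambda>x. \<Sum>k\<in>J. c k * f k x" "c k" 1 j] L2_sum[of J f c]
    by (simp add: L2_integrable)
qed

lemma L2_norm_nonneg: "L2_norm T f \<ge> 0"
  by (simp add: L2_norm_eq)

lemma L2_norm_power2: "(L2_norm T f)\<^sup>2 = (LINT x|\<mu>. (cmod (f x))\<^sup>2)"
  by (simp add: L2_norm_eq)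

text \<open>With \<open>a\<close> the integral of \<open>cmod (f x)\<close>, expanding the
  nonnegative integral of \<open>(T * cmod (f x) - a)\<^sup>2\<close> is the Cauchy-Schwarz
  inequality against a constant function.\<close>

lemma L1_le_L2:
  assumes "f \<in> L2 T"
  shows "(LINT x|\<mu>. cmod (f x)) \<le> sqrt T * L2_norm T f"
proof -
  let ?a = "LINT x|\<mu>. cmod (f x)"
  have i: "integrable \<mu> (\<lambda>x. cmod (f x))" using L2_integrable[OF assms] by simp
  have "0 \<le> (LINT x|\<mu>. (T * cmod (f x) - ?a)\<^sup>2)" by simp
  also have "\<dots> = (LINT x|\<mu>. T\<^sup>2 * (cmod (f x))\<^sup>2 - 2 * T * ?a * cmod (f x) + ?a\<^sup>2)"
    by (intro Bochner_Integration.integral_cong) (auto simp: power2_eq_square algebra_simps)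
  also have "\<dots> = T\<^sup>2 * (L2_norm T f)\<^sup>2 - 2 * T * ?a * ?a + ?a\<^sup>2 * T"
    using i L2_square_integrable[OF assms] by (simp add: L2_norm_power2 measure_\<mu>)
  also have "\<dots> = T * (T * (L2_norm T f)\<^sup>2 - ?a\<^sup>2)" by (simp add: power2_eq_square algebra_simps)
  finally have "?a\<^sup>2 \<le> T * (L2_norm T f)\<^sup>2" using T_pos by (simp add: zero_le_mult_iff)
  then have "?a\<^sup>2 \<le> (sqrt T * L2_norm T f)\<^sup>2" using T_pos by (simp add: power_mult_distrib)
  then show ?thesis by (rule power2_le_imp_le) (use T_pos L2_norm_nonneg in auto)
qed

lemma fourier_coeff_le_integral:
  assumes "integrable \<mu> f"
  shows "cmod (fc f j) \<le> (LINT x|\<mu>. cmod (f x)) / sqrt T"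
proof -
  have "cmod (fc f j) \<le> (LINT x|\<mu>. cmod (f x * cnj (bas j x)))"
    unfolding fourier_coeff_eq by (rule integral_norm_bound)
  then show ?thesis by (simp add: norm_mult)
qed

lemma fourier_coeff_le_L2_norm:
  assumes "f \<in> L2 T"
  shows "cmod (fc f j) \<le> L2_norm T f"
proof -
  have "cmod (fc f j) \<le> sqrt T * L2_norm T f / sqrt T"
    using fourier_coeff_le_integral[OF L2_integrable[OF assms], of j]
      divide_right_mono[OF L1_le_L2[OF assms], of "sqrt T"] T_pos by simp
  then show ?thesis using T_pos by simp
qed

lemma fourier_coeff_basis: "fc (bas k) j = (if k = j then 1 else 0)"
proof (cases "k = j")
  case True
  have "fc (bas k) j = (LINT x|\<mu>. of_real (1/T))"
    unfolding fourier_coeff_eq using True T_pos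
    by (intro Bochner_Integration.integral_cong) (auto simp: complex_norm_square[symmetric] power_divide)
  then show ?thesis using True T_pos by (simp add: measure_\<mu> scaleR_conv_of_real)
next
  case False
  \<comment> \<open>The product of two distinct exponentials oscillates with frequency
    \<open>w\<close>, and its antiderivative takes equal values at both ends of the period.\<close>
  define w where "w = - 2 * pi * of_int (k - j) / T"
  have w: "w \<noteq> 0" using False T_pos by (simp add: w_def)
  let ?F = "\<lambda>x. of_real (1 / T) * cis (w * x) / (\<i> * of_real w)"
  have eq: "bas k x * cnj (bas j x) = of_real (1 / T) * cis (w * x)" for x
    using T_pos unfolding cnj_basis basis_mult
    by (simp add: basis_fun_eq w_def mult.assoc[symmetric] flip: of_real_mult)
  have "(LBINT x:{-T/2..T/2}. of_real (1 / T) * cis (w * x)) = ?F (T/2) - ?F (-T/2)"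
    unfolding set_lebesgue_integral_def
  proof (rule integral_FTC_Icc)
    show "-T/2 \<le> T/2" using T_pos by simp
    show "continuous_on {-T/2..T/2} (\<lambda>x. of_real (1 / T) * cis (w * x))" by (intro continuous_intros)
    fix x
    show "(?F has_vector_derivative of_real (1 / T) * cis (w * x)) (at x within {-T/2..T/2})"
    proof -
      have "((\<lambda>z. of_real (1 / T) * exp (\<i> * (of_real w * z)) / (\<i> * of_real w)) has_field_derivative
          of_real (1 / T) * exp (\<i> * (of_real w * of_real x))) (at (of_real x))"
        using w T_pos by (auto intro!: derivative_eq_intros)
      from has_vector_derivative_real_field[OF this] show ?thesis by (simp add: cis_conv_exp)
    qed
  qed
  also have "cis (w * (T/2)) = cis (w * (-T/2))"
  proof -
    have "w * (T/2) = w * (-T/2) + 2 * pi * of_int (-(k-j))" using T_pos by (simp add: w_def field_simps)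
    then have "cis (w * (T/2)) = cis (w * (-T/2)) * cis (2 * pi * of_int (-(k-j)))"
      by (simp only: cis_mult)
    also have "cis (2 * pi * of_int (-(k-j))) = 1" by (rule cis_multiple_2pi) simp
    finally show ?thesis by simp
  qed
  then have "?F (T/2) - ?F (-T/2) = 0" by simp
  finally have "(LBINT x:{-T/2..T/2}. of_real (1 / T) * cis (w * x)) = 0" .
  moreover have "fc (bas k) j = (LBINT x:{-T/2..T/2}. of_real (1 / T) * cis (w * x))"
  proof -
    have [measurable]: "(\<lambda>x. of_real (1 / T) * cis (w * x)) \<in> borel_measurable borel"
      by (intro borel_measurable_continuous_onI continuous_intros)
    show ?thesis
      unfolding fourier_coeff_def eq set_lebesgue_integral_def
      by (rule integral_completion) measurable
  qed
  ultimately show ?thesis using False by simp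
qed

section \<open>Uniqueness of Fourier coefficients\<close>


text \<open>Wraps the period onto the unit circle, a compact subset of the plane, which is the
  setting in which Stone-Weierstrass can be applied to periodic functions.\<close>

definition circ :: "real \<Rightarrow> complex" where "circ x = cis (2 * pi * x / T)"

lemma circ_sphere: "circ x \<in> sphere 0 1"
  by (simp add: circ_def)

lemma continuous_circ: "continuous_on S circ"
  unfolding circ_def using T_pos by (intro continuous_intros) auto

lemma circ_measurable [measurable]: "circ \<in> borel_measurable \<mu>"
proof -
  have "circ \<in> borel_measurable borel"
    by (rule borel_measurable_continuous_onI[OF continuous_circ])
  then have "circ \<in> borel_measurable lebesgue" by (simp add: measurable_completion)
  then show ?thesis by (rule measurable_\<mu>)
qed

lemma circ_basis:
  "circ x = of_real (sqrt T) * bas (-1) x" "cnj (circ x) = of_real (sqrt T) * bas 1 x"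
  using T_pos by (simp_all add: circ_def basis_fun_eq cis_cnj mult.assoc[symmetric] flip: of_real_mult)

text \<open>Both endpoints of the period have the same image, so one of the two points has to be
  interior. This is the origin of the condition \<open>C \<subseteq> {-T/2<..<T/2}\<close> in the
  lemmas on closed sets.\<close>

lemma circ_eqD:
  assumes "circ x = circ y" "-T/2 \<le> x" "x \<le> T/2" "-T/2 < y" "y < T/2"
  shows "x = y"
proof -
  from assms(1) have "cos (2 * pi * x / T) = cos (2 * pi * y / T)" "sin (2 * pi * x / T) = sin (2 * pi * y / T)"
    by (auto simp: circ_def complex_eq_iff)
  then obtain n :: int where n: "2 * pi * x / T = 2 * pi * y / T + 2 * pi * n"
    using sin_cos_eq_iff by blast
  then have "2 * pi * x = 2 * pi * (y + T * n)" using T_pos by (simp add: field_simps)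
  then have xy: "x - y = T * n" by simp
  with assms have "T * real_of_int n < T * 1" "T * (-1) < T * real_of_int n" by linarith+
  then have "real_of_int n < 1" "-1 < real_of_int n" using T_pos by (simp_all only: mult_less_cancel_left_pos)
  then have "n = 0" by linarith
  with xy show ?thesis by simp
qed

definition coeff_null :: "(real \<Rightarrow> complex) set" where
  "coeff_null = {g. integrable \<mu> g \<and> (\<forall>j. fc g j = 0)}"

lemma fourier_coeff_mult_basis:
  "fc (\<lambda>x. bas k x * g x) j = of_real (1 / sqrt T) * fc g (j - k)"
proof -
  have "bas k x * g x * cnj (bas j x) = of_real (1 / sqrt T) * (g x * cnj (bas (j - k) x))" for x
    using basis_mult[of k x "-j"] unfolding cnj_basis by (simp add: algebra_simps)
  then show ?thesis unfolding fourier_coeff_eq by simp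
qed

lemma coeff_null_basis: "g \<in> coeff_null \<Longrightarrow> (\<lambda>x. bas k x * g x) \<in> coeff_null"
  using integrable_mult_basis(1)[of g k] unfolding mult.commute[of _ "bas k _"]
  by (auto simp: coeff_null_def fourier_coeff_mult_basis)

lemma coeff_null_lin:
  "f \<in> coeff_null \<Longrightarrow> g \<in> coeff_null \<Longrightarrow> (\<lambda>x. a * f x + b * g x) \<in> coeff_null"
  by (auto simp: coeff_null_def fourier_coeff_lin)

text \<open>The functions with vanishing coefficients form a module over the polynomials in \<open>circ\<close>, which
  are dense in the continuous functions on the circle by Stone-Weierstrass.\<close>

lemma coeff_null_poly:
  fixes p :: "complex \<Rightarrow> real"
  assumes "real_polynomial_function p"
  shows "g \<in> coeff_null \<Longrightarrow> (\<lambda>x. of_real (p (circ x)) * g x) \<in> coeff_null"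
  using assms
proof (induction p arbitrary: g)
  case (linear f)
  have f: "f z = Re z * f 1 + Im z * f \<i>" for z
  proof -
    interpret bounded_linear f by fact
    have "z = Re z *\<^sub>R 1 + Im z *\<^sub>R \<i>" by (simp add: complex_eq_iff)
    then have "f z = f (Re z *\<^sub>R 1 + Im z *\<^sub>R \<i>)" by simp
    then show ?thesis by (simp add: add scaleR)
  qed
  \<comment> \<open>A real-linear functional of \<open>z\<close> is a combination of
    \<open>z\<close> and \<open>cnj z\<close>, which on the circle are multiples of
    \<open>bas (-1)\<close> and \<open>bas 1\<close>; \<open>a\<close> and \<open>b\<close> are the
    resulting coefficients.\<close>
  define a b where "a = of_real (sqrt T) * (of_real (f 1) - \<i> * of_real (f \<i>)) / 2"
    and "b = of_real (sqrt T) * (of_real (f 1) + \<i> * of_real (f \<i>)) / 2"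
  have "of_real (f (circ x)) = a * bas (-1) x + b * bas 1 x" for x
  proof -
    have "of_real (f z) = (of_real (f 1) - \<i> * of_real (f \<i>)) / 2 * z + (of_real (f 1) + \<i> * of_real (f \<i>)) / 2 * cnj z" for z
      by (subst f) (simp add: complex_eq_iff field_simps)
    from this[of "circ x"] show ?thesis unfolding circ_basis(2) unfolding circ_basis(1) a_def b_def
      by (simp add: mult_ac)
  qed
  then have eq: "(\<lambda>x. of_real (f (circ x)) * g x)
      = (\<lambda>x. a * (bas (-1) x * g x) + b * (bas 1 x * g x))"
    by (simp add: algebra_simps)
  show ?case unfolding eq
    by (intro coeff_null_lin coeff_null_basis linear)
next
  case (const c)
  show ?case using coeff_null_lin[OF const const, of "of_real c" 0] by simp
next
  case (add f h)
  show ?case using coeff_null_lin[OF add.IH(1)[OF add.prems] add.IH(2)[OF add.prems], of 1 1]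
    by (simp add: algebra_simps)
next
  case (mult f h)
  show ?case using mult.IH(1)[OF mult.IH(2)[OF mult.prems]] by (simp add: algebra_simps)
qed

lemma coeff_null_integral:
  assumes "g \<in> coeff_null" shows "integral\<^sup>L \<mu> g = 0"
proof -
  have "fc g 0 = 0" using assms by (simp add: coeff_null_def)
  then show ?thesis using T_pos by (simp add: fourier_coeff_eq basis_fun_eq)
qed

text \<open>A polynomial uniformly within \<open>e\<close> of \<phi> on the unit circle contributes
  integral zero, which leaves at most \<open>e\<close> times the L1 norm of
  \<open>g\<close>.\<close>

lemma coeff_null_continuous:
  fixes \<phi> :: "complex \<Rightarrow> real"
  assumes g: "g \<in> coeff_null" and \<phi>: "continuous_on UNIV \<phi>"
  shows "(LINT x|\<mu>. of_real (\<phi> (circ x)) * g x) = 0"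
proof -
  have ig: "integrable \<mu> g" using g by (simp add: coeff_null_def)
  have [measurable]: "\<phi> \<in> borel_measurable borel" by (rule borel_measurable_continuous_onI[OF \<phi>])
  have "bounded (\<phi> ` sphere 0 1)"
    by (intro compact_imp_bounded compact_continuous_image continuous_on_subset[OF \<phi>]) auto
  then obtain B where "\<forall>y\<in>\<phi> ` sphere 0 1. norm y \<le> B" unfolding bounded_iff by blast
  then have B: "\<And>z. z \<in> sphere 0 1 \<Longrightarrow> \<bar>\<phi> z\<bar> \<le> B" by auto
  have i1: "integrable \<mu> (\<lambda>x. of_real (\<phi> (circ x)) * g x)"
    unfolding mult.commute[of "of_real _"]
    by (rule integrable_mult_bounded[OF ig, of _ B]) (use B circ_sphere in auto)
  have "cmod (LINT x|\<mu>. of_real (\<phi> (circ x)) * g x) \<le> e * (LINT x|\<mu>. cmod (g x))" if e: "e > 0" for e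
  proof -
    obtain p where p: "real_polynomial_function p" "\<And>z. z \<in> sphere 0 1 \<Longrightarrow> \<bar>\<phi> z - p z\<bar> < e"
      using Stone_Weierstrass_real_polynomial_function[OF compact_sphere continuous_on_subset[OF \<phi>] e, of 0 1]
      by auto
    have n: "(\<lambda>x. of_real (p (circ x)) * g x) \<in> coeff_null" by (rule coeff_null_poly[OF p(1) g])
    have "(LINT x|\<mu>. of_real (\<phi> (circ x)) * g x)
        = (LINT x|\<mu>. of_real (\<phi> (circ x)) * g x - of_real (p (circ x)) * g x)"
      using n i1 coeff_null_integral[OF n] by (simp add: coeff_null_def)
    also have "cmod \<dots> \<le> (LINT x|\<mu>. e * cmod (g x))"
    proof (rule order_trans[OF integral_norm_bound integral_mono])
      show "integrable \<mu> (\<lambda>x. cmod (of_real (\<phi> (circ x)) * g x - of_real (p (circ x)) * g x))"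
        using n i1 by (auto simp: coeff_null_def)
      show "integrable \<mu> (\<lambda>x. e * cmod (g x))" using ig by auto
      fix x
      have "cmod (of_real (\<phi> (circ x)) * g x - of_real (p (circ x)) * g x) = \<bar>\<phi> (circ x) - p (circ x)\<bar> * cmod (g x)"
        by (simp add: norm_mult flip: left_diff_distrib of_real_diff)
      also have "\<dots> \<le> e * cmod (g x)" by (intro mult_right_mono less_imp_le[OF p(2)] circ_sphere) auto
      finally show "cmod (of_real (\<phi> (circ x)) * g x - of_real (p (circ x)) * g x) \<le> e * cmod (g x)" .
    qed
    finally show ?thesis by simp
  qed
  note le = this
  have "cmod (LINT x|\<mu>. of_real (\<phi> (circ x)) * g x) \<le> 0 + e" if e: "e > 0" for e
  proof -
    define L where "L = (LINT x|\<mu>. cmod (g x))"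
    have L: "L \<ge> 0" by (simp add: L_def)
    \<comment> \<open>Dividing by \<open>L + 1\<close> instead of \<open>L\<close> covers the case
      of a vanishing norm.\<close>
    then have "e / (L + 1) * L \<le> e" using e by (simp add: field_simps)
    moreover have "0 < e / (L + 1)" using L e by simp
    ultimately show ?thesis using le[of "e / (L + 1)"] unfolding L_def[symmetric] by linarith
  qed
  then show ?thesis using field_le_epsilon by (metis norm_le_zero_iff)
qed

text \<open>Tent functions of the distance to the image of \<open>C\<close> on the circle are
  continuous and converge to the indicator of that image; dominated convergence applies with
  majorant \<open>cmod (g x)\<close>. Since \<open>C\<close> avoids the endpoints, the indicator
  pulls back to that of \<open>C\<close>.\<close>

lemma coeff_null_closed:
  assumes g: "g \<in> coeff_null" and C: "closed C" "C \<subseteq> {-T/2<..<T/2}"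
  shows "(LINT x|\<mu>. indicat_real C x *\<^sub>R g x) = 0"
proof (cases "C = {}")
  case True then show ?thesis by simp
next
  case False
  have ig: "integrable \<mu> g" using g by (simp add: coeff_null_def)
  have [measurable]: "g \<in> borel_measurable \<mu>" using ig by auto
  define K where "K = circ ` C"
  have "compact C"
  proof -
    have "C \<subseteq> {-T/2..T/2}" using C by force
    then have "bounded C" by (rule bounded_subset[rotated]) simp
    with C show ?thesis by (simp add: compact_eq_bounded_closed)
  qed
  then have K: "closed K" "K \<noteq> {}"
    unfolding K_def using False by (auto intro!: compact_imp_closed compact_continuous_image continuous_circ)
  define \<phi> where "\<phi> n z = max 0 (1 - real n * infdist z K)" for n z
  have \<phi>c: "continuous_on UNIV (\<phi> n)" for n
    unfolding \<phi>_def by (intro continuous_intros)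
  have [measurable]: "\<phi> n \<in> borel_measurable borel" for n by (rule borel_measurable_continuous_onI[OF \<phi>c])
  have lim: "(\<lambda>n. \<phi> n z) \<longlonglongrightarrow> indicat_real K z" for z
  proof (cases "z \<in> K")
    case True then show ?thesis by (simp add: \<phi>_def)
  next
    case False
    then have pos: "infdist z K > 0" using K by (metis in_closed_iff_infdist_zero infdist_nonneg less_eq_real_def)
    then obtain N :: nat where N: "1 < real N * infdist z K" using reals_Archimedean3 by blast
    have "\<phi> n z = 0" if "n \<ge> N" for n
    proof -
      have "real N * infdist z K \<le> real n * infdist z K" using that pos by (intro mult_right_mono) auto
      then show ?thesis using N by (simp add: \<phi>_def)
    qed
    then have "eventually (\<lambda>n. \<phi> n z = 0) sequentially" by (auto simp: eventually_sequentially)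
    with False show ?thesis by (simp add: tendsto_eventually)
  qed
  have ind: "indicat_real K (circ x) = indicat_real C x" if "x \<in> space \<mu>" for x
    using that C circ_eqD[of x] unfolding K_def space_\<mu> by (force simp: indicator_def)
  have Cb: "C \<in> sets \<mu>"
    unfolding \<mu>_def using C by (subst sets_restrict_space_iff) auto
  have "(\<lambda>n. LINT x|\<mu>. of_real (\<phi> n (circ x)) * g x) \<longlonglongrightarrow> (LINT x|\<mu>. indicat_real C x *\<^sub>R g x)"
  proof (rule integral_dominated_convergence[where w="\<lambda>x. cmod (g x)"])
    show "AE x in \<mu>. (\<lambda>n. of_real (\<phi> n (circ x)) * g x) \<longlonglongrightarrow> indicat_real C x *\<^sub>R g x"
    proof (rule AE_I2)
      fix x assume x: "x \<in> space \<mu>"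
      show "(\<lambda>n. of_real (\<phi> n (circ x)) * g x) \<longlonglongrightarrow> indicat_real C x *\<^sub>R g x"
        unfolding ind[OF x, symmetric] scaleR_conv_of_real by (intro tendsto_intros lim)
    qed
    fix n
    show "AE x in \<mu>. cmod (of_real (\<phi> n (circ x)) * g x) \<le> cmod (g x)"
      by (auto simp: norm_mult \<phi>_def infdist_nonneg intro!: mult_left_le_one_le)
  qed (use ig Cb in auto)
  then show ?thesis
    by (simp add: coeff_null_continuous[OF g \<phi>c] LIMSEQ_const_iff)
qed

text \<open>Inner regularity: a closed \<open>K\<close> inside the set where \<open>h\<close> is
  positive carries a vanishing integral of a positive function, so \<open>K\<close> is null, and the
  set has measure at most every \<open>e > 0\<close>. The endpoints are cut off first because the
  closed sets must lie in the open interval.\<close>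

lemma AE_le_0_of_closed:
  fixes h :: "real \<Rightarrow> real"
  assumes h: "integrable \<mu> h"
    and C: "\<And>C. closed C \<Longrightarrow> C \<subseteq> {-T/2<..<T/2} \<Longrightarrow> (LINT x|\<mu>. indicat_real C x *\<^sub>R h x) = 0"
  shows "AE x in \<mu>. h x \<le> 0"
proof -
  have [measurable]: "h \<in> borel_measurable \<mu>" using h by auto
  define E where "E = {x \<in> space \<mu>. h x > 0} \<inter> {-T/2<..<T/2}"
  have E\<mu>: "E \<in> sets \<mu>"
  proof -
    have "{-T/2<..<T/2} \<in> sets \<mu>" unfolding \<mu>_def by (subst sets_restrict_space_iff) auto
    then show ?thesis unfolding E_def by measurable
  qed
  then have E: "E \<in> sets lebesgue"
    unfolding \<mu>_def by (subst (asm) sets_restrict_space_iff) auto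
  have small: "emeasure lebesgue E \<le> ennreal e" if e: "e > 0" for e
  proof -
    obtain K where K: "closed K" "K \<subseteq> E" "E - K \<in> lmeasurable" "emeasure lebesgue (E - K) < ennreal e"
      using sets_lebesgue_inner_closed[OF E e] by metis
    have K\<mu>: "K \<in> sets \<mu>"
      unfolding \<mu>_def using K by (subst sets_restrict_space_iff) (auto simp: E_def space_\<mu>)
    have "(LINT x|\<mu>. indicat_real K x *\<^sub>R h x) = 0" using K by (intro C) (auto simp: E_def)
    moreover have "integrable \<mu> (\<lambda>x. indicat_real K x *\<^sub>R h x)"
      using h K\<mu> by (intro integrable_mult_indicator)
    moreover have nn: "AE x in \<mu>. 0 \<le> indicat_real K x *\<^sub>R h x"
      using K by (intro AE_I2) (auto simp: indicator_def E_def)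
    ultimately have "AE x in \<mu>. indicat_real K x *\<^sub>R h x = 0"
      using integral_nonneg_eq_0_iff_AE by blast
    then have "AE x in \<mu>. x \<notin> K"
      by eventually_elim (use K in \<open>auto simp: E_def indicator_def split: if_splits\<close>)
    then have "K \<in> null_sets \<mu>" using AE_iff_null_sets[OF K\<mu>] by simp
    then have "emeasure lebesgue K = 0"
      using K unfolding \<mu>_def by (subst (asm) null_sets_restrict_space) auto
    moreover have "emeasure lebesgue E \<le> emeasure lebesgue K + emeasure lebesgue (E - K)"
    proof -
      have "E = K \<union> (E - K)" using K by auto
      then show ?thesis using emeasure_subadditive[of K lebesgue "E - K"] K E by auto
    qed
    ultimately show ?thesis using K by simp
  qed
  have "emeasure lebesgue E = 0"
  proof (rule ccontr)
    assume "emeasure lebesgue E \<noteq> 0"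
    then have pos: "0 < emeasure lebesgue E" by (simp add: zero_less_iff_neq_zero)
    then obtain a where a: "0 < a" "a < emeasure lebesgue E" using dense by blast
    define e where "e = enn2real a"
    have "a < top" using a(2) by (rule order.strict_trans2) simp
    then have "0 < e" "ennreal e < emeasure lebesgue E"
      using a by (auto simp: e_def enn2real_positive_iff)
    with small[of e] show False by simp
  qed
  then have En: "AE x in lebesgue. x \<notin> E" using E by (intro AE_not_in) (auto simp: null_sets_def)
  have ends: "AE x in lebesgue. x \<noteq> -T/2 \<and> x \<noteq> T/2"
  proof -
    have "AE x in lebesgue. x \<notin> {-T/2, T/2}" by (intro AE_not_in) (simp flip: negligible_iff_null_sets)
    then show ?thesis by eventually_elim auto
  qed
  have "AE x in lebesgue. x \<in> {-T/2..T/2} \<longrightarrow> h x \<le> 0"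
    using En ends by eventually_elim (auto simp: E_def space_\<mu>)
  then show ?thesis unfolding \<mu>_def by (subst AE_restrict_space_iff) auto
qed

text \<open>\<open>AE_le_0_of_closed\<close> is one-sided, so it is applied to both signs of the
  real and of the imaginary part.\<close>

lemma fourier_coeff_unique:
  assumes g: "integrable \<mu> g" "\<And>j. fc g j = 0"
  shows "AE x in \<mu>. g x = 0"
proof -
  have n: "g \<in> coeff_null" using g by (simp add: coeff_null_def)
  have *: "AE x in \<mu>. c * Re (g x) + d * Im (g x) \<le> 0" for c d :: real
  proof (rule AE_le_0_of_closed)
    show "integrable \<mu> (\<lambda>x. c * Re (g x) + d * Im (g x))"
      using g(1) by (intro Bochner_Integration.integrable_add integrable_mult_right integrable_Re integrable_Im)
    fix C assume C: "closed C" "C \<subseteq> {-T/2<..<T/2}"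
    have Cb: "C \<in> sets \<mu>"
      unfolding \<mu>_def using C by (subst sets_restrict_space_iff) auto
    have i: "integrable \<mu> (\<lambda>x. indicat_real C x *\<^sub>R g x)"
      by (rule integrable_mult_indicator[OF Cb g(1)])
    have "(LINT x|\<mu>. indicat_real C x *\<^sub>R (c * Re (g x) + d * Im (g x)))
       = (LINT x|\<mu>. c * Re (indicat_real C x *\<^sub>R g x) + d * Im (indicat_real C x *\<^sub>R g x))"
      by (simp add: algebra_simps)
    also have "\<dots> = c * Re (LINT x|\<mu>. indicat_real C x *\<^sub>R g x) + d * Im (LINT x|\<mu>. indicat_real C x *\<^sub>R g x)"
      using i integrable_Re[OF i] integrable_Im[OF i] integral_Re[OF i] integral_Im[OF i] by simp
    also have "\<dots> = 0" by (simp only: coeff_null_closed[OF n C]) simp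
    finally show "(LINT x|\<mu>. indicat_real C x *\<^sub>R (c * Re (g x) + d * Im (g x))) = 0" .
  qed
  show ?thesis
    using *[of 1 0] *[of "-1" 0] *[of 0 1] *[of 0 "-1"]
    by eventually_elim (simp add: complex_eq_iff)
qed

end

section \<open>The Wiener algebra\<close>

abbreviation isum :: "(int \<Rightarrow> ennreal) \<Rightarrow> ennreal" where
  "isum f \<equiv> integral\<^sup>N (count_space UNIV) f"

lemma nn_integral_int_eq_suminf:
  "(isum (\<lambda>j. f j)) = (\<Sum>n. f (int_decode n))"
  by (subst nn_integral_bij_count_space[OF bij_int_decode, symmetric])
     (rule nn_integral_count_space_nat)

lemma ennreal_norm_sums_le:
  fixes f :: "nat \<Rightarrow> 'a::banach"
  assumes "f sums s"
  shows "ennreal (norm s) \<le> (\<Sum>n. ennreal (norm (f n)))"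
proof (cases "(\<Sum>n. ennreal (norm (f n))) = top")
  case False
  then have s: "summable (\<lambda>n. norm (f n))" by (intro summable_suminf_not_top) auto
  then have "norm s \<le> (\<Sum>n. norm (f n))" using summable_norm[OF s] assms by (simp add: sums_iff)
  then have "ennreal (norm s) \<le> ennreal (\<Sum>n. norm (f n))" by (rule ennreal_leI)
  also have "\<dots> = (\<Sum>n. ennreal (norm (f n)))" using s by (intro suminf_ennreal2[symmetric]) auto
  finally show ?thesis .
qed simp

text \<open>Tonelli, followed by translation invariance of the counting measure.\<close>

lemma nn_integral_convolution_int:
  fixes a b :: "int \<Rightarrow> ennreal"
  shows "(\<integral>\<^sup>+ j. \<integral>\<^sup>+ k. a k * b (j - k) \<partial>count_space UNIV \<partial>count_space UNIV)
     = (isum (\<lambda>k. a k)) * (isum (\<lambda>k. b k))"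
proof -
  have "(\<integral>\<^sup>+ j. \<integral>\<^sup>+ k. a k * b (j - k) \<partial>count_space UNIV \<partial>count_space UNIV)
     = (\<integral>\<^sup>+ k. \<integral>\<^sup>+ j. a k * b (j - k) \<partial>count_space UNIV \<partial>count_space UNIV)"
    by (rule nn_integral_count_space_nn_integral) auto
  also have "\<dots> = (\<integral>\<^sup>+ k. a k * (isum (\<lambda>j. b j)) \<partial>count_space UNIV)"
  proof (rule nn_integral_cong)
    fix k :: int
    have "bij (\<lambda>j. j - k)" by (rule bij_betw_byWitness[where f'="\<lambda>j. j + k"]) auto
    then show "(isum (\<lambda>j. a k * b (j - k))) = a k * (isum (\<lambda>j. b j))"
      by (subst nn_integral_cmult) (auto simp: nn_integral_bij_count_space[of "\<lambda>j. j - k" UNIV UNIV b])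
  qed
  finally show ?thesis by (simp add: nn_integral_multc)
qed

context circle begin

text \<open>\<open>int_decode\<close> turns the bilateral series into one over the naturals. For
  coefficients in \<open>l1\<close> it converges absolutely, so the enumeration does not affect the
  value.\<close>

definition trig :: "(int \<Rightarrow> complex) \<Rightarrow> real \<Rightarrow> complex" where
  "trig c x = (\<Sum>n. c (int_decode n) * bas (int_decode n) x)"

definition l1 :: "(int \<Rightarrow> complex) set" where
  "l1 = {c. (isum (\<lambda>j. ennreal (cmod (c j)))) < \<infinity>}"

definition wnorm :: "(int \<Rightarrow> real) \<Rightarrow> (real \<Rightarrow> complex) \<Rightarrow> ennreal" where
  "wnorm w f = (isum (\<lambda>j. ennreal (w j * cmod (fc f j))))"

abbreviation anorm :: "(real \<Rightarrow> complex) \<Rightarrow> ennreal" where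
  "anorm \<equiv> wnorm (\<lambda>_. 1)"

definition wiener :: "(real \<Rightarrow> complex) set" where
  "wiener = {f \<in> L2 T. anorm f < \<infinity>}"

lemma anorm_eq: "anorm f = (isum (\<lambda>j. ennreal (cmod (fc f j))))"
  by (simp add: wnorm_def)

lemma l1_summable: "c \<in> l1 \<Longrightarrow> summable (\<lambda>n. cmod (c (int_decode n)))"
  unfolding l1_def by (intro summable_suminf_not_top) (auto simp: nn_integral_int_eq_suminf)

lemma l1_suminf:
  "c \<in> l1 \<Longrightarrow> (isum (\<lambda>j. ennreal (cmod (c j)))) = ennreal (\<Sum>n. cmod (c (int_decode n)))"
  using l1_summable by (simp add: nn_integral_int_eq_suminf suminf_ennreal2)

lemma trig_abs_summable:
  assumes "c \<in> l1" shows "summable (\<lambda>n. cmod (c (int_decode n) * bas (int_decode n) x))"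
  using summable_mult2[OF l1_summable[OF assms], of "1 / sqrt T"] by (simp add: norm_mult)

lemma cmod_trig_le:
  assumes "c \<in> l1" shows "cmod (trig c x) \<le> (\<Sum>n. cmod (c (int_decode n))) / sqrt T"
proof -
  have "cmod (trig c x) \<le> (\<Sum>n. cmod (c (int_decode n) * bas (int_decode n) x))"
    unfolding trig_def by (rule summable_norm[OF trig_abs_summable[OF assms]])
  also have "\<dots> = (\<Sum>n. cmod (c (int_decode n)) / sqrt T)" by (simp add: norm_mult)
  also have "\<dots> = (\<Sum>n. cmod (c (int_decode n))) / sqrt T"
    using suminf_divide[OF l1_summable[OF assms]] by simp
  finally show ?thesis .
qed

lemma trig_measurable [measurable]: "trig c \<in> borel_measurable lebesgue"
  unfolding trig_def by measurable

lemma trig_periodic: "periodic T (trig c)"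
  using basis_periodic by (simp add: periodic_def trig_def)

lemma trig_L2: "c \<in> l1 \<Longrightarrow> trig c \<in> L2 T"
  by (rule L2_bounded[OF trig_periodic trig_measurable AE_I2[OF cmod_trig_le]])

text \<open>The measure is left general because termwise integration is used both over one period,
  for coefficients, and over the whole line, against the convolution kernel.\<close>

lemma trig_mult_integral:
  fixes M :: "real measure"
  assumes c: "c \<in> l1" and g: "integrable M g"
    and [measurable]: "\<And>k. bas k \<in> borel_measurable M"
  shows "(\<lambda>n. c (int_decode n) * (LINT x|M. bas (int_decode n) x * g x)) sums (LINT x|M. trig c x * g x)"
    and "integrable M (\<lambda>x. trig c x * g x)"
proof -
  have [measurable]: "g \<in> borel_measurable M" using g by auto
  define F where "F n x = c (int_decode n) * (bas (int_decode n) x * g x)" for n x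
  have ie: "integrable M (\<lambda>x. bas k x * g x)" for k
    by (rule Bochner_Integration.integrable_bound[of _ "\<lambda>x. (1 / sqrt T) * cmod (g x)"])
       (use g T_pos in \<open>auto simp: norm_mult\<close>)
  have F: "integrable M (F n)" for n unfolding F_def using ie by (intro integrable_mult_right)
  have nF: "cmod (F n x) = cmod (c (int_decode n)) * (cmod (g x) / sqrt T)" for n x
    by (simp add: F_def norm_mult)
  have ae: "AE x in M. summable (\<lambda>n. norm (F n x))"
    unfolding nF by (intro AE_I2 summable_mult2 l1_summable c)
  have s: "summable (\<lambda>n. LINT x|M. norm (F n x))"
    unfolding nF using g by (simp add: summable_mult2 l1_summable c)
  have eq: "(\<Sum>n. F n x) = trig c x * g x" for x
  proof -
    have "F n x = c (int_decode n) * bas (int_decode n) x * g x" for n by (simp add: F_def)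
    then show ?thesis unfolding trig_def
      using suminf_mult2[OF summable_norm_cancel[OF trig_abs_summable[OF c]], of x "g x"] by simp
  qed
  have "(\<lambda>n. integral\<^sup>L M (F n)) sums (LINT x|M. (\<Sum>n. F n x))" by (rule sums_integral[OF F ae s])
  then show "(\<lambda>n. c (int_decode n) * (LINT x|M. bas (int_decode n) x * g x)) sums (LINT x|M. trig c x * g x)"
    unfolding eq by (simp add: F_def[abs_def])
  have "integrable M (\<lambda>x. \<Sum>n. F n x)" by (rule integrable_suminf[OF F ae s])
  then show "integrable M (\<lambda>x. trig c x * g x)" unfolding eq .
qed

lemma fourier_coeff_trig:
  assumes "c \<in> l1" shows "fc (trig c) j = c j"
proof -
  have "(\<lambda>n. c (int_decode n) * (LINT x|\<mu>. bas (int_decode n) x * cnj (bas j x)))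
      sums (LINT x|\<mu>. trig c x * cnj (bas j x))"
    by (rule trig_mult_integral(1)[OF assms]) (auto simp: cnj_basis L2_integrable basis_L2)
  then have "(\<lambda>n. c (int_decode n) * (if int_decode n = j then 1 else 0)) sums fc (trig c) j"
    unfolding fourier_coeff_eq[symmetric] fourier_coeff_basis .
  also have "(\<lambda>n. c (int_decode n) * (if int_decode n = j then 1 else 0)) = (\<lambda>n. if n = int_encode j then c j else 0)"
    by (auto simp: fun_eq_iff)
  finally have "(\<lambda>n. if n = int_encode j then c j else 0) sums fc (trig c) j" .
  moreover have "(\<lambda>n. if n = int_encode j then c j else 0) sums c j"
    using sums_single[of "int_encode j" "\<lambda>_. c j"] by simp
  ultimately show ?thesis by (rule sums_unique2)
qed

lemma wnorm_trig: "c \<in> l1 \<Longrightarrow> wnorm w (trig c) = (isum (\<lambda>j. ennreal (w j * cmod (c j))))"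
  by (simp add: wnorm_def fourier_coeff_trig)

lemma trig_wiener: "c \<in> l1 \<Longrightarrow> trig c \<in> wiener"
  unfolding wiener_def using trig_L2 wnorm_trig[of c "\<lambda>_. 1"] by (auto simp: l1_def)

lemma wiener_L2: "f \<in> wiener \<Longrightarrow> f \<in> L2 T"
  by (simp add: wiener_def)

lemma wiener_coeff_l1: "f \<in> wiener \<Longrightarrow> fc f \<in> l1"
  by (simp add: wiener_def l1_def anorm_eq)

text \<open>Countably many translates of a null set cover the exceptional points. The passage from
  one period to the line matters because functions are identified almost everywhere on the line and
  the kernel integrates over all of it.\<close>

lemma periodic_AE_lebesgue:
  assumes d: "periodic T d" and ae: "AE x in \<mu>. d x = (0::complex)"
  shows "AE x in lebesgue. d x = 0"
proof -
  have per: "d (x + of_int n * T) = d x" for x and n :: int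
  proof -
    have *: "d (x + real n * T) = d x" for x n
    proof (induction n)
      case (Suc n)
      have "d (x + real (Suc n) * T) = d ((x + real n * T) + T)" by (simp add: algebra_simps)
      also have "\<dots> = d x" using d Suc by (simp add: periodic_def)
      finally show ?case .
    qed simp
    show ?thesis
    proof (cases "n \<ge> 0")
      case True then show ?thesis using *[of x "nat n"] by simp
    next
      case False then show ?thesis using *[of "x + of_int n * T" "nat (-n)"] by simp
    qed
  qed
  have "AE x in lebesgue. x \<in> {-T/2..T/2} \<longrightarrow> d x = 0"
    using ae unfolding \<mu>_def by (subst (asm) AE_restrict_space_iff) auto
  then obtain N where N: "N \<in> null_sets lebesgue" "{x. \<not> (x \<in> {-T/2..T/2} \<longrightarrow> d x = 0)} \<subseteq> N"
    by (auto elim!: AE_E3 simp: eventually_ae_filter)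
  have "(\<Union>n::int. (+) (of_int n * T) ` N) \<in> null_sets lebesgue"
    using N(1) by (intro null_sets_UN) (simp add: negligible_translation flip: negligible_iff_null_sets)
  moreover have "{x \<in> space lebesgue. d x \<noteq> 0} \<subseteq> (\<Union>n::int. (+) (of_int n * T) ` N)"
  proof safe
    fix x assume x: "d x \<noteq> 0"
    \<comment> \<open>The index of the period, centred at a multiple of \<open>T\<close>, that
      contains \<open>x\<close>.\<close>
    define n where "n = \<lfloor>x / T + 1/2\<rfloor>"
    have "of_int n \<le> x / T + 1/2" "x / T + 1/2 < of_int n + 1" unfolding n_def by linarith+
    then have "of_int n * T \<le> (x / T + 1/2) * T" "(x / T + 1/2) * T \<le> (of_int n + 1) * T"
      using T_pos by (intro mult_right_mono; simp)+
    then have "x - of_int n * T \<in> {-T/2..T/2}" using T_pos by (simp add: algebra_simps)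
    moreover have "d (x - of_int n * T) \<noteq> 0" using per[of "x - of_int n * T" n] x by simp
    ultimately have "x - of_int n * T \<in> N" using N by auto
    then show "x \<in> (\<Union>n::int. (+) (of_int n * T) ` N)" by (intro UN_I[of n]) (auto intro!: image_eqI)
  qed
  ultimately show ?thesis by (auto simp: eventually_ae_filter)
qed

text \<open>The series built from the coefficients of \<open>f\<close> has these same coefficients,
  so the difference vanishes by uniqueness.\<close>

lemma wiener_expansion:
  assumes f: "f \<in> wiener" shows "AE x in lebesgue. f x = trig (fc f) x"
proof -
  let ?g = "trig (fc f)"
  have g: "?g \<in> L2 T" by (rule trig_L2[OF wiener_coeff_l1[OF f]])
  have d: "(\<lambda>x. f x - ?g x) \<in> L2 T" by (rule L2_diff[OF wiener_L2[OF f] g])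
  have "AE x in \<mu>. f x - ?g x = 0"
    by (rule fourier_coeff_unique)
      (use d g f in \<open>simp_all add: L2_integrable fourier_coeff_diff wiener_L2 fourier_coeff_trig wiener_coeff_l1\<close>)
  from periodic_AE_lebesgue[OF L2_periodic[OF d] this] show ?thesis by eventually_elim simp
qed

lemma wiener_AE_bound:
  assumes f: "f \<in> wiener" shows "AE x in lebesgue. ennreal (cmod (f x)) \<le> anorm f / ennreal (sqrt T)"
  using wiener_expansion[OF f]
proof eventually_elim
  case (elim x)
  then have "cmod (f x) \<le> (\<Sum>n. cmod (fc f (int_decode n))) / sqrt T"
    using cmod_trig_le[OF wiener_coeff_l1[OF f]] by simp
  then have "ennreal (cmod (f x)) \<le> ennreal ((\<Sum>n. cmod (fc f (int_decode n))) / sqrt T)"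
    by (rule ennreal_leI)
  also have "\<dots> = anorm f / ennreal (sqrt T)"
    using T_pos by (simp add: anorm_eq l1_suminf[OF wiener_coeff_l1[OF f]] divide_ennreal suminf_nonneg l1_summable[OF wiener_coeff_l1[OF f]])
  finally show ?case .
qed

lemma wiener_bounded:
  assumes f: "f \<in> wiener" obtains B where "B \<ge> 0" "AE x in \<mu>. cmod (f x) \<le> B"
proof -
  have "anorm f / ennreal (sqrt T) < \<infinity>" using f T_pos by (auto simp: wiener_def ennreal_divide_eq_top_iff less_top[symmetric])
  then obtain B where B: "B \<ge> 0" "anorm f / ennreal (sqrt T) = ennreal B" by (cases "anorm f / ennreal (sqrt T)") auto
  have "AE x in \<mu>. cmod (f x) \<le> B"
    using AE_\<mu>[OF wiener_AE_bound[OF f]] by eventually_elim (use B in simp)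
  with B that show ?thesis by blast
qed

section \<open>Products and conjugates in the algebra\<close>

lemma wiener_mult_L2: "f \<in> wiener \<Longrightarrow> g \<in> L2 T \<Longrightarrow> (\<lambda>x. f x * g x) \<in> L2 T"
  using wiener_bounded L2_mult_bounded(1) L2_periodic L2_measurable wiener_L2 by metis

text \<open>Multiplication by an exponential shifts coefficients, so expanding \<open>f\<close>
  produces a convolution; the factor \<open>1 / sqrt T\<close> is the normalisation seen in
  \<open>basis_mult\<close>.\<close>

lemma fourier_coeff_mult_sums:
  assumes f: "f \<in> wiener" and g: "g \<in> L2 T"
  shows "(\<lambda>n. fc f (int_decode n) * (of_real (1 / sqrt T) * fc g (j - int_decode n)))
     sums fc (\<lambda>x. f x * g x) j"
proof -
  have [measurable]: "g \<in> borel_measurable lebesgue" "f \<in> borel_measurable lebesgue"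
    using f g wiener_L2 L2_measurable by auto
  have "fc (\<lambda>x. f x * g x) j = fc (\<lambda>x. trig (fc f) x * g x) j"
    by (rule fourier_coeff_cong) (use wiener_expansion[OF f] in auto)
  moreover have "(\<lambda>n. fc f (int_decode n) * (LINT x|\<mu>. bas (int_decode n) x * (g x * cnj (bas j x))))
     sums (LINT x|\<mu>. trig (fc f) x * (g x * cnj (bas j x)))"
    by (rule trig_mult_integral[OF wiener_coeff_l1[OF f]])
       (auto intro!: integrable_mult_basis(2) L2_integrable[OF g])
  moreover have "(LINT x|\<mu>. bas k x * (g x * cnj (bas j x))) = of_real (1 / sqrt T) * fc g (j - k)" for k
    unfolding fourier_coeff_mult_basis[symmetric] by (simp add: fourier_coeff_eq mult.assoc)
  ultimately show ?thesis by (simp add: fourier_coeff_eq mult.assoc)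
qed

lemma fourier_coeff_mult_le:
  assumes f: "f \<in> wiener" and g: "g \<in> L2 T"
  shows "ennreal (cmod (fc (\<lambda>x. f x * g x) j)) \<le> ennreal (1 / sqrt T) *
     (isum (\<lambda>k. ennreal (cmod (fc f k)) * ennreal (cmod (fc g (j - k)))))"
proof -
  have "ennreal (cmod (fc (\<lambda>x. f x * g x) j)) \<le> (\<Sum>n. ennreal (cmod (fc f (int_decode n) * (of_real (1 / sqrt T) * fc g (j - int_decode n)))))"
    by (rule ennreal_norm_sums_le[OF fourier_coeff_mult_sums[OF f g]])
  also have "\<dots> = (\<Sum>n. ennreal (1 / sqrt T) * (ennreal (cmod (fc f (int_decode n))) * ennreal (cmod (fc g (j - int_decode n)))))"
    using T_pos by (intro suminf_cong) (simp add: norm_mult norm_divide mult_ac flip: ennreal_mult)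
  finally show ?thesis by (simp add: nn_integral_int_eq_suminf ennreal_suminf_cmult)
qed

lemma anorm_mult:
  assumes f: "f \<in> wiener" and g: "g \<in> L2 T"
  shows "anorm (\<lambda>x. f x * g x) \<le> ennreal (1 / sqrt T) * (anorm f * anorm g)"
proof -
  have "anorm (\<lambda>x. f x * g x) \<le> (\<integral>\<^sup>+ j. ennreal (1 / sqrt T) *
     (isum (\<lambda>k. ennreal (cmod (fc f k)) * ennreal (cmod (fc g (j - k))))) \<partial>count_space UNIV)"
    unfolding anorm_eq by (intro nn_integral_mono fourier_coeff_mult_le f g)
  also have "\<dots> = ennreal (1 / sqrt T) * (anorm f * anorm g)"
    unfolding anorm_eq nn_integral_convolution_int[symmetric] by (simp add: nn_integral_cmult)
  finally show ?thesis .
qed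

text \<open>Subadditivity of \<open>w\<close> distributes the weight at frequency \<open>j\<close>
  over two factors of frequencies \<open>k\<close> and \<open>j - k\<close>, so the weighted norm
  obeys a Leibniz rule, as for a derivative.\<close>

lemma wnorm_mult:
  assumes f: "f \<in> wiener" and g: "g \<in> L2 T"
    and w: "\<And>k. w k \<ge> 0" "\<And>j k. w (j + k) \<le> w j + w k"
  shows "wnorm w (\<lambda>x. f x * g x) \<le> ennreal (1 / sqrt T) * (wnorm w f * anorm g + anorm f * wnorm w g)"
proof -
  let ?P = "\<lambda>j. \<integral>\<^sup>+ k. ennreal (w k * cmod (fc f k)) * ennreal (cmod (fc g (j - k))) \<partial>count_space UNIV"
  let ?Q = "\<lambda>j. \<integral>\<^sup>+ k. ennreal (cmod (fc f k)) * ennreal (w (j - k) * cmod (fc g (j - k))) \<partial>count_space UNIV"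
  let ?f = "\<lambda>k. cmod (fc f k)" and ?g = "\<lambda>k. cmod (fc g k)"
  have "wnorm w (\<lambda>x. f x * g x) \<le> (isum (\<lambda>j. ennreal (1 / sqrt T) *
     (?P j
     + ?Q j)))"
    unfolding wnorm_def
  proof (rule nn_integral_mono)
    fix j
    have "ennreal (w j * cmod (fc (\<lambda>x. f x * g x) j)) = ennreal (w j) * ennreal (cmod (fc (\<lambda>x. f x * g x) j))"
      using w by (simp add: ennreal_mult)
    also have "\<dots> \<le> ennreal (w j) * (ennreal (1 / sqrt T) * (isum (\<lambda>k. ennreal (?f k) * ennreal (?g (j - k)))))"
      by (intro mult_left_mono fourier_coeff_mult_le f g) auto
    also have "\<dots> = ennreal (1 / sqrt T) * (isum (\<lambda>k. ennreal (w j) * (ennreal (?f k) * ennreal (?g (j - k)))))"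
      by (simp add: nn_integral_cmult mult_ac)
    also have "\<dots> \<le> ennreal (1 / sqrt T) * (isum (\<lambda>k. ennreal (w k * ?f k) * ennreal (?g (j - k)) + ennreal (?f k) * ennreal (w (j - k) * ?g (j - k))))"
    proof (intro mult_left_mono nn_integral_mono)
      fix k
      have "w j * (?f k * ?g (j - k)) \<le> (w k + w (j - k)) * (?f k * ?g (j - k))"
        using w(2)[of k "j - k"] by (intro mult_right_mono) auto
      then show "ennreal (w j) * (ennreal (?f k) * ennreal (?g (j - k))) \<le> ennreal (w k * ?f k) * ennreal (?g (j - k)) + ennreal (?f k) * ennreal (w (j - k) * ?g (j - k))"
        using w(1) by (simp add: algebra_simps flip: ennreal_mult ennreal_plus)
    qed auto
    also have "(isum (\<lambda>k. ennreal (w k * ?f k) * ennreal (?g (j - k)) + ennreal (?f k) * ennreal (w (j - k) * ?g (j - k))))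
      = ?P j
       + ?Q j"
      by (intro nn_integral_add) auto
    finally show "ennreal (w j * cmod (fc (\<lambda>x. f x * g x) j)) \<le> ennreal (1 / sqrt T) *
     (?P j
     + ?Q j)" .
  qed
  also have "\<dots> = ennreal (1 / sqrt T) * (wnorm w f * anorm g + anorm f * wnorm w g)"
    unfolding wnorm_def
    by (subst nn_integral_cmult, simp, subst nn_integral_add)
       (simp_all add: nn_integral_convolution_int[of "\<lambda>k. ennreal (w k * ?f k)" "\<lambda>k. ennreal (?g k)"]
         nn_integral_convolution_int[of "\<lambda>k. ennreal (?f k)" "\<lambda>k. ennreal (w k * ?g k)"])
  finally show ?thesis .
qed

lemma wiener_mult: "f \<in> wiener \<Longrightarrow> g \<in> wiener \<Longrightarrow> (\<lambda>x. f x * g x) \<in> wiener"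
  using anorm_mult[of f g] wiener_mult_L2[of f g]
  by (auto simp: wiener_def ennreal_mult_less_top ennreal_mult_eq_top_iff less_top[symmetric] top_unique)

lemma fourier_coeff_cnj: "fc (\<lambda>x. cnj (f x)) j = cnj (fc f (- j))"
proof -
  have "cnj (fc f (- j)) = (LINT x|\<mu>. cnj (f x * cnj (bas (- j) x)))"
    unfolding fourier_coeff_eq by (rule Bochner_Integration.integral_cnj[symmetric])
  then show ?thesis unfolding fourier_coeff_eq by (simp add: cnj_basis)
qed

lemma L2_cnj: "f \<in> L2 T \<Longrightarrow> (\<lambda>x. cnj (f x)) \<in> L2 T"
proof -
  have "cnj \<in> borel_measurable borel" by (intro borel_measurable_continuous_onI continuous_intros)
  then show "f \<in> L2 T \<Longrightarrow> (\<lambda>x. cnj (f x)) \<in> L2 T"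
    by (auto simp: L2_iff periodic_def intro: measurable_compose)
qed

lemma wnorm_cnj:
  assumes "\<And>k. w (- k) = w k" shows "wnorm w (\<lambda>x. cnj (f x)) = wnorm w f"
proof -
  have b: "bij (uminus :: int \<Rightarrow> int)" by (rule bij_betw_byWitness[where f'=uminus]) auto
  show ?thesis unfolding wnorm_def fourier_coeff_cnj
    using nn_integral_bij_count_space[OF b, of "\<lambda>j. ennreal (w j * cmod (fc f j))"] assms by simp
qed

lemma wiener_cnj: "f \<in> wiener \<Longrightarrow> (\<lambda>x. cnj (f x)) \<in> wiener"
  by (simp add: wiener_def L2_cnj wnorm_cnj)

lemma wnorm_add:
  assumes "integrable \<mu> f" "integrable \<mu> g" and w: "\<And>k. w k \<ge> 0"
  shows "wnorm w (\<lambda>x. f x + g x) \<le> wnorm w f + wnorm w g"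
  unfolding wnorm_def
proof (subst nn_integral_add[symmetric])
  have "fc (\<lambda>x. f x + g x) j = fc f j + fc g j" for j
    using fourier_coeff_lin[OF assms(1,2), of 1 1] by simp
  then show "(isum (\<lambda>j. ennreal (w j * cmod (fc (\<lambda>x. f x + g x) j))))
    \<le> (isum (\<lambda>j. ennreal (w j * cmod (fc f j)) + ennreal (w j * cmod (fc g j))))"
    using w by (auto intro!: nn_integral_mono mult_left_mono norm_triangle_ineq simp flip: ennreal_plus distrib_left)
qed auto

lemma wnorm_minus: "wnorm w (\<lambda>x. - f x) = wnorm w f"
  using fourier_coeff_cmult[of "-1" f] by (simp add: wnorm_def)

lemma wnorm_diff:
  assumes "integrable \<mu> f" "integrable \<mu> g" and w: "\<And>k. w k \<ge> 0"
  shows "wnorm w (\<lambda>x. f x - g x) \<le> wnorm w f + wnorm w g"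
  using wnorm_add[of f "\<lambda>x. - g x" w] assms by (simp add: wnorm_minus)

lemma wnorm_cong:
  assumes "AE x in lebesgue. f x = g x"
    and "f \<in> borel_measurable lebesgue" "g \<in> borel_measurable lebesgue"
  shows "wnorm w f = wnorm w g"
  unfolding wnorm_def using fourier_coeff_cong[OF assms] by simp

lemma wiener_diff: "f \<in> wiener \<Longrightarrow> g \<in> wiener \<Longrightarrow> (\<lambda>x. f x - g x) \<in> wiener"
  using wnorm_diff[of f g "\<lambda>_. 1"] L2_diff[of f g] L2_integrable
  by (auto simp: wiener_def less_top[symmetric] top_unique elim!: order.strict_trans1)

end

section \<open>Convolution kernels as Fourier multipliers\<close>

lemma lebesgue_integral_real_affine:
  fixes f :: "real \<Rightarrow> 'a::{banach, second_countable_topology}"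
  assumes c: "c \<noteq> 0" and f: "integrable lebesgue f"
  shows "integrable lebesgue (\<lambda>x. f (t + c * x))"
    and "(LINT x|lebesgue. f x) = \<bar>c\<bar> *\<^sub>R (LINT x|lebesgue. f (t + c * x))"
proof -
  have T [measurable]: "(\<lambda>x. t + c * x) \<in> lebesgue \<rightarrow>\<^sub>M lebesgue"
    using lebesgue_affine_measurable[where c="\<lambda>x::real. c" and t=t] c by simp
  have [measurable]: "f \<in> borel_measurable lebesgue" using f by auto
  have L: "lebesgue = density (distr lebesgue lebesgue (\<lambda>x. t + c * x)) (\<lambda>_. ennreal \<bar>c\<bar>)"
    using lebesgue_real_affine[OF c] by simp
  have fd: "f \<in> borel_measurable (distr lebesgue lebesgue (\<lambda>x. t + c * x))" by simp
  have "integrable (density (distr lebesgue lebesgue (\<lambda>x. t + c * x)) (\<lambda>_. ennreal \<bar>c\<bar>)) f"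
    using f L by simp
  then have "integrable (distr lebesgue lebesgue (\<lambda>x. t + c * x)) (\<lambda>x. \<bar>c\<bar> *\<^sub>R f x)"
    by (subst (asm) integrable_density[OF fd]) auto
  then have "integrable lebesgue (\<lambda>x. \<bar>c\<bar> *\<^sub>R f (t + c * x))"
    by (subst (asm) integrable_distr_eq[OF T]) auto
  then show "integrable lebesgue (\<lambda>x. f (t + c * x))"
    using integrable_scaleR_right[of "1 / \<bar>c\<bar>" lebesgue "\<lambda>x. \<bar>c\<bar> *\<^sub>R f (t + c * x)"] c by simp
  have "(LINT x|lebesgue. f x) = (LINT x|density (distr lebesgue lebesgue (\<lambda>x. t + c * x)) (\<lambda>_. ennreal \<bar>c\<bar>). f x)"
    using L by simp
  also have "\<dots> = (LINT x|distr lebesgue lebesgue (\<lambda>x. t + c * x). \<bar>c\<bar> *\<^sub>R f x)"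
    by (rule integral_density[OF fd]) auto
  also have "\<dots> = (LINT x|lebesgue. \<bar>c\<bar> *\<^sub>R f (t + c * x))"
    by (rule integral_distr[OF T]) auto
  finally show "(LINT x|lebesgue. f x) = \<bar>c\<bar> *\<^sub>R (LINT x|lebesgue. f (t + c * x))" by simp
qed

lemma cmod_cis_minus_1_le: "cmod (cis t - 1) \<le> \<bar>t\<bar>"
  using dist_exp_i_1[of t] abs_sin_x_le_abs_x[of "t / 2"]
  by (simp add: cis_conv_exp dist_norm mult.commute)

lemma continuous_lebesgue_measurable:
  fixes f :: "real \<Rightarrow> 'b::topological_space"
  shows "continuous_on UNIV f \<Longrightarrow> f \<in> borel_measurable lebesgue"
  by (intro measurable_completion) (simp add: borel_measurable_continuous_onI)

context circle begin

text \<open>The Fourier transform of \<zeta> at \<open>- 2 * pi * k * \<epsilon> / T\<close>; the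
  sign comes from the negative exponent in \<open>basis_fun\<close>. At \<epsilon> = 0 the formula
  gives the mass, so the local equation is a member of the same family.\<close>

definition symbol :: "(real \<Rightarrow> real) \<Rightarrow> real \<Rightarrow> int \<Rightarrow> complex" where
  "symbol \<zeta> \<epsilon> k = (LINT v|lebesgue. of_real (\<zeta> v) * cis (2 * pi * of_int k * \<epsilon> * v / T))"

definition smul :: "(int \<Rightarrow> complex) \<Rightarrow> (real \<Rightarrow> complex) \<Rightarrow> real \<Rightarrow> complex" where
  "smul m g = trig (\<lambda>k. m k * fc g k)"

lemma symbol_integrable:
  assumes "integrable lebesgue \<zeta>"
  shows "integrable lebesgue (\<lambda>v. of_real (\<zeta> v) * cis (2 * pi * of_int k * \<epsilon> * v / T))"
proof (rule Bochner_Integration.integrable_bound[OF assms])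
  have [measurable]: "(\<lambda>v. cis (2 * pi * of_int k * \<epsilon> * v / T)) \<in> borel_measurable lebesgue"
    using T_pos by (intro continuous_lebesgue_measurable continuous_intros) auto
  have [measurable]: "\<zeta> \<in> borel_measurable lebesgue" using assms by auto
  show "(\<lambda>v. of_real (\<zeta> v) * cis (2 * pi * of_int k * \<epsilon> * v / T)) \<in> borel_measurable lebesgue"
    by measurable
qed (auto simp: norm_mult)

text \<open>The substitution \<open>y = x - \<epsilon> * v\<close> factors \<open>bas k x\<close>
  out of the integral: exponentials are eigenfunctions of convolution, and \<open>symbol\<close>
  collects the eigenvalues.\<close>

lemma kernel_basis:
  assumes \<zeta>: "integrable lebesgue \<zeta>" and \<epsilon>: "\<epsilon> > 0"
  shows "integrable lebesgue (\<lambda>y. complex_of_real (scaled_kernel \<zeta> \<epsilon> (x - y)))"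
    and "(LINT y|lebesgue. bas k y * of_real (scaled_kernel \<zeta> \<epsilon> (x - y))) = symbol \<zeta> \<epsilon> k * bas k x"
proof -
  have "integrable lebesgue (\<lambda>y. \<zeta> (x / \<epsilon> + (-1 / \<epsilon>) * y))"
    using \<epsilon> by (intro lebesgue_integral_real_affine \<zeta>) auto
  also have "(\<lambda>y. \<zeta> (x / \<epsilon> + (-1 / \<epsilon>) * y)) = (\<lambda>y. \<zeta> ((x - y) / \<epsilon>))"
    by (simp add: diff_divide_distrib)
  finally show "integrable lebesgue (\<lambda>y. complex_of_real (scaled_kernel \<zeta> \<epsilon> (x - y)))"
    unfolding scaled_kernel_def by (intro integrable_of_real integrable_mult_right)
  define F where "F v = complex_of_real (\<zeta> v) * cis (2 * pi * of_int k * \<epsilon> * v / T)" for v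
  have F: "integrable lebesgue F" unfolding F_def by (rule symbol_integrable[OF \<zeta>])
  have eq: "bas k y * of_real (scaled_kernel \<zeta> \<epsilon> (x - y))
      = (of_real (1 / \<epsilon>) * bas k x) * F (x / \<epsilon> + (-1 / \<epsilon>) * y)" for y
  proof -
    have a: "x / \<epsilon> + (-1 / \<epsilon>) * y = (x - y) / \<epsilon>" by (simp add: diff_divide_distrib)
    have b: "2 * pi * of_int k * \<epsilon> * ((x - y) / \<epsilon>) / T = 2 * pi * of_int k * (x - y) / T"
      using \<epsilon> by simp
    have "- 2 * pi * of_int k * x / T + 2 * pi * of_int k * (x - y) / T = - 2 * pi * of_int k * y / T"
      by (simp add: add_divide_distrib[symmetric] algebra_simps)
    then have c: "bas k y = bas k x * cis (2 * pi * of_int k * (x - y) / T)"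
      unfolding basis_fun_eq mult.assoc[of "complex_of_real _"] cis_mult by simp
    show ?thesis unfolding a F_def b scaled_kernel_def c by simp
  qed
  have "symbol \<zeta> \<epsilon> k = (LINT v|lebesgue. F v)" by (simp add: symbol_def F_def)
  also have "\<dots> = \<bar>-1 / \<epsilon>\<bar> *\<^sub>R (LINT y|lebesgue. F (x / \<epsilon> + (-1 / \<epsilon>) * y))"
    using \<epsilon> by (intro lebesgue_integral_real_affine(2) F) auto
  finally have "symbol \<zeta> \<epsilon> k = of_real (1 / \<epsilon>) * (LINT y|lebesgue. F (x / \<epsilon> + (-1 / \<epsilon>) * y))"
    using \<epsilon> by (simp add: scaleR_conv_of_real)
  then show "(LINT y|lebesgue. bas k y * of_real (scaled_kernel \<zeta> \<epsilon> (x - y))) = symbol \<zeta> \<epsilon> k * bas k x"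
    unfolding eq by simp
qed

lemma l1_mult:
  assumes "\<And>k. cmod (m k) \<le> B" "c \<in> l1" shows "(\<lambda>k. m k * c k) \<in> l1"
proof -
  have B: "B \<ge> 0" using assms(1)[of 0] norm_ge_zero[of "m 0"] by linarith
  have "(isum (\<lambda>j. ennreal (cmod (m j * c j)))) \<le> (isum (\<lambda>j. ennreal B * ennreal (cmod (c j))))"
    using B by (intro nn_integral_mono) (auto simp: norm_mult assms(1) mult_right_mono intro!: ennreal_leI simp flip: ennreal_mult)
  also have "\<dots> < \<infinity>"
    using assms(2) by (simp add: nn_integral_cmult l1_def ennreal_mult_less_top)
  finally show ?thesis by (simp add: l1_def)
qed

lemma smul_wiener: "(\<And>k. cmod (m k) \<le> B) \<Longrightarrow> g \<in> wiener \<Longrightarrow> smul m g \<in> wiener"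
  unfolding smul_def by (intro trig_wiener l1_mult wiener_coeff_l1)

lemma fourier_coeff_smul:
  "(\<And>k. cmod (m k) \<le> B) \<Longrightarrow> g \<in> wiener \<Longrightarrow> fc (smul m g) k = m k * fc g k"
  unfolding smul_def by (rule fourier_coeff_trig[OF l1_mult[OF _ wiener_coeff_l1]])

section \<open>The cubic nonlinearity as a multiplier expression\<close>

definition weight :: "(real \<Rightarrow> real) \<Rightarrow> real \<Rightarrow> int \<Rightarrow> real" where
  "weight \<zeta> \<epsilon> k = min 2 (2 * pi / T * (LINT v|lebesgue. \<bar>v * \<zeta> v\<bar>) * \<epsilon> * \<bar>of_int k\<bar>)"

text \<open>The squared modulus is written as a product with the conjugate, which keeps the
  expression within the algebra; \<open>nonlinearity_cubic\<close> relates it to the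
  equation.\<close>

definition cubic :: "(int \<Rightarrow> complex) \<Rightarrow> (real \<Rightarrow> complex) \<Rightarrow> real \<Rightarrow> complex" where
  "cubic m f x = f x * smul m (\<lambda>y. f y * cnj (f y)) x"

lemma wiener_integrable: "f \<in> wiener \<Longrightarrow> integrable \<mu> f"
  by (intro L2_integrable wiener_L2)

lemma weight_minus: "weight \<zeta> \<epsilon> (- k) = weight \<zeta> \<epsilon> k"
  by (simp add: weight_def)

text \<open>Capping a nonnegative subadditive function by a positive constant keeps it subadditive,
  which is what \<open>wnorm_mult\<close> asks of a weight.\<close>

lemma weight_add:
  assumes "\<epsilon> \<ge> 0" shows "weight \<zeta> \<epsilon> (j + k) \<le> weight \<zeta> \<epsilon> j + weight \<zeta> \<epsilon> k"
proof -
  define c where "c = 2 * pi / T * (LINT v|lebesgue. \<bar>v * \<zeta> v\<bar>) * \<epsilon>"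
  have c: "c \<ge> 0" using T_pos assms by (simp add: c_def)
  have "c * \<bar>of_int (j + k)\<bar> \<le> c * \<bar>of_int j\<bar> + c * \<bar>of_int k\<bar>"
    using c unfolding distrib_left[symmetric] by (intro mult_left_mono) auto
  moreover have "c * \<bar>of_int j\<bar> \<ge> 0" "c * \<bar>of_int k\<bar> \<ge> 0" using c by auto
  ultimately show ?thesis unfolding weight_def c_def[symmetric] by linarith
qed

lemma anorm_smul_le:
  assumes "\<And>k. cmod (m k) \<le> 1" "g \<in> wiener" shows "anorm (smul m g) \<le> anorm g"
  unfolding anorm_eq fourier_coeff_smul[OF assms]
  by (intro nn_integral_mono ennreal_leI) (simp add: norm_mult mult_left_le_one_le assms)

lemma cubic_wiener: "(\<And>k. cmod (m k) \<le> B) \<Longrightarrow> f \<in> wiener \<Longrightarrow> cubic m f \<in> wiener"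
  unfolding cubic_def by (intro wiener_mult smul_wiener wiener_cnj)

text \<open>With \<open>d = f - g\<close> the difference is \<open>d\<close> times the multiplier
  applied to \<open>F\<close>, plus \<open>g\<close> times the multiplier applied to
  \<open>F - G\<close>, and \<open>F - G = d * cnj f + g * cnj d\<close>. Each term contains two
  nested products, which accounts for \<open>1 / T\<close>.\<close>

lemma cubic_lipschitz:
  assumes m: "\<And>k. cmod (m k) \<le> 1" and f: "f \<in> wiener" and g: "g \<in> wiener"
  shows "anorm (\<lambda>x. cubic m f x - cubic m g x) \<le> ennreal (1 / T) *
    (anorm (\<lambda>x. f x - g x) * (anorm f * anorm f + anorm f * anorm g + anorm g * anorm g))"
proof -
  define s where "s = ennreal (1 / sqrt T)"
  have ss: "ennreal (1 / T) = s * s" using T_pos by (simp add: s_def flip: ennreal_mult)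
  define d where "d x = f x - g x" for x
  have d: "d \<in> wiener" unfolding d_def by (rule wiener_diff[OF f g])
  define F where "F x = f x * cnj (f x)" for x
  define G where "G x = g x * cnj (g x)" for x
  have FG: "F \<in> wiener" "G \<in> wiener" unfolding F_def G_def by (intro wiener_mult wiener_cnj f g)+
  define E where "E x = smul m F x - smul m G x" for x
  have E: "E \<in> wiener" unfolding E_def by (intro wiener_diff smul_wiener[OF m] FG)
  have p1: "(\<lambda>x. d x * smul m F x) \<in> wiener" and p2: "(\<lambda>x. g x * E x) \<in> wiener"
    and q1: "(\<lambda>x. d x * cnj (f x)) \<in> wiener" and q2: "(\<lambda>x. g x * cnj (d x)) \<in> wiener"
    by (intro wiener_mult wiener_cnj smul_wiener[OF m] d E g FG f)+
  have "fc E k = m k * fc (\<lambda>x. F x - G x) k" for k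
    unfolding E_def using fourier_coeff_diff[OF wiener_integrable[OF smul_wiener[OF m FG(1)]] wiener_integrable[OF smul_wiener[OF m FG(2)]]]
      fourier_coeff_diff[OF FG[THEN wiener_integrable]]
    by (simp add: fourier_coeff_smul[OF m FG(1)] fourier_coeff_smul[OF m FG(2)] right_diff_distrib)
  then have "anorm E \<le> anorm (\<lambda>x. F x - G x)"
    unfolding anorm_eq by (intro nn_integral_mono ennreal_leI) (simp add: norm_mult mult_left_le_one_le m)
  also have "(\<lambda>x. F x - G x) = (\<lambda>x. d x * cnj (f x) + g x * cnj (d x))"
    by (simp add: F_def G_def d_def algebra_simps)
  also have "anorm \<dots> \<le> anorm (\<lambda>x. d x * cnj (f x)) + anorm (\<lambda>x. g x * cnj (d x))"
    by (intro wnorm_add wiener_integrable q1 q2) auto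
  also have "\<dots> \<le> s * (anorm d * anorm (\<lambda>x. cnj (f x))) + s * (anorm g * anorm (\<lambda>x. cnj (d x)))"
    unfolding s_def by (intro add_mono anorm_mult d g wiener_L2 wiener_cnj f)
  finally have aE: "anorm E \<le> s * (anorm d * anorm f) + s * (anorm g * anorm d)"
    by (simp add: wnorm_cnj)
  have "anorm (smul m F) \<le> s * (anorm f * anorm (\<lambda>x. cnj (f x)))"
    using anorm_smul_le[OF m FG(1)] anorm_mult[OF f wiener_L2[OF wiener_cnj[OF f]]]
    unfolding s_def F_def by (rule order_trans)
  then have aF: "anorm (smul m F) \<le> s * (anorm f * anorm f)" by (simp add: wnorm_cnj)
  have "(\<lambda>x. cubic m f x - cubic m g x) = (\<lambda>x. d x * smul m F x + g x * E x)"
    by (rule ext) (simp add: cubic_def d_def E_def F_def[abs_def] G_def[abs_def] algebra_simps)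
  then have "anorm (\<lambda>x. cubic m f x - cubic m g x) \<le> anorm (\<lambda>x. d x * smul m F x) + anorm (\<lambda>x. g x * E x)"
    using wnorm_add[OF wiener_integrable[OF p1] wiener_integrable[OF p2], of "\<lambda>_. 1"] by simp
  also have "\<dots> \<le> s * (anorm d * anorm (smul m F)) + s * (anorm g * anorm E)"
    unfolding s_def by (intro add_mono anorm_mult d g wiener_L2 smul_wiener[OF m] FG E)
  also have "\<dots> \<le> s * (anorm d * (s * (anorm f * anorm f))) + s * (anorm g * (s * (anorm d * anorm f) + s * (anorm g * anorm d)))"
    by (intro add_mono mult_left_mono aE aF) auto
  also have "\<dots> = (s * s) * (anorm d * (anorm f * anorm f + anorm f * anorm g + anorm g * anorm g))"
    by (simp add: distrib_left distrib_right mult_ac add_ac)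
  finally show ?thesis unfolding ss d_def .
qed

text \<open>Changing the multiplier affects only the factor that comes from the squared modulus. The
  bound \<open>w\<close> turns this change into a weighted norm of the squared modulus, and the
  Leibniz rule of \<open>wnorm_mult\<close> passes the weight on to \<open>g\<close>.\<close>

lemma cubic_symbol_diff:
  assumes m: "\<And>k. cmod (m k) \<le> 1" "\<And>k. cmod (m' k) \<le> 1" "\<And>k. cmod (m k - m' k) \<le> w k"
    and w: "\<And>j k. w (j + k) \<le> w j + w k" "\<And>k. w (- k) = w k"
    and g: "g \<in> wiener"
  shows "anorm (\<lambda>x. cubic m g x - cubic m' g x) \<le> ennreal (1 / T) * (2 * (anorm g * anorm g) * wnorm w g)"
proof -
  define s where "s = ennreal (1 / sqrt T)"
  have ss: "ennreal (1 / T) = s * s" using T_pos by (simp add: s_def flip: ennreal_mult)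
  have w0: "w k \<ge> 0" for k using m(3)[of k] norm_ge_zero order_trans by blast
  define G where "G x = g x * cnj (g x)" for x
  have G: "G \<in> wiener" unfolding G_def by (intro wiener_mult wiener_cnj g)
  define E where "E x = smul m G x - smul m' G x" for x
  have E: "E \<in> wiener" unfolding E_def by (intro wiener_diff smul_wiener[OF m(1)] smul_wiener[OF m(2)] G)
  have "fc E k = (m k - m' k) * fc G k" for k
    unfolding E_def using fourier_coeff_diff[OF wiener_integrable[OF smul_wiener[OF m(1) G]] wiener_integrable[OF smul_wiener[OF m(2) G]]]
    by (simp add: fourier_coeff_smul[OF m(1) G] fourier_coeff_smul[OF m(2) G] left_diff_distrib)
  then have "anorm E \<le> wnorm w G"
    unfolding anorm_eq wnorm_def by (intro nn_integral_mono ennreal_leI) (simp add: norm_mult mult_right_mono m)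
  also have "\<dots> \<le> s * (wnorm w g * anorm (\<lambda>x. cnj (g x)) + anorm g * wnorm w (\<lambda>x. cnj (g x)))"
    unfolding s_def G_def by (intro wnorm_mult g wiener_L2 wiener_cnj w w0)
  finally have aE: "anorm E \<le> s * (2 * (anorm g * wnorm w g))"
    by (simp add: wnorm_cnj w mult.commute mult_2)
  have "(\<lambda>x. cubic m g x - cubic m' g x) = (\<lambda>x. g x * E x)"
    by (rule ext) (simp add: cubic_def E_def G_def[abs_def] algebra_simps)
  then have "anorm (\<lambda>x. cubic m g x - cubic m' g x) \<le> s * (anorm g * anorm E)"
    unfolding s_def using anorm_mult[OF g wiener_L2[OF E]] by simp
  also have "\<dots> \<le> s * (anorm g * (s * (2 * (anorm g * wnorm w g))))"
    by (intro mult_left_mono aE) auto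
  finally show ?thesis unfolding ss by (simp add: mult_ac)
qed

context
  fixes \<zeta> :: "real \<Rightarrow> real"
  assumes \<zeta>_nonneg: "\<And>x. \<zeta> x \<ge> 0" and \<zeta>_integrable: "integrable lebesgue \<zeta>"
    and \<zeta>_mass: "(LINT x|lebesgue. \<zeta> x) = 1" and \<zeta>_moment: "integrable lebesgue (\<lambda>x. x * \<zeta> x)"
begin

lemma symbol_0: "symbol \<zeta> 0 k = 1"
  by (simp add: symbol_def \<zeta>_mass)

lemma cmod_symbol_le: "cmod (symbol \<zeta> \<epsilon> k) \<le> 1"
proof -
  have "cmod (symbol \<zeta> \<epsilon> k) \<le> (LINT v|lebesgue. cmod (of_real (\<zeta> v) * cis (2 * pi * of_int k * \<epsilon> * v / T)))"
    unfolding symbol_def by (rule integral_norm_bound)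
  then show ?thesis by (simp add: norm_mult \<zeta>_nonneg \<zeta>_mass)
qed

text \<open>Mass one absorbs the constant 1 into the integral; then
  \<open>cmod_cis_minus_1_le\<close> produces the first moment. The competing bound 2 is the
  triangle inequality.\<close>

lemma cmod_symbol_minus_1_le:
  assumes "\<epsilon> \<ge> 0" shows "cmod (symbol \<zeta> \<epsilon> k - 1) \<le> weight \<zeta> \<epsilon> k"
proof -
  let ?c = "\<lambda>v. cis (2 * pi * of_int k * \<epsilon> * v / T)" and ?b = "2 * pi / T * \<epsilon> * \<bar>of_int k\<bar>"
  have "symbol \<zeta> \<epsilon> k - 1 = (LINT v|lebesgue. of_real (\<zeta> v) * ?c v - of_real (\<zeta> v))"
    using symbol_integrable[OF \<zeta>_integrable, of k \<epsilon>] \<zeta>_integrable by (simp add: symbol_def \<zeta>_mass)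
  also have "cmod \<dots> \<le> (LINT v|lebesgue. ?b * \<bar>v * \<zeta> v\<bar>)"
  proof (rule order_trans[OF integral_norm_bound integral_mono])
    show "integrable lebesgue (\<lambda>v. cmod (of_real (\<zeta> v) * ?c v - of_real (\<zeta> v)))"
      using symbol_integrable[OF \<zeta>_integrable, of k \<epsilon>] \<zeta>_integrable by (intro integrable_norm) auto
    show "integrable lebesgue (\<lambda>v. ?b * \<bar>v * \<zeta> v\<bar>)"
      using \<zeta>_moment by (intro integrable_mult_right integrable_abs)
    fix v
    have "cmod (of_real (\<zeta> v) * ?c v - of_real (\<zeta> v)) = \<zeta> v * cmod (?c v - 1)"
    proof -
      have "of_real (\<zeta> v) * z - of_real (\<zeta> v) = of_real (\<zeta> v) * (z - 1)" for z :: complex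
        by (simp add: algebra_simps)
      then show ?thesis using \<zeta>_nonneg[of v] by (simp add: norm_mult)
    qed
    also have "\<dots> \<le> \<zeta> v * \<bar>2 * pi * of_int k * \<epsilon> * v / T\<bar>"
      by (intro mult_left_mono cmod_cis_minus_1_le \<zeta>_nonneg)
    also have "\<dots> = ?b * \<bar>v * \<zeta> v\<bar>"
      using T_pos assms \<zeta>_nonneg[of v] by (simp add: abs_mult)
    finally show "cmod (of_real (\<zeta> v) * ?c v - of_real (\<zeta> v)) \<le> ?b * \<bar>v * \<zeta> v\<bar>" .
  qed
  finally have "cmod (symbol \<zeta> \<epsilon> k - 1) \<le> 2 * pi / T * (LINT v|lebesgue. \<bar>v * \<zeta> v\<bar>) * \<epsilon> * \<bar>of_int k\<bar>"
    by (simp add: mult_ac)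
  moreover have "cmod (symbol \<zeta> \<epsilon> k - 1) \<le> 2"
    using norm_triangle_ineq4[of "symbol \<zeta> \<epsilon> k" 1] cmod_symbol_le[of \<epsilon> k] by simp
  ultimately show ?thesis by (simp add: weight_def)
qed

text \<open>Replacing the squared modulus by its Fourier series changes the integrand on a null set
  only, and the series is integrated against the kernel term by term. Hence the identity holds at
  every \<open>x\<close>.\<close>

lemma kernel_conv_eq:
  assumes f: "f \<in> wiener" and \<epsilon>: "\<epsilon> > 0"
  shows "of_real (kernel_conv \<zeta> \<epsilon> (\<lambda>y. (cmod (f y))\<^sup>2) x) = smul (symbol \<zeta> \<epsilon>) (\<lambda>y. f y * cnj (f y)) x"
proof -
  let ?g = "\<lambda>y. f y * cnj (f y)" and ?R = "\<lambda>y. complex_of_real (scaled_kernel \<zeta> \<epsilon> (x - y))"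
  have g: "?g \<in> wiener" by (intro wiener_mult wiener_cnj f)
  have [measurable]: "?g \<in> borel_measurable lebesgue" by (rule L2_measurable[OF wiener_L2[OF g]])
  have R: "integrable lebesgue ?R" by (rule kernel_basis[OF \<zeta>_integrable \<epsilon>])
  then have [measurable]: "?R \<in> borel_measurable lebesgue" by auto
  have "of_real (kernel_conv \<zeta> \<epsilon> (\<lambda>y. (cmod (f y))\<^sup>2) x)
      = (LINT y|lebesgue. complex_of_real (scaled_kernel \<zeta> \<epsilon> (x - y) * (cmod (f y))\<^sup>2))"
    unfolding kernel_conv_def using \<epsilon> by (subst integral_complex_of_real) simp
  also have "\<dots> = (LINT y|lebesgue. ?g y * ?R y)"
    by (simp add: complex_norm_square mult.commute del: of_real_power)
  also have "\<dots> = (LINT y|lebesgue. trig (fc ?g) y * ?R y)"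
    by (rule integral_cong_AE) (use wiener_expansion[OF g] in auto)
  also have "\<dots> = (\<Sum>n. fc ?g (int_decode n) * (LINT y|lebesgue. bas (int_decode n) y * ?R y))"
    by (rule sums_unique, rule trig_mult_integral[OF wiener_coeff_l1[OF g] R]) simp
  also have "\<dots> = smul (symbol \<zeta> \<epsilon>) ?g x"
    unfolding smul_def trig_def kernel_basis(2)[OF \<zeta>_integrable \<epsilon>] by (simp add: mult_ac)
  finally show ?thesis .
qed

text \<open>For \<epsilon> = 0 a pointwise product is compared with a Fourier series, and
  \<open>wiener_expansion\<close> gives agreement almost everywhere; for \<epsilon> > 0 both sides
  coincide as functions.\<close>

lemma nonlinearity_cubic:
  assumes f: "f \<in> wiener" and \<epsilon>: "\<epsilon> \<ge> 0"
  shows "AE x in lebesgue. nonlinearity \<zeta> \<epsilon> f x = cubic (symbol \<zeta> \<epsilon>) f x"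
    and "nonlinearity \<zeta> \<epsilon> f \<in> wiener"
proof -
  have g: "(\<lambda>y. f y * cnj (f y)) \<in> wiener" by (intro wiener_mult wiener_cnj f)
  have 0: "nonlinearity \<zeta> 0 f = (\<lambda>x. f x * (f x * cnj (f x)))"
    by (rule ext) (simp add: nonlinearity_def kernel_conv_def complex_norm_square del: of_real_power)
  have pos: "nonlinearity \<zeta> \<epsilon> f = cubic (symbol \<zeta> \<epsilon>) f" if "\<epsilon> > 0"
    by (rule ext) (simp only: nonlinearity_def kernel_conv_eq[OF f that] cubic_def)
  show "AE x in lebesgue. nonlinearity \<zeta> \<epsilon> f x = cubic (symbol \<zeta> \<epsilon>) f x"
  proof (cases "\<epsilon> = 0")
    case True
    show ?thesis unfolding True 0 cubic_def smul_def symbol_0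
      using wiener_expansion[OF g] by eventually_elim simp
  qed (use pos \<epsilon> in simp)
  show "nonlinearity \<zeta> \<epsilon> f \<in> wiener"
  proof (cases "\<epsilon> = 0")
    case True
    show ?thesis unfolding True 0 by (intro wiener_mult f g)
  qed (use pos \<epsilon> cubic_wiener[OF cmod_symbol_le f] in simp)
qed

text \<open>The term \<open>cubic (symbol \<zeta> \<epsilon>) g\<close> is inserted: first the
  functions differ under one multiplier, then the multipliers differ on \<open>g\<close>. With
  \<open>g\<close> the local solution, the weighted norm never falls on the nonlocal one.\<close>

lemma nonlinearity_diff:
  assumes f: "f \<in> wiener" and g: "g \<in> wiener" and \<epsilon>: "\<epsilon> \<ge> 0"
  shows "anorm (\<lambda>x. nonlinearity \<zeta> \<epsilon> f x - nonlinearity \<zeta> 0 g x) \<le> ennreal (1 / T) *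
    (anorm (\<lambda>x. f x - g x) * (anorm f * anorm f + anorm f * anorm g + anorm g * anorm g)
      + 2 * (anorm g * anorm g) * wnorm (weight \<zeta> \<epsilon>) g)"
proof -
  let ?m = "symbol \<zeta> \<epsilon>" and ?n = "symbol \<zeta> 0"
  note m = cmod_symbol_le
  have W: "cubic ?m f \<in> wiener" "cubic ?m g \<in> wiener" "cubic ?n g \<in> wiener"
    by (intro cubic_wiener[OF m] f g)+
  have "anorm (\<lambda>x. nonlinearity \<zeta> \<epsilon> f x - nonlinearity \<zeta> 0 g x) = anorm (\<lambda>x. cubic ?m f x - cubic ?n g x)"
  proof (rule wnorm_cong)
    show "AE x in lebesgue. nonlinearity \<zeta> \<epsilon> f x - nonlinearity \<zeta> 0 g x = cubic ?m f x - cubic ?n g x"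
      using nonlinearity_cubic(1)[OF f \<epsilon>] nonlinearity_cubic(1)[OF g order_refl] by eventually_elim simp
    show "(\<lambda>x. nonlinearity \<zeta> \<epsilon> f x - nonlinearity \<zeta> 0 g x) \<in> borel_measurable lebesgue"
      "(\<lambda>x. cubic ?m f x - cubic ?n g x) \<in> borel_measurable lebesgue"
      by (intro L2_measurable wiener_L2 wiener_diff nonlinearity_cubic(2) f g \<epsilon> W order_refl)+
  qed
  also have "(\<lambda>x. cubic ?m f x - cubic ?n g x) = (\<lambda>x. (cubic ?m f x - cubic ?m g x) + (cubic ?m g x - cubic ?n g x))"
    by simp
  also have "anorm \<dots> \<le> anorm (\<lambda>x. cubic ?m f x - cubic ?m g x) + anorm (\<lambda>x. cubic ?m g x - cubic ?n g x)"
    by (intro wnorm_add wiener_integrable wiener_diff W) auto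
  also have "\<dots> \<le> ennreal (1 / T) *
    (anorm (\<lambda>x. f x - g x) * (anorm f * anorm f + anorm f * anorm g + anorm g * anorm g))
      + ennreal (1 / T) * (2 * (anorm g * anorm g) * wnorm (weight \<zeta> \<epsilon>) g)"
    using cmod_symbol_minus_1_le[OF \<epsilon>]
    by (intro add_mono cubic_lipschitz cubic_symbol_diff m f g) (auto simp: symbol_0 weight_minus weight_add[OF \<epsilon>])
  finally show ?thesis by (simp add: distrib_left)
qed

end
end

section \<open>The linear propagator\<close>

lemma nn_integral_int_le:
  assumes "\<And>J. finite J \<Longrightarrow> (\<Sum>j\<in>J. f j) \<le> (B :: ennreal)"
  shows "(\<integral>\<^sup>+ j. f j \<partial>count_space (UNIV :: int set)) \<le> B"
  unfolding nn_integral_int_eq_suminf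
proof (rule suminf_le_const)
  fix n
  have "(\<Sum>i<n. f (int_decode i)) = (\<Sum>j\<in>int_decode ` {..<n}. f j)"
    by (subst sum.reindex) (auto intro: inj_on_subset[OF inj_int_decode])
  then show "(\<Sum>i<n. f (int_decode i)) \<le> B" using assms by simp
qed simp

text \<open>The enumeration zigzags and reaches absolute value k > 0 exactly at the indices 2k - 1
  and 2k. This reduces power sums over the integers to p-series.\<close>

lemma abs_int_decode: "real n + 1 \<le> 2 * (1 + \<bar>real_of_int (int_decode n)\<bar>)"
proof -
  have "int n + 1 \<le> 2 * (1 + \<bar>int_decode n\<bar>)"
    unfolding int_decode_def sum_decode_def by (cases "even n") (auto elim!: evenE oddE)
  then have "real_of_int (int n + 1) \<le> real_of_int (2 * (1 + \<bar>int_decode n\<bar>))" by (simp only: of_int_le_iff)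
  then show ?thesis by simp
qed

lemma int_powr_summable:
  assumes "p > 1"
  shows "(isum (\<lambda>j. ennreal ((1 + \<bar>real_of_int j\<bar>) powr (- p)))) < \<infinity>"
proof -
  have "summable (\<lambda>n. real n powr (- p))" using assms by (simp add: summable_real_powr_iff)
  then have "summable (\<lambda>n. real (Suc n) powr (- p))" by (subst summable_Suc_iff)
  then have s: "summable (\<lambda>n. 2 powr p * real (Suc n) powr (- p))" by (rule summable_mult)
  have "(1 + \<bar>real_of_int (int_decode n)\<bar>) powr (- p) \<le> 2 powr p * real (Suc n) powr (- p)" for n
  proof -
    have "(1 + \<bar>real_of_int (int_decode n)\<bar>) powr (- p) \<le> (real (Suc n) / 2) powr (- p)"
      using abs_int_decode[of n] assms by (intro powr_mono2') auto
    also have "\<dots> = 2 powr p * real (Suc n) powr (- p)"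
      by (simp add: powr_divide powr_minus_divide)
    finally show ?thesis .
  qed
  then have "summable (\<lambda>n. (1 + \<bar>real_of_int (int_decode n)\<bar>) powr (- p))"
    by (intro summable_comparison_test'[OF s, of 0]) auto
  then show ?thesis by (simp add: nn_integral_int_eq_suminf suminf_ennreal2)
qed

lemma has_vector_derivative_cis [derivative_intros]:
  "((\<lambda>x. cis (w * x)) has_vector_derivative \<i> * of_real w * cis (w * x)) (at x within S)"
proof -
  have "((\<lambda>z. exp (\<i> * (of_real w * z))) has_field_derivative \<i> * of_real w * exp (\<i> * (of_real w * of_real x))) (at (of_real x))"
    by (auto intro!: derivative_eq_intros)
  from has_vector_derivative_real_field[OF this] show ?thesis by (simp add: cis_conv_exp)
qed

lemma has_vector_derivative_of_quotient:
  assumes "((\<lambda>s. (f (t + s) - f t) /\<^sub>R s) \<longlongrightarrow> f') (at 0)"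
  shows "(f has_vector_derivative f') (at t)"
proof -
  have "((\<lambda>s. norm ((f (t + s) - f t) /\<^sub>R s - f')) \<longlongrightarrow> 0) (at 0)"
    using assms by (simp add: tendsto_norm_zero_iff Lim_null[symmetric])
  then have "((\<lambda>s. norm (f (t + s) - f t - s *\<^sub>R f') / norm s) \<longlongrightarrow> 0) (at 0)"
  proof (rule Lim_transform_eventually)
    have "norm ((f (t + s) - f t) /\<^sub>R s - f') = norm (f (t + s) - f t - s *\<^sub>R f') / norm s" if "s \<noteq> 0" for s
    proof -
      have "(f (t + s) - f t) /\<^sub>R s - f' = (f (t + s) - f t - s *\<^sub>R f') /\<^sub>R s"
        using that by (simp add: scaleR_diff_right)
      then show ?thesis by (simp add: divide_inverse mult.commute)
    qed
    then show "\<forall>\<^sub>F s in at 0. norm ((f (t + s) - f t) /\<^sub>R s - f') = norm (f (t + s) - f t - s *\<^sub>R f') / norm s"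
      by (auto simp: eventually_at_filter)
  qed
  then show ?thesis
    by (simp add: has_vector_derivative_def has_derivative_at bounded_linear_scaleR_left)
qed

section \<open>Coefficient decay of a smooth potential\<close>

context circle begin

lemma l1_of_decay:
  assumes "\<And>j. (1 + (real_of_int j)\<^sup>2) * cmod (c j) \<le> D"
  shows "(isum (\<lambda>j. ennreal (cmod (c j))))
    \<le> ennreal (2 * D) * (isum (\<lambda>j. ennreal ((1 + \<bar>real_of_int j\<bar>) powr (- 2))))"
proof -
  have D: "D \<ge> 0" using order_trans[OF norm_ge_zero[of "c 0"]] assms[of 0] by simp
  have "cmod (c j) \<le> 2 * D * (1 + \<bar>real_of_int j\<bar>) powr (- 2)" for j
  proof -
    have "(1 + \<bar>real_of_int j\<bar>)\<^sup>2 \<le> 2 * (1 + (real_of_int j)\<^sup>2)"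
      using zero_le_power2[of "1 - \<bar>real_of_int j\<bar>"] by (simp add: power2_eq_square algebra_simps)
    then have "(1 + \<bar>real_of_int j\<bar>)\<^sup>2 * cmod (c j) \<le> 2 * (1 + (real_of_int j)\<^sup>2) * cmod (c j)"
      by (intro mult_right_mono) auto
    also have "\<dots> \<le> 2 * D" using mult_left_mono[OF assms[of j], of 2] by (simp only: mult.assoc)
    finally have "cmod (c j) \<le> 2 * D / (1 + \<bar>real_of_int j\<bar>)\<^sup>2" by (simp add: pos_le_divide_eq mult.commute)
    then show ?thesis by (simp add: powr_minus_divide)
  qed
  then have "(isum (\<lambda>j. ennreal (cmod (c j))))
    \<le> (isum (\<lambda>j. ennreal (2 * D) * ennreal ((1 + \<bar>real_of_int j\<bar>) powr (- 2))))"
    using D by (intro nn_integral_mono) (auto intro!: ennreal_leI simp flip: ennreal_mult)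
  then show ?thesis by (simp add: nn_integral_cmult)
qed

lemma l1_of_decay':
  assumes "\<And>j. (1 + (real_of_int j)\<^sup>2) * cmod (c j) \<le> D" shows "c \<in> l1"
  unfolding l1_def using order.strict_trans1[OF l1_of_decay[OF assms]] int_powr_summable[of 2]
  by (simp add: ennreal_mult_less_top)

lemma fourier_coeff_le_const:
  assumes "f \<in> borel_measurable \<mu>" "\<And>x. x \<in> {-T/2..T/2} \<Longrightarrow> cmod (f x) \<le> B"
  shows "cmod (fc f j) \<le> sqrt T * B"
proof -
  have i: "integrable \<mu> f"
    by (rule \<mu>.integrable_const_bound[of _ B]) (use assms in \<open>auto simp: space_\<mu> intro!: AE_I2\<close>)
  have "(LINT x|\<mu>. cmod (f x)) \<le> (LINT x|\<mu>. B)"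
    using i assms by (intro integral_mono) (auto simp: space_\<mu>)
  then have "cmod (fc f j) \<le> (T * B) / sqrt T"
    using fourier_coeff_le_integral[OF i, of j] T_pos divide_right_mono[of "LINT x|\<mu>. cmod (f x)" "T * B" "sqrt T"]
    by (simp add: measure_\<mu>)
  also have "\<dots> = sqrt T * B" using T_pos by (simp add: real_div_sqrt field_simps)
  finally show ?thesis .
qed

text \<open>Two integrations by parts over a period express the coefficients of the second
  derivative as \<open>- (2 * pi * j / T)\<^sup>2\<close> times those of \<open>V\<close>. The
  second derivative is continuous, hence bounded on a period, so the coefficients of
  \<open>V\<close> decay quadratically.\<close>

lemma smooth_periodic_wiener:
  assumes sm: "smooth V" and per: "periodic T V"
  shows "(\<lambda>x. complex_of_real (V x)) \<in> wiener"
proof -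
  define V1 V2 where "V1 = deriv V" and "V2 = deriv V1"
  have d: "((deriv ^^ n) V has_real_derivative (deriv ^^ Suc n) V x) (at x)" for n x
    using sm unfolding smooth_def
    by (simp add: DERIV_deriv_iff_real_differentiable differentiable_on_def)
  have d0: "(V has_real_derivative V1 x) (at x)" for x using d[of 0 x] by (simp add: V1_def)
  have d1: "(V1 has_real_derivative V2 x) (at x)" for x using d[of 1 x] by (simp add: V1_def V2_def)
  have d2: "(V2 has_real_derivative deriv V2 x) (at x)" for x
    using d[of 2 x] by (simp add: V1_def V2_def numeral_2_eq_2)
  have c: "continuous_on UNIV V" "continuous_on UNIV V1" "continuous_on UNIV V2"
    using d0 d1 d2 by (meson DERIV_continuous_on has_field_derivative_at_within)+
  have per1: "V1 (x + T) = V1 x" for x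
  proof -
    have "((\<lambda>y. V (y + T)) has_real_derivative V1 (x + T)) (at x)"
      using d0[of "x + T"] by (subst (asm) DERIV_shift) auto
    moreover have "(\<lambda>y. V (y + T)) = V" using per by (auto simp: periodic_def)
    ultimately show ?thesis using d0 DERIV_unique by metis
  qed
  have bd: "\<exists>B. \<forall>x\<in>{-T/2..T/2}. \<bar>W x\<bar> \<le> B" if "continuous_on UNIV W" for W :: "real \<Rightarrow> real"
  proof -
    have "bounded (W ` {-T/2..T/2})"
      by (intro compact_imp_bounded compact_continuous_image continuous_on_subset[OF that]) auto
    then show ?thesis by (auto simp: bounded_iff)
  qed
  obtain B0 B2 where B0: "\<And>x. x \<in> {-T/2..T/2} \<Longrightarrow> \<bar>V x\<bar> \<le> B0" and B2: "\<And>x. x \<in> {-T/2..T/2} \<Longrightarrow> \<bar>V2 x\<bar> \<le> B2"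
    using bd[OF c(1)] bd[OF c(3)] by blast
  have meas [measurable]: "(\<lambda>x. complex_of_real (V x)) \<in> borel_measurable lebesgue"
    "(\<lambda>x. complex_of_real (V2 x)) \<in> borel_measurable lebesgue"
    by (intro continuous_lebesgue_measurable continuous_intros c)+
  have L: "(\<lambda>x. complex_of_real (V x)) \<in> L2 T"
    by (rule L2_bounded[of _ B0]) (use per B0 in \<open>auto simp: periodic_def space_\<mu> intro!: AE_I2\<close>)
  let ?v = "fc (\<lambda>x. complex_of_real (V x))" and ?w = "fc (\<lambda>x. complex_of_real (V2 x))"
  have rel: "of_real ((2 * pi * of_int j / T)\<^sup>2) * ?v j = - ?w j" for j
  proof -
    define w where "w = 2 * pi * of_int j / T"
    \<comment> \<open>Both integrations by parts at once: the first-order terms in the derivative of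
      \<open>F\<close> cancel, which leaves \<open>f\<close>.\<close>
    define F where "F x = (of_real (V1 x) - \<i> * of_real w * of_real (V x)) * cis (w * x)" for x
    define f where "f x = (of_real (V2 x) + of_real (w\<^sup>2) * of_real (V x)) * cis (w * x)" for x
    have "(LBINT x:{-T/2..T/2}. f x) = F (T/2) - F (-T/2)"
      unfolding set_lebesgue_integral_def
    proof (rule integral_FTC_Icc)
      show "-T/2 \<le> T/2" using T_pos by simp
      show "continuous_on {-T/2..T/2} f" unfolding f_def
        by (intro continuous_intros continuous_on_subset[OF c(1)] continuous_on_subset[OF c(3)]) auto
      fix x
      have "((\<lambda>x. of_real (V1 x) - \<i> * of_real w * of_real (V x)) has_vector_derivative (of_real (V2 x) - \<i> * of_real w * of_real (V1 x))) (at x within {-T/2..T/2})"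
        by (rule has_vector_derivative_diff[OF has_vector_derivative_of_real[OF has_field_derivative_at_within[OF d1]]
              has_vector_derivative_mult_right[OF has_vector_derivative_of_real[OF has_field_derivative_at_within[OF d0]]]])
      from has_vector_derivative_mult[OF this has_vector_derivative_cis[of w x]]
      show "(F has_vector_derivative f x) (at x within {-T/2..T/2})"
        unfolding F_def f_def by (rule has_vector_derivative_eq_rhs) (simp add: algebra_simps power2_eq_square)
    qed
    also have "F (T/2) = F (-T/2)"
    proof -
      have a: "V (T/2) = V (-T/2)" "V1 (T/2) = V1 (-T/2)"
        using per[unfolded periodic_def, rule_format, of "-T/2"] per1[of "-T/2"] by simp_all
      have "w * (T/2) = w * (-T/2) + 2 * pi * of_int j" using T_pos by (simp add: w_def field_simps)
      then have "cis (w * (T/2)) = cis (w * (-T/2)) * cis (2 * pi * of_int j)" by (simp only: cis_mult)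
      also have "cis (2 * pi * of_int j) = 1" by (rule cis_multiple_2pi) simp
      finally show ?thesis by (simp only: F_def a mult_1_right)
    qed
    finally have 0: "(LBINT x:{-T/2..T/2}. f x) = 0" by simp
    have cf: "continuous_on UNIV f" unfolding f_def by (intro continuous_intros c)
    then have [measurable]: "f \<in> borel_measurable borel" by (rule borel_measurable_continuous_onI)
    have "(LINT x|\<mu>. f x) = (LBINT x:{-T/2..T/2}. f x)"
      unfolding set_integral_\<mu>[symmetric] set_lebesgue_integral_def
      by (rule integral_completion) measurable
    with 0 have 1: "(LINT x|\<mu>. of_real (1 / sqrt T) * f x) = 0" by simp
    have e: "cnj (bas j x) = of_real (1 / sqrt T) * cis (w * x)" for x
      by (simp add: basis_fun_eq cis_cnj w_def)
    have i: "integrable \<mu> (\<lambda>x. complex_of_real (V2 x))"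
      by (rule \<mu>.integrable_const_bound[of _ B2]) (use B2 in \<open>auto simp: space_\<mu> measurable_\<mu> intro!: AE_I2\<close>)
    have eqf: "(\<lambda>x. of_real (1 / sqrt T) * f x) = (\<lambda>x. (1 * of_real (V2 x) + of_real (w\<^sup>2) * of_real (V x)) * cnj (bas j x))"
      by (simp add: e f_def fun_eq_iff)
    have "fc (\<lambda>x. 1 * of_real (V2 x) + of_real (w\<^sup>2) * of_real (V x)) j = 0"
      unfolding fourier_coeff_eq eqf[symmetric] by (rule 1)
    then have "?w j + of_real (w\<^sup>2) * ?v j = 0"
      by (subst (asm) fourier_coeff_lin[OF i L2_integrable[OF L]]) simp
    then show ?thesis unfolding w_def by (simp add: add_eq_0_iff)
  qed
  define D where "D = sqrt T * B0 + (T / (2 * pi))\<^sup>2 * (sqrt T * B2)"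
  have "(1 + (real_of_int j)\<^sup>2) * cmod (?v j) \<le> D" for j
  proof -
    have "(2 * pi * of_int j / T)\<^sup>2 * cmod (?v j) = cmod (?w j)"
      using arg_cong[OF rel[of j], of cmod] by (simp add: norm_mult norm_power norm_divide abs_mult power_divide power_mult_distrib del: of_real_power)
    also have "\<dots> \<le> sqrt T * B2" by (rule fourier_coeff_le_const[OF measurable_\<mu>[OF meas(2)]]) (use B2 in auto)
    finally have "(T / (2 * pi))\<^sup>2 * ((2 * pi * of_int j / T)\<^sup>2 * cmod (?v j)) \<le> (T / (2 * pi))\<^sup>2 * (sqrt T * B2)"
      by (intro mult_left_mono) auto
    moreover have "(T / (2 * pi))\<^sup>2 * ((2 * pi * of_int j / T)\<^sup>2 * cmod (?v j)) = (real_of_int j)\<^sup>2 * cmod (?v j)"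
      using T_pos by (simp add: power_divide power_mult_distrib field_simps)
    moreover have "cmod (?v j) \<le> sqrt T * B0" by (rule fourier_coeff_le_const[OF measurable_\<mu>[OF meas(1)]]) (use B0 in auto)
    ultimately show ?thesis unfolding D_def distrib_right mult_1_left by linarith
  qed
  then have "?v \<in> l1" by (rule l1_of_decay')
  with L show ?thesis by (simp add: wiener_def anorm_eq l1_def)
qed

end

section \<open>The unitary group and its generator\<close>

locale propagator = circle +
  fixes V :: "real \<Rightarrow> real" and U :: "real \<Rightarrow> (real \<Rightarrow> complex) \<Rightarrow> real \<Rightarrow> complex"
  assumes V_smooth: "smooth V" and V_periodic: "periodic T V"
    and group: "schroedinger_group T V U"
begin

abbreviation Vc :: "real \<Rightarrow> complex" where "Vc \<equiv> \<lambda>x. of_real (V x)"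

lemma V_wiener: "Vc \<in> wiener"
  by (rule smooth_periodic_wiener[OF V_smooth V_periodic])

lemma U_L2: "f \<in> L2 T \<Longrightarrow> U t f \<in> L2 T"
  and U_norm: "f \<in> L2 T \<Longrightarrow> L2_norm T (U t f) = L2_norm T f"
  and U_lin: "f \<in> L2 T \<Longrightarrow> g \<in> L2 T \<Longrightarrow> AE x in lebesgue. U t (\<lambda>y. a * f y + b * g y) x = a * U t f x + b * U t g x"
  and U_0: "f \<in> L2 T \<Longrightarrow> AE x in lebesgue. U 0 f x = f x"
  and U_add: "f \<in> L2 T \<Longrightarrow> AE x in lebesgue. U (s + t) f x = U s (U t f) x"
  and generator: "group_generator T U f h \<longleftrightarrow> schroedinger_op T V f (\<lambda>x. \<i> * h x)"
  using group unfolding schroedinger_group_def unitary_group_def by blast+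

lemma U_diff:
  assumes "f \<in> L2 T" "g \<in> L2 T"
  shows "AE x in lebesgue. U t (\<lambda>y. f y - g y) x = U t f x - U t g x"
  using U_lin[OF assms, of t 1 "-1"] by simp

lemma U_sum:
  assumes "finite J" "\<And>k. k \<in> J \<Longrightarrow> f k \<in> L2 T"
  shows "AE x in lebesgue. U t (\<lambda>y. \<Sum>k\<in>J. c k * f k y) x = (\<Sum>k\<in>J. c k * U t (f k) x)"
  using assms
proof (induction J rule: finite_induct)
  case empty
  show ?case using U_lin[OF L2_zero L2_zero, of t 0 0] by simp
next
  case (insert k J)
  have "AE x in lebesgue. U t (\<lambda>y. c k * f k y + 1 * (\<Sum>k\<in>J. c k * f k y)) x = c k * U t (f k) x + 1 * U t (\<lambda>y. \<Sum>k\<in>J. c k * f k y) x"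
    using insert by (intro U_lin L2_sum) auto
  moreover have "AE x in lebesgue. U t (\<lambda>y. \<Sum>k\<in>J. c k * f k y) x = (\<Sum>k\<in>J. c k * U t (f k) x)"
    using insert by auto
  ultimately show ?case by eventually_elim (use insert in simp)
qed

lemma generator_L2: "group_generator T U f h \<Longrightarrow> f \<in> L2 T" "group_generator T U f h \<Longrightarrow> h \<in> L2 T"
  by (auto simp: group_generator_def)

text \<open>By linearity and the group law \<open>U t\<close> commutes with difference quotients up
  to null sets, and it is an isometry, so the defining limit is carried along the orbit.\<close>

lemma generator_U:
  assumes "group_generator T U f h"
  shows "group_generator T U (U t f) (U t h)"
proof -
  note L = generator_L2[OF assms]
  have "L2_norm T (\<lambda>x. (U s (U t f) x - U t f x) / of_real s - U t h x)
      = L2_norm T (\<lambda>x. (U s f x - f x) / of_real s - h x)" for s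
  proof -
    define q where "q x = (1 / of_real s) * U s f x + (- 1 / of_real s) * f x" for x
    have q: "q \<in> L2 T" unfolding q_def by (intro L2_lin U_L2 L)
    have eq: "(\<lambda>x. (U s f x - f x) / of_real s - h x) = (\<lambda>x. 1 * q x + (-1) * h x)"
      by (simp add: q_def diff_divide_distrib)
    have "AE x in lebesgue. U t (\<lambda>x. 1 * q x + (-1) * h x) x = (U s (U t f) x - U t f x) / of_real s - U t h x"
      using U_lin[OF q L(2), of t 1 "-1"] U_lin[OF U_L2[OF L(1)] L(1), of t "1 / of_real s" s "- 1 / of_real s"]
        U_add[OF L(1), of s t] U_add[OF L(1), of t s]
      by eventually_elim (simp add: q_def[abs_def] diff_divide_distrib add.commute)
    then have "L2_norm T (U t (\<lambda>x. 1 * q x + (-1) * h x)) = L2_norm T (\<lambda>x. (U s (U t f) x - U t f x) / of_real s - U t h x)"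
    proof (rule L2_norm_cong)
      show "U t (\<lambda>x. 1 * q x + (-1) * h x) \<in> borel_measurable lebesgue"
        by (intro L2_measurable U_L2 L2_lin q L)
      have [measurable]: "U s (U t f) \<in> borel_measurable lebesgue" "U t f \<in> borel_measurable lebesgue" "U t h \<in> borel_measurable lebesgue"
        by (intro L2_measurable U_L2 L)+
      show "(\<lambda>x. (U s (U t f) x - U t f x) / of_real s - U t h x) \<in> borel_measurable lebesgue"
        by measurable
    qed
    then show ?thesis unfolding eq using U_norm[OF L2_lin[OF q L(2), of 1 "-1"]] by simp
  qed
  then show ?thesis using assms U_L2 by (auto simp: group_generator_def)
qed

text \<open>The eigenvalue of the kinetic part on \<open>bas j\<close>, without the
  potential.\<close>

definition eigenvalue :: "int \<Rightarrow> real" where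
  "eigenvalue j = 1/2 * (2 * pi * of_int j / T)\<^sup>2"

lemma schroedinger_op_coeff:
  assumes "schroedinger_op T V f g"
  shows "fc g j = of_real (eigenvalue j) * fc f j + fc (\<lambda>x. Vc x * f x) j"
proof -
  from assms obtain h where f: "f \<in> L2 T" and g: "g \<in> L2 T" and h: "h \<in> L2 T"
    and hc: "\<And>j. fc h j = - of_real ((2 * pi * of_int j / T)\<^sup>2) * fc f j"
    and ae: "AE x in lebesgue. g x = - (1/2) * h x + of_real (V x) * f x"
    unfolding schroedinger_op_def has_second_deriv_def sobolev_def by blast
  have Vf: "(\<lambda>x. Vc x * f x) \<in> L2 T" by (rule wiener_mult_L2[OF V_wiener f])
  have "fc g j = fc (\<lambda>x. (- (1/2)) * h x + 1 * (Vc x * f x)) j"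
    by (rule fourier_coeff_cong[OF _ L2_measurable[OF g] L2_measurable[OF L2_lin[OF h Vf]]])
       (use ae in simp)
  also have "\<dots> = (- (1/2)) * fc h j + 1 * fc (\<lambda>x. Vc x * f x) j"
    by (rule fourier_coeff_lin[OF h[THEN L2_integrable] Vf[THEN L2_integrable]])
  finally show ?thesis by (simp add: hc eigenvalue_def)
qed

lemma basis_in_domain:
  obtains g where "group_generator T U (bas k) g"
proof -
  let ?e = "bas k"
  define a :: complex where "a = - of_real ((2 * pi * of_int k / T)\<^sup>2)"
  define h where "h x = a * ?e x" for x
  \<comment> \<open>The factor \<open>-\<i>\<close> undoes the \<open>\<i>\<close> in
    \<open>generator\<close>.\<close>
  define g where "g x = (-\<i>) * ((-1/2) * h x + 1 * (Vc x * ?e x))" for x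
  have h: "h \<in> L2 T" unfolding h_def by (intro L2_cmult basis_L2)
  have Ve: "(\<lambda>x. Vc x * ?e x) \<in> L2 T" by (rule wiener_mult_L2[OF V_wiener basis_L2])
  have "?e \<in> sobolev T 2"
    unfolding sobolev_def using basis_L2
    by (auto intro!: finite_nonzero_values_imp_summable_on finite_subset[of _ "{k}"]
        simp: sobolev_term_def fourier_coeff_basis split: if_splits)
  moreover have "(\<lambda>x. (-1/2) * h x + 1 * (Vc x * ?e x)) \<in> L2 T"
    by (intro L2_lin h Ve)
  moreover have "has_second_deriv T ?e h"
    unfolding has_second_deriv_def using h
    by (auto simp: h_def[abs_def] fourier_coeff_cmult fourier_coeff_basis a_def[symmetric])
      (simp add: a_def)
  ultimately have "schroedinger_op T V ?e (\<lambda>x. (-1/2) * h x + 1 * (Vc x * ?e x))"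
    unfolding schroedinger_op_def by (intro conjI exI[of _ h]) auto
  then have "group_generator T U ?e g" unfolding generator g_def by (simp flip: mult.assoc)
  then show ?thesis by (rule that)
qed

text \<open>A coefficient is dominated by the L2 norm, so the norm limit defining the generator
  differentiates every coefficient; \<open>generator_U\<close> moves the limit from time 0 to time
  \<open>t\<close>.\<close>

lemma coeff_derivative:
  assumes "group_generator T U f g"
  shows "((\<lambda>t. fc (U t f) j) has_vector_derivative fc (U t g) j) (at t)"
proof -
  note L = generator_L2[OF assms]
  have lim: "((\<lambda>s. L2_norm T (\<lambda>x. (U s (U t f) x - U t f x) / of_real s - U t g x)) \<longlongrightarrow> 0) (at 0)"
    using generator_U[OF assms, of t] by (simp add: group_generator_def)
  have est: "norm ((fc (U (t + s) f) j - fc (U t f) j) /\<^sub>R s - fc (U t g) j)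
      \<le> L2_norm T (\<lambda>x. (U s (U t f) x - U t f x) / of_real s - U t g x)" for s
  proof -
    define q where "q x = (1 / of_real s) * U s (U t f) x + (- 1 / of_real s) * U t f x" for x
    have q: "q \<in> L2 T" unfolding q_def by (intro L2_lin U_L2 L)
    have "fc (U (t + s) f) j = fc (U s (U t f)) j"
      using fourier_coeff_cong[OF U_add[OF L(1), of s t], of j] L2_measurable U_L2 L by (simp add: add.commute)
    then have qc: "fc q j = (fc (U (t + s) f) j - fc (U t f) j) /\<^sub>R s"
      unfolding q_def
      by (subst fourier_coeff_lin) (auto intro!: L2_integrable U_L2 L simp: scaleR_conv_of_real diff_divide_distrib field_simps)
    have "fc (\<lambda>x. q x - U t g x) j = (fc (U (t + s) f) j - fc (U t f) j) /\<^sub>R s - fc (U t g) j"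
      by (simp add: fourier_coeff_diff L2_integrable q U_L2 L qc)
    moreover have "cmod (fc (\<lambda>x. q x - U t g x) j) \<le> L2_norm T (\<lambda>x. q x - U t g x)"
      by (intro fourier_coeff_le_L2_norm L2_diff q U_L2 L)
    moreover have "(\<lambda>x. q x - U t g x) = (\<lambda>x. (U s (U t f) x - U t f x) / of_real s - U t g x)"
      by (simp add: q_def diff_divide_distrib)
    ultimately show ?thesis by simp
  qed
  have "((\<lambda>s. (fc (U (t + s) f) j - fc (U t f) j) /\<^sub>R s - fc (U t g) j) \<longlongrightarrow> 0) (at 0)"
    by (rule Lim_null_comparison[OF _ lim]) (use est in auto)
  then have "((\<lambda>s. (fc (U (t + s) f) j - fc (U t f) j) /\<^sub>R s) \<longlongrightarrow> fc (U t g) j) (at 0)"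
    by (simp add: Lim_null[symmetric])
  then show ?thesis
    by (rule has_vector_derivative_of_quotient)
qed

end

context circle begin

text \<open>Finite sums, to which the linearity of \<open>U\<close> applies before a limit is taken
  in L2.\<close>

definition partial :: "nat \<Rightarrow> (real \<Rightarrow> complex) \<Rightarrow> real \<Rightarrow> complex" where
  "partial n f x = (\<Sum>i<n. fc f (int_decode i) * bas (int_decode i) x)"

lemma partial_L2: "partial n f \<in> L2 T"
  unfolding partial_def by (intro L2_sum basis_L2) auto

lemma L2_norm_le_const:
  assumes "f \<in> L2 T" "AE x in \<mu>. cmod (f x) \<le> B" "B \<ge> 0"
  shows "L2_norm T f \<le> sqrt T * B"
proof -
  have "(LINT x|\<mu>. (cmod (f x))\<^sup>2) \<le> (LINT x|\<mu>. B\<^sup>2)"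
  proof (rule integral_mono_AE[OF L2_square_integrable[OF assms(1)]])
    show "AE x in \<mu>. (cmod (f x))\<^sup>2 \<le> B\<^sup>2" using assms(2) by eventually_elim (auto intro: power_mono)
  qed simp
  then have "(LINT x|\<mu>. (cmod (f x))\<^sup>2) \<le> (sqrt T * B)\<^sup>2" using T_pos by (simp add: measure_\<mu> power_mult_distrib)
  then show ?thesis unfolding L2_norm_eq using assms(3) T_pos by (intro real_le_lsqrt) auto
qed

text \<open>The remainder is bounded, uniformly in \<open>x\<close>, by the l1 tail of the
  coefficients over \<open>sqrt T\<close>, and on a bounded interval a uniform bound is an L2
  bound.\<close>

lemma partial_tendsto:
  assumes f: "f \<in> wiener"
  shows "(\<lambda>n. L2_norm T (\<lambda>x. f x - partial n f x)) \<longlonglongrightarrow> 0"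
proof -
  define c where "c i = cmod (fc f (int_decode i))" for i
  have s: "summable c" unfolding c_def by (rule l1_summable[OF wiener_coeff_l1[OF f]])
  have le: "L2_norm T (\<lambda>x. f x - partial n f x) \<le> sqrt T * ((\<Sum>i. c (i + n)) / sqrt T)" for n
  proof (rule L2_norm_le_const)
    show "(\<lambda>x. f x - partial n f x) \<in> L2 T" by (intro L2_diff wiener_L2 f partial_L2)
    show "AE x in \<mu>. cmod (f x - partial n f x) \<le> (\<Sum>i. c (i + n)) / sqrt T"
      using AE_\<mu>[OF wiener_expansion[OF f]]
    proof eventually_elim
      case (elim x)
      let ?a = "\<lambda>i. fc f (int_decode i) * bas (int_decode i) x"
      have as: "summable (\<lambda>i. cmod (?a i))" by (rule trig_abs_summable[OF wiener_coeff_l1[OF f]])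
      have "f x - partial n f x = (\<Sum>i. ?a (i + n))"
        using suminf_split_initial_segment[OF summable_norm_cancel[OF as], of n]
        by (simp add: elim trig_def partial_def)
      also have "cmod \<dots> \<le> (\<Sum>i. cmod (?a (i + n)))"
        using as by (intro summable_norm) (simp add: summable_iff_shift[of "\<lambda>i. cmod (?a i)"])
      also have "\<dots> = (\<Sum>i. c (i + n) / sqrt T)" by (simp add: norm_mult c_def)
      also have "\<dots> = (\<Sum>i. c (i + n)) / sqrt T"
        using s by (intro suminf_divide) (simp add: summable_iff_shift)
      finally show ?case .
    qed
    have "summable (\<lambda>i. c (i + n))" using s by (simp add: summable_iff_shift)
    moreover have "\<And>i. c i \<ge> 0" by (simp add: c_def)
    ultimately
    show "(\<Sum>i. c (i + n)) / sqrt T \<ge> 0"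
      using T_pos by (intro divide_nonneg_nonneg suminf_nonneg) auto
  qed
  have "(\<lambda>n. \<Sum>i. c (i + n)) \<longlonglongrightarrow> 0" by (rule suminf_exist_split2[OF s])
  then have "(\<lambda>n. sqrt T * ((\<Sum>i. c (i + n)) / sqrt T)) \<longlonglongrightarrow> sqrt T * (0 / sqrt T)"
    using T_pos by (intro tendsto_intros) auto
  then have lim: "(\<lambda>n. sqrt T * ((\<Sum>i. c (i + n)) / sqrt T)) \<longlonglongrightarrow> 0" by simp
  show ?thesis by (rule tendsto_sandwich[OF _ _ tendsto_const lim]) (use le L2_norm_nonneg in auto)
qed

end

context propagator begin

section \<open>Growth of the propagator in the Wiener norm\<close>

definition Vconst :: real where "Vconst = enn2real (ennreal (1 / sqrt T) * anorm Vc)"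

lemma anorm_mult_V: "f \<in> L2 T \<Longrightarrow> anorm (\<lambda>x. Vc x * f x) \<le> ennreal Vconst * anorm f"
proof -
  have "ennreal Vconst = ennreal (1 / sqrt T) * anorm Vc"
    unfolding Vconst_def using V_wiener by (intro ennreal_enn2real) (simp add: wiener_def ennreal_mult_less_top)
  then show "f \<in> L2 T \<Longrightarrow> anorm (\<lambda>x. Vc x * f x) \<le> ennreal Vconst * anorm f"
    using anorm_mult[OF V_wiener, of f] by (simp add: mult.assoc)
qed

lemma eigenvalue_nonneg: "eigenvalue j \<ge> 0"
  by (simp add: eigenvalue_def)

text \<open>The orbit stays in the domain while \<open>U t (bas k)\<close> and \<open>U t g\<close>
  keep their L2 norms. Solving the coefficient form of the operator for the kinetic term bounds
  \<open>eigenvalue j\<close> times the coefficient uniformly in \<open>t\<close> and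
  \<open>j\<close>, which is quadratic decay. The bound depends on \<open>k\<close>; its purpose is
  to make a supremum finite.\<close>

lemma U_basis_apriori:
  obtains D where "\<And>t. anorm (U t (bas k)) \<le> D" "D < \<infinity>"
proof -
  let ?e = "bas k"
  obtain g where g: "group_generator T U ?e g" by (rule basis_in_domain)
  obtain B where B: "B \<ge> 0" "AE x in \<mu>. cmod (Vc x) \<le> B" by (rule wiener_bounded[OF V_wiener])
  note L = generator_L2[OF g]
  have V: "periodic T Vc" "Vc \<in> borel_measurable lebesgue"
    using L2_periodic L2_measurable wiener_L2[OF V_wiener] by auto
  \<comment> \<open>The first term bounds the coefficient itself; the factor of the second is the
    inverse of \<open>2 * pi\<^sup>2 / T\<^sup>2\<close>, which relates \<open>eigenvalue j\<close>
    to the square of \<open>j\<close>.\<close>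
  define D where "D = L2_norm T ?e + T\<^sup>2 / (2 * pi\<^sup>2) * (L2_norm T g + B * L2_norm T ?e)"
  have b: "(1 + (real_of_int j)\<^sup>2) * cmod (fc (U t ?e) j) \<le> D" for t j
  proof -
    let ?u = "U t ?e"
    have u: "?u \<in> L2 T" by (rule U_L2[OF basis_L2])
    have "schroedinger_op T V ?u (\<lambda>x. \<i> * U t g x)" using generator_U[OF g, of t] generator by blast
    from schroedinger_op_coeff[OF this, of j]
    have "of_real (eigenvalue j) * fc ?u j = \<i> * fc (U t g) j - fc (\<lambda>x. Vc x * ?u x) j"
      by (simp add: fourier_coeff_cmult)
    then have "cmod (of_real (eigenvalue j) * fc ?u j) \<le> cmod (fc (U t g) j) + cmod (fc (\<lambda>x. Vc x * ?u x) j)"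
      using norm_triangle_ineq4[of "\<i> * fc (U t g) j"] by (simp add: norm_mult)
    also have "\<dots> \<le> L2_norm T (U t g) + L2_norm T (\<lambda>x. Vc x * ?u x)"
      by (intro add_mono fourier_coeff_le_L2_norm U_L2 L wiener_mult_L2 V_wiener)
    also have "\<dots> \<le> L2_norm T (U t g) + B * L2_norm T ?u"
      by (intro add_left_mono L2_mult_bounded(2)[OF u V B(2,1)])
    also have "\<dots> = L2_norm T g + B * L2_norm T ?e" using L by (simp add: U_norm)
    finally have "eigenvalue j * cmod (fc ?u j) \<le> L2_norm T g + B * L2_norm T ?e"
      by (simp add: norm_mult eigenvalue_nonneg)
    then have "T\<^sup>2 / (2 * pi\<^sup>2) * (eigenvalue j * cmod (fc ?u j)) \<le> T\<^sup>2 / (2 * pi\<^sup>2) * (L2_norm T g + B * L2_norm T ?e)"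
      by (intro mult_left_mono) auto
    moreover have "T\<^sup>2 / (2 * pi\<^sup>2) * (eigenvalue j * cmod (fc ?u j)) = (real_of_int j)\<^sup>2 * cmod (fc ?u j)"
      using T_pos by (simp add: eigenvalue_def power_divide power_mult_distrib field_simps)
    moreover have "cmod (fc ?u j) \<le> L2_norm T ?e"
      using fourier_coeff_le_L2_norm[OF u, of j] U_norm[OF basis_L2] by simp
    ultimately show ?thesis by (simp add: D_def algebra_simps)
  qed
  show ?thesis
  proof (rule that)
    fix t show "anorm (U t ?e) \<le> ennreal (2 * D) * (isum (\<lambda>j. ennreal ((1 + \<bar>real_of_int j\<bar>) powr (- 2))))"
      unfolding anorm_eq by (rule l1_of_decay[OF b])
    show "ennreal (2 * D) * (isum (\<lambda>j. ennreal ((1 + \<bar>real_of_int j\<bar>) powr (- 2)))) < \<infinity>"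
      using int_powr_summable[of 2] by (simp add: ennreal_mult_less_top)
  qed
qed

text \<open>A time so short that the potential contributes at most half of the current bound, see
  \<open>tau_Vconst\<close>. The added 1 allows \<open>Vconst\<close> to vanish.\<close>

definition tau :: real where "tau = 1 / (2 * (Vconst + 1))"

lemma Vconst_nonneg: "Vconst \<ge> 0" by (simp add: Vconst_def)

lemma tau_pos: "tau > 0" using Vconst_nonneg by (simp add: tau_def)

lemma tau_Vconst: "tau * Vconst \<le> 1/2"
  using Vconst_nonneg by (simp add: tau_def field_simps)

text \<open>In the interaction picture \<open>cis (\<lambda>\<^sub>j t) (U t e\<^sub>k)\<^sub>j\<close> only the potential contributes to the
  derivative; the phases \<open>\<theta>\<close> turn a finite sum of moduli into a scalar function to which
  the mean value theorem applies.\<close>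

lemma U_basis_growth:
  assumes J: "finite J" and t: "0 \<le> t" "t \<le> tau"
    and S: "\<And>s. s \<in> {0..tau} \<Longrightarrow> anorm (U s (bas k)) \<le> ennreal S" and S0: "S \<ge> 0"
  shows "(\<Sum>j\<in>J. cmod (fc (U t (bas k)) j)) \<le> 1 + S / 2"
proof -
  let ?e = "bas k"
  obtain g where g: "group_generator T U ?e g" by (rule basis_in_domain)
  define a where "a j s = fc (U s ?e) j" for j s
  define v where "v j s = fc (\<lambda>x. Vc x * U s ?e x) j" for j s
  define \<theta> where "\<theta> j = cnj (sgn (cis (eigenvalue j * t) * a j t))" for j
  have \<theta>: "\<theta> j * (cis (eigenvalue j * t) * a j t) = of_real (cmod (a j t))" for j
  proof -
    have "cnj (sgn z) * z = of_real (cmod z)" for z :: complex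
      by (cases "z = 0") (auto simp: sgn_eq complex_norm_square[symmetric] power2_eq_square mult.commute[of "cnj z"])
    then show ?thesis by (simp add: \<theta>_def norm_mult)
  qed
  have \<theta>1: "cmod (\<theta> j) \<le> 1" for j by (simp add: \<theta>_def norm_sgn)
  have da: "(a j has_vector_derivative (- \<i>) * (of_real (eigenvalue j) * a j s + v j s)) (at s)" for j s
  proof -
    have "schroedinger_op T V (U s ?e) (\<lambda>x. \<i> * U s g x)" using generator_U[OF g, of s] generator by blast
    from schroedinger_op_coeff[OF this, of j]
    have "\<i> * fc (U s g) j = of_real (eigenvalue j) * a j s + v j s"
      by (simp add: fourier_coeff_cmult a_def v_def)
    then have "fc (U s g) j = (- \<i>) * (of_real (eigenvalue j) * a j s + v j s)"
      by (metis (no_types, lifting) complex_i_mult_minus minus_mult_left minus_minus)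
    then show ?thesis using coeff_derivative[OF g, of j s] by (simp add: a_def[abs_def])
  qed
  define \<beta> where "\<beta> s = Re (\<Sum>j\<in>J. \<theta> j * (cis (eigenvalue j * s) * a j s))" for s
  define \<beta>' where "\<beta>' s = Re (\<Sum>j\<in>J. \<theta> j * (cis (eigenvalue j * s) * ((- \<i>) * v j s)))" for s
  have d\<beta>: "(\<beta> has_real_derivative \<beta>' s) (at s)" for s
  proof -
    have "((\<lambda>s. cis (eigenvalue j * s) * a j s) has_vector_derivative cis (eigenvalue j * s) * ((- \<i>) * v j s)) (at s)" for j
      by (rule has_vector_derivative_eq_rhs[OF has_vector_derivative_mult[OF has_vector_derivative_cis da]])
         (simp add: algebra_simps)
    then have "((\<lambda>s. \<Sum>j\<in>J. \<theta> j * (cis (eigenvalue j * s) * a j s)) has_vector_derivative (\<Sum>j\<in>J. \<theta> j * (cis (eigenvalue j * s) * ((- \<i>) * v j s)))) (at s)"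
      by (intro has_vector_derivative_sum has_vector_derivative_mult_right)
    then show ?thesis unfolding \<beta>_def \<beta>'_def has_real_derivative_iff_has_vector_derivative
      by (rule bounded_linear.has_vector_derivative[OF bounded_linear_Re])
  qed
  have sum_le: "ennreal (\<Sum>j\<in>J. cmod (fc f j)) \<le> anorm f" for f
  proof -
    have "ennreal (\<Sum>j\<in>J. cmod (fc f j)) = (\<integral>\<^sup>+ j. ennreal (cmod (fc f j)) \<partial>count_space J)"
      using J by (simp add: nn_integral_count_space_finite)
    also have "\<dots> \<le> anorm f"
      unfolding anorm_eq by (subst nn_integral_count_space_indicator) (auto intro!: nn_integral_mono simp: indicator_def)
    finally show ?thesis .
  qed
  have \<beta>'_le: "\<beta>' s \<le> Vconst * S" if "s \<in> {0..tau}" for s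
  proof -
    have "\<beta>' s \<le> (\<Sum>j\<in>J. cmod (\<theta> j * (cis (eigenvalue j * s) * ((- \<i>) * v j s))))"
      unfolding \<beta>'_def by (rule order_trans[OF complex_Re_le_cmod norm_sum])
    also have "\<dots> \<le> (\<Sum>j\<in>J. cmod (v j s))"
      by (intro sum_mono) (simp add: norm_mult mult_left_le_one_le \<theta>1)
    finally have le: "\<beta>' s \<le> (\<Sum>j\<in>J. cmod (v j s))" .
    have "ennreal (\<Sum>j\<in>J. cmod (v j s)) \<le> anorm (\<lambda>x. Vc x * U s ?e x)"
      unfolding v_def by (rule sum_le)
    also have "\<dots> \<le> ennreal Vconst * anorm (U s ?e)" by (rule anorm_mult_V[OF U_L2[OF basis_L2]])
    also have "\<dots> \<le> ennreal Vconst * ennreal S" by (intro mult_left_mono S that) auto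
    also have "\<dots> = ennreal (Vconst * S)" using Vconst_nonneg S0 by (simp add: ennreal_mult)
    finally have "(\<Sum>j\<in>J. cmod (v j s)) \<le> Vconst * S" using Vconst_nonneg S0 by (simp add: ennreal_le_iff)
    with le show ?thesis by simp
  qed
  have \<beta>0: "\<beta> 0 \<le> 1"
  proof -
    have a0: "a j 0 = (if k = j then 1 else 0)" for j
      unfolding a_def using fourier_coeff_cong[OF U_0[OF basis_L2] L2_measurable[OF U_L2[OF basis_L2]] L2_measurable[OF basis_L2]]
      by (simp add: fourier_coeff_basis)
    have "\<beta> 0 \<le> (\<Sum>j\<in>J. cmod (\<theta> j * (cis (eigenvalue j * 0) * a j 0)))"
      unfolding \<beta>_def by (rule order_trans[OF complex_Re_le_cmod norm_sum])
    also have "\<dots> \<le> (\<Sum>j\<in>J. if j = k then 1 else 0)"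
      using \<theta>1 by (intro sum_mono) (auto simp: a0 norm_mult)
    also have "\<dots> \<le> 1" using J by simp
    finally show ?thesis .
  qed
  \<comment> \<open>The phases are frozen at the final time \<open>t\<close>, where each summand
    becomes its modulus; at other times only \<open>cmod (\<theta> j) \<le> 1\<close>
    enters.\<close>
  have \<beta>t: "\<beta> t = (\<Sum>j\<in>J. cmod (a j t))"
    unfolding \<beta>_def \<theta> by simp
  have "\<beta> t \<le> \<beta> 0 + t * (Vconst * S)"
  proof (cases "t = 0")
    case False
    with t have "0 < t" by simp
    from MVT2[OF this, of \<beta> \<beta>'] d\<beta> obtain z where z: "0 < z" "z < t" "\<beta> t - \<beta> 0 = (t - 0) * \<beta>' z" by blast
    have "t * \<beta>' z \<le> t * (Vconst * S)" using z t by (intro mult_left_mono \<beta>'_le) auto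
    moreover have "\<beta> t - \<beta> 0 = t * \<beta>' z" using z by simp
    ultimately show ?thesis by linarith
  qed simp
  also have "t * (Vconst * S) \<le> tau * (Vconst * S)"
    using t Vconst_nonneg S0 by (intro mult_right_mono) auto
  also have "\<dots> \<le> 1/2 * S" using mult_right_mono[OF tau_Vconst S0] by (simp add: mult.assoc)
  finally show ?thesis using \<beta>0 unfolding \<beta>t a_def by simp
qed

text \<open>The supremum \<open>r\<close> over \<open>{0..tau}\<close> satisfies
  \<open>r \<le> 1 + r / 2\<close> by \<open>U_basis_growth\<close>. It is finite by the a priori
  bound, so \<open>r / 2\<close> can be absorbed, and the resulting 2 is the same for all
  \<open>k\<close>.\<close>

lemma U_basis_le_2:
  assumes t: "t \<in> {0..tau}"
  shows "anorm (U t (bas k)) \<le> 2"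
proof -
  let ?e = "bas k"
  obtain D where D: "\<And>t. anorm (U t ?e) \<le> D" "D < \<infinity>" using U_basis_apriori by blast
  define S where "S = (SUP s\<in>{0..tau}. anorm (U s ?e))"
  have "S \<le> D" unfolding S_def by (intro SUP_least D)
  then have "S < \<infinity>" using D(2) by (rule order.strict_trans1)
  then obtain r where r: "r \<ge> 0" "S = ennreal r" by (cases S) auto
  have le: "anorm (U s ?e) \<le> ennreal r" if "s \<in> {0..tau}" for s
    unfolding r(2)[symmetric] S_def by (rule SUP_upper[OF that])
  have "anorm (U s ?e) \<le> ennreal (1 + r / 2)" if "s \<in> {0..tau}" for s
    unfolding anorm_eq
  proof (rule nn_integral_int_le)
    fix J :: "int set" assume J: "finite J"
    have "(\<Sum>j\<in>J. ennreal (cmod (fc (U s ?e) j))) = ennreal (\<Sum>j\<in>J. cmod (fc (U s ?e) j))"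
      by (rule sum_ennreal) simp
    also have "\<dots> \<le> ennreal (1 + r / 2)"
      by (intro ennreal_leI U_basis_growth J le r) (use that in auto)
    finally show "(\<Sum>j\<in>J. ennreal (cmod (fc (U s ?e) j))) \<le> ennreal (1 + r / 2)" .
  qed
  then have "S \<le> ennreal (1 + r / 2)" unfolding S_def by (rule SUP_least)
  then have "r \<le> 1 + r / 2" unfolding r(2) by (subst (asm) ennreal_le_iff) (use r(1) in auto)
  then have "r \<le> 2" by simp
  have "anorm (U t ?e) \<le> ennreal r" by (rule le[OF t])
  also have "\<dots> \<le> 2" using \<open>r \<le> 2\<close> ennreal_leI by fastforce
  finally show ?thesis .
qed

text \<open>\<open>U t\<close> is linear on finite sums and an L2 isometry, so the coefficients of
  the images of the partial sums converge to that of \<open>U t f\<close>.\<close>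

lemma U_coeff_sums:
  assumes f: "f \<in> wiener"
  shows "(\<lambda>i. fc f (int_decode i) * fc (U t (bas (int_decode i))) j)
    sums fc (U t f) j"
proof -
  let ?s = "\<lambda>n. \<Sum>i<n. fc f (int_decode i) * fc (U t (bas (int_decode i))) j"
  note L = wiener_L2[OF f]
  have "fc (U t f) j - ?s n
      = fc (U t (\<lambda>x. f x - partial n f x)) j" for n
  proof -
    have p: "U t (partial n f) \<in> L2 T" "U t f \<in> L2 T" by (intro U_L2 partial_L2 L)+
    have s: "(\<lambda>x. \<Sum>i<n. fc f (int_decode i) * U t (bas (int_decode i)) x) \<in> L2 T"
      by (intro L2_sum U_L2 basis_L2) auto
    have "AE x in lebesgue. U t (partial n f) x = (\<Sum>i<n. fc f (int_decode i) * U t (bas (int_decode i)) x)"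
      unfolding partial_def[abs_def] by (intro U_sum basis_L2) auto
    from fourier_coeff_cong[OF this L2_measurable[OF p(1)] L2_measurable[OF s], of j]
    have 1: "fc (U t (partial n f)) j = ?s n"
      by (subst (asm) fourier_coeff_sum) (auto intro: U_L2 basis_L2)
    have "fc (U t (\<lambda>x. f x - partial n f x)) j = fc (\<lambda>x. U t f x - U t (partial n f) x) j"
      by (rule fourier_coeff_cong[OF U_diff[OF L partial_L2]])
         (intro L2_measurable U_L2 L2_diff L partial_L2)+
    also have "\<dots> = fc (U t f) j - fc (U t (partial n f)) j"
      by (intro fourier_coeff_diff L2_integrable p)
    finally show ?thesis using 1 by simp
  qed
  then have "cmod (?s n - fc (U t f) j)
      \<le> L2_norm T (\<lambda>x. f x - partial n f x)" for n
    using fourier_coeff_le_L2_norm[OF U_L2[OF L2_diff[OF L partial_L2]]] U_norm[OF L2_diff[OF L partial_L2]]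
    by (metis norm_minus_commute)
  then have "(\<lambda>n. ?s n - fc (U t f) j) \<longlonglongrightarrow> 0"
    by (intro Lim_null_comparison[OF _ partial_tendsto[OF f]]) auto
  then show ?thesis unfolding sums_def by (simp add: Lim_null[symmetric])
qed

text \<open>On l1 the norm of an operator is the largest norm of its columns, and the columns are
  the images of the basis functions.\<close>

lemma U_anorm_le_2:
  assumes t: "t \<in> {0..tau}" and f: "f \<in> wiener"
  shows "anorm (U t f) \<le> 2 * anorm f"
proof -
  let ?f = "\<lambda>i. cmod (fc f (int_decode i))"
  let ?u = "\<lambda>i j. cmod (fc (U t (bas (int_decode i))) j)"
  have "anorm (U t f) \<le> (isum (\<lambda>j. (\<Sum>i. ennreal (?f i) * ennreal (?u i j))))"
    unfolding anorm_eq
  proof (rule nn_integral_mono)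
    fix j
    show "ennreal (cmod (fc (U t f) j)) \<le> (\<Sum>i. ennreal (?f i) * ennreal (?u i j))"
      using ennreal_norm_sums_le[OF U_coeff_sums[OF f, of t j]] by (simp add: norm_mult ennreal_mult)
  qed
  also have "\<dots> = (\<Sum>i. ennreal (?f i) * anorm (U t (bas (int_decode i))))"
    by (subst nn_integral_suminf) (auto simp: nn_integral_cmult anorm_eq)
  also have "\<dots> \<le> (\<Sum>i. ennreal (?f i) * 2)"
    by (intro suminf_le mult_left_mono U_basis_le_2 t) auto
  also have "\<dots> = 2 * anorm f" by (simp add: anorm_eq nn_integral_int_eq_suminf mult.commute)
  finally show ?thesis .
qed

text \<open>The time is cut at \<open>real n * tau\<close>, and the group law charges one factor 2
  per piece. The induction hypothesis also keeps the intermediate state in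
  \<open>wiener\<close>.\<close>

lemma U_anorm_iterate:
  assumes f: "f \<in> wiener"
  shows "t \<in> {0..real n * tau} \<Longrightarrow> anorm (U t f) \<le> 2 ^ n * anorm f"
proof (induction n arbitrary: t)
  case 0
  then have "t = 0" by simp
  have "anorm (U 0 f) = anorm f"
    by (rule wnorm_cong[OF U_0]) (auto intro: L2_measurable U_L2 wiener_L2 f)
  with \<open>t = 0\<close> show ?case by simp
next
  case (Suc n)
  show ?case
  proof (cases "t \<le> real n * tau")
    case True
    then have "anorm (U t f) \<le> 2 ^ n * anorm f" using Suc by simp
    also have "\<dots> \<le> 2 ^ Suc n * anorm f" by (intro mult_right_mono power_increasing) auto
    finally show ?thesis .
  next
    case False
    define s where "s = real n * tau"
    have s: "s \<in> {0..real n * tau}" using tau_pos by (simp add: s_def)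
    have ts: "t - s \<in> {0..tau}" using False Suc.prems by (auto simp: s_def algebra_simps)
    have w: "U s f \<in> wiener"
      using order.strict_trans1[OF Suc.IH[OF s]] f U_L2[OF wiener_L2[OF f]]
      by (simp add: wiener_def ennreal_mult_less_top power_less_top_ennreal)
    have "anorm (U t f) = anorm (U (t - s) (U s f))"
      using wnorm_cong[OF U_add[OF wiener_L2[OF f], of "t - s" s]] by (simp add: L2_measurable U_L2 wiener_L2 f)
    also have "\<dots> \<le> 2 * anorm (U s f)" by (rule U_anorm_le_2[OF ts w])
    also have "\<dots> \<le> 2 * (2 ^ n * anorm f)" by (intro mult_left_mono Suc.IH s) auto
    finally show ?thesis by (simp add: mult.assoc)
  qed
qed

lemma U_wiener_bounded:
  obtains B where "B > 0" "\<And>t f. t \<in> {0..T'} \<Longrightarrow> f \<in> wiener \<Longrightarrow> anorm (U t f) \<le> ennreal B * anorm f"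
proof -
  obtain n :: nat where n: "T' \<le> real n * tau" using reals_Archimedean3[OF tau_pos] less_imp_le by blast
  show ?thesis
  proof (rule that[of "2 ^ n"])
    fix t f assume "t \<in> {0..T'}" "f \<in> wiener"
    then have "anorm (U t f) \<le> 2 ^ n * anorm f" using n by (intro U_anorm_iterate) auto
    then show "anorm (U t f) \<le> ennreal (2 ^ n) * anorm f" by (simp flip: ennreal_power)
  qed simp
qed

end

section \<open>Time integrals and Sobolev norms\<close>

text \<open>Completeness of Lebesgue measure, transferred to \<open>S\<close> through extension by
  zero.\<close>

lemma borel_measurable_lebesgue_on_AE:
  fixes f g :: "real \<Rightarrow> 'b::euclidean_space"
  assumes S: "S \<in> sets lebesgue" and f: "f \<in> borel_measurable (lebesgue_on S)"
    and ae: "AE x in lebesgue_on S. f x = g x"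
  shows "g \<in> borel_measurable (lebesgue_on S)"
proof -
  have "(\<lambda>x. if x \<in> S then f x else 0) \<in> borel_measurable lebesgue"
    using f S by (simp add: borel_measurable_if)
  moreover have "AE x in lebesgue. (if x \<in> S then f x else 0) = (if x \<in> S then g x else 0)"
    using ae S by (subst (asm) AE_restrict_space_iff) auto
  ultimately have "(\<lambda>x. if x \<in> S then g x else 0) \<in> borel_measurable lebesgue"
    by (rule borel_measurable_AE)
  then show ?thesis using S by (simp add: borel_measurable_if)
qed

lemma borel_measurable_lebesgue_on_AE_LIMSEQ:
  fixes f :: "real \<Rightarrow> complex"
  assumes S: "S \<in> sets lebesgue" and a [measurable]: "\<And>n::nat. a n \<in> borel_measurable (lebesgue_on S)"
    and ae: "AE x in lebesgue_on S. (\<lambda>n. a n x) \<longlonglongrightarrow> f x"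
  shows "f \<in> borel_measurable (lebesgue_on S)"
proof (rule borel_measurable_lebesgue_on_AE[OF S])
  show "(\<lambda>x. lim (\<lambda>n. a n x)) \<in> borel_measurable (lebesgue_on S)" by measurable
  show "AE x in lebesgue_on S. lim (\<lambda>n. a n x) = f x" using ae by eventually_elim (rule limI)
qed

context circle begin

section \<open>Coefficients under measurability and integration in time\<close>

lemma simple_map_coeff:
  assumes S: "S \<in> lmeasurable" and F: "simple_map X S F" and X: "X \<subseteq> L2 T"
  shows "(\<lambda>t. fc (F t) j) \<in> borel_measurable (lebesgue_on S)"
    and "integrable (lebesgue_on S) (\<lambda>t. fc (F t) j)"
    and "(LINT t|lebesgue_on S. fc (F t) j) = fc (simple_map_integral S F) j"
    and "simple_map_integral S F \<in> L2 T"
proof -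
  interpret finite_measure "lebesgue_on S" by (rule finite_measure_lebesgue_on[OF S])
  have S': "S \<in> sets lebesgue" using S by auto
  have sf: "simple_function (lebesgue_on S) F" and FX: "F ` S \<subseteq> X" using F by (auto simp: simple_map_def)
  have fin: "finite (F ` S)" using simple_functionD(1)[OF sf] by simp
  have A: "{t \<in> S. F t = c} \<in> sets (lebesgue_on S)" for c
    using simple_functionD(2)[OF sf, of "{c}"] by (simp add: vimage_def Int_def conj_commute)
  have A': "{t \<in> S. F t = c} \<in> sets lebesgue" for c
    using A[of c] S' by (simp add: sets_restrict_space_iff)
  have ab: "{t \<in> S. F t = c} \<inter> S = {t \<in> S. F t = c}" for c by auto
  have m: "measure (lebesgue_on S) {t \<in> S. F t = c} = measure lebesgue {t \<in> S. F t = c}" for c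
    using S' by (intro measure_restrict_space) auto
  have eq: "fc (F t) j = (\<Sum>c\<in>F ` S. indicat_real {t \<in> S. F t = c} t *\<^sub>R fc c j)"
    if "t \<in> space (lebesgue_on S)" for t
  proof -
    have "(\<Sum>c\<in>F ` S. indicat_real {t \<in> S. F t = c} t *\<^sub>R fc c j)
        = (\<Sum>c\<in>F ` S. if c = F t then fc c j else 0)"
      using that by (intro sum.cong) (auto simp: indicator_def)
    then show ?thesis using that fin by simp
  qed
  have i: "integrable (lebesgue_on S) (\<lambda>t. \<Sum>c\<in>F ` S. indicat_real {t \<in> S. F t = c} t *\<^sub>R fc c j)"
    using A by (intro Bochner_Integration.integrable_sum integrable_scaleR_left) (auto simp: less_top[symmetric])
  show I: "integrable (lebesgue_on S) (\<lambda>t. fc (F t) j)"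
    using i by (subst Bochner_Integration.integrable_cong[OF refl eq])
  then show "(\<lambda>t. fc (F t) j) \<in> borel_measurable (lebesgue_on S)" by auto
  have "(LINT t|lebesgue_on S. fc (F t) j)
      = (LINT t|lebesgue_on S. (\<Sum>c\<in>F ` S. indicat_real {t \<in> S. F t = c} t *\<^sub>R fc c j))"
    by (rule Bochner_Integration.integral_cong[OF refl eq])
  also have "\<dots> = (\<Sum>c\<in>F ` S. of_real (measure lebesgue {t \<in> S. F t = c}) * fc c j)"
    using A by (subst Bochner_Integration.integral_sum) (auto simp: less_top[symmetric] m ab scaleR_conv_of_real)
  also have "\<dots> = fc (simple_map_integral S F) j"
    unfolding simple_map_integral_def[abs_def] using fin FX X by (subst fourier_coeff_sum) auto
  finally show "(LINT t|lebesgue_on S. fc (F t) j) = fc (simple_map_integral S F) j" .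
  show "simple_map_integral S F \<in> L2 T"
    unfolding simple_map_integral_def[abs_def] using fin FX X by (intro L2_sum) auto
qed

text \<open>The space and seminorm are left open since L2 and the Sobolev space are both treated;
  \<open>N\<close> has to dominate differences of coefficients, so these are almost everywhere
  limits of simple functions.\<close>

lemma strongly_measurable_coeff:
  assumes S: "S \<in> lmeasurable" and F: "strongly_measurable X N S F" and X: "X \<subseteq> L2 T"
    and N: "\<And>f g. f \<in> X \<Longrightarrow> g \<in> X \<Longrightarrow> cmod (fc f j - fc g j) \<le> N (\<lambda>x. f x - g x)"
  shows "(\<lambda>t. fc (F t) j) \<in> borel_measurable (lebesgue_on S)"
proof -
  obtain s where s: "\<And>n. simple_map X S (s n)"
    and ae: "AE t in lebesgue_on S. F t \<in> X \<and> (\<lambda>n::nat. N (\<lambda>x. F t x - s n t x)) \<longlonglongrightarrow> 0"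
    using F unfolding strongly_measurable_def by blast
  show ?thesis
  proof (rule borel_measurable_lebesgue_on_AE_LIMSEQ)
    show "S \<in> sets lebesgue" using S by auto
    show "(\<lambda>t. fc (s n t) j) \<in> borel_measurable (lebesgue_on S)" for n
      by (rule simple_map_coeff(1)[OF S s X])
    have "AE t in lebesgue_on S. t \<in> S" by (rule AE_I2) simp
    with ae show "AE t in lebesgue_on S. (\<lambda>n. fc (s n t) j) \<longlonglongrightarrow> fc (F t) j"
    proof eventually_elim
      case (elim t)
      have "s n t \<in> X" for n using s[of n] elim by (auto simp: simple_map_def)
      then have le: "cmod (fc (F t) j - fc (s n t) j) \<le> N (\<lambda>x. F t x - s n t x)" for n
        using elim by (intro N) auto
      have "(\<lambda>n. fc (F t) j - fc (s n t) j) \<longlonglongrightarrow> 0"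
        by (rule Lim_null_comparison[OF always_eventually[OF allI[OF le]]]) (use elim in simp)
      then have "(\<lambda>n. fc (F t) j - (fc (F t) j - fc (s n t) j)) \<longlonglongrightarrow> fc (F t) j - 0"
        by (intro tendsto_intros)
      then show ?case by simp
    qed
  qed
qed

lemma fourier_coeff_diff_le_L2_norm:
  "f \<in> L2 T \<Longrightarrow> g \<in> L2 T \<Longrightarrow> cmod (fc f j - fc g j) \<le> L2_norm T (\<lambda>x. f x - g x)"
  using fourier_coeff_le_L2_norm[OF L2_diff, of f g j] by (simp add: fourier_coeff_diff L2_integrable)

text \<open>A coefficient is a continuous functional on L2 and so commutes with the vector-valued
  integral. This turns the mild equation into scalar equations with Lebesgue integrals.\<close>

lemma has_space_integral_coeff:
  assumes S: "S \<in> lmeasurable" and FG: "has_space_integral (L2 T) (L2_norm T) S F G"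
  shows "integrable (lebesgue_on S) (\<lambda>t. fc (F t) j)"
    and "fc G j = (LINT t|lebesgue_on S. fc (F t) j)"
proof -
  let ?M = "lebesgue_on S"
  have sm: "strongly_measurable (L2 T) (L2_norm T) S F" and G: "G \<in> L2 T"
    using FG by (auto simp: has_space_integral_def)
  obtain s where s: "\<And>n. simple_map (L2 T) S (s n)"
    and lim: "(\<lambda>n::nat. \<integral>\<^sup>+t. ennreal (L2_norm T (\<lambda>x. F t x - s n t x)) \<partial>?M) \<longlonglongrightarrow> 0"
    and lim': "(\<lambda>n. L2_norm T (\<lambda>x. simple_map_integral S (s n) x - G x)) \<longlonglongrightarrow> 0"
    using FG unfolding has_space_integral_def by blast
  let ?f = "\<lambda>t. fc (F t) j" and ?a = "\<lambda>n t. fc (s n t) j"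
  have fm [measurable]: "?f \<in> borel_measurable ?M"
    by (rule strongly_measurable_coeff[OF S sm order_refl fourier_coeff_diff_le_L2_norm])
  note sc = simple_map_coeff[OF S s order_refl]
  have [measurable]: "?a n \<in> borel_measurable ?M" for n by (rule sc)
  have FL: "AE t in ?M. F t \<in> L2 T \<and> t \<in> S"
  proof -
    have "AE t in ?M. F t \<in> L2 T" using sm unfolding strongly_measurable_def by (auto elim!: eventually_mono)
    moreover have "AE t in ?M. t \<in> S" by (rule AE_I2) simp
    ultimately show ?thesis by eventually_elim simp
  qed
  have le: "(\<integral>\<^sup>+t. ennreal (cmod (?a n t - ?f t)) \<partial>?M) \<le> (\<integral>\<^sup>+t. ennreal (L2_norm T (\<lambda>x. F t x - s n t x)) \<partial>?M)" for n
  proof (rule nn_integral_mono_AE)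
    show "AE t in ?M. ennreal (cmod (?a n t - ?f t)) \<le> ennreal (L2_norm T (\<lambda>x. F t x - s n t x))"
      using FL
    proof eventually_elim
      case (elim t)
      then have "s n t \<in> L2 T" using s[of n] by (auto simp: simple_map_def)
      then show ?case using fourier_coeff_diff_le_L2_norm[of "F t" "s n t" j] elim
        by (intro ennreal_leI) (simp add: norm_minus_commute)
    qed
  qed
  have L1: "(\<lambda>n. \<integral>\<^sup>+t. ennreal (cmod (?a n t - ?f t)) \<partial>?M) \<longlonglongrightarrow> 0"
    by (rule tendsto_sandwich[OF _ _ tendsto_const lim]) (use le in auto)
  \<comment> \<open>A single simple map at finite L1 distance suffices for integrability of the
    limit.\<close>
  then have "eventually (\<lambda>n. (\<integral>\<^sup>+t. ennreal (cmod (?a n t - ?f t)) \<partial>?M) < 1) sequentially"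
    by (rule order_tendstoD) simp
  then obtain n where n: "(\<integral>\<^sup>+t. ennreal (cmod (?a n t - ?f t)) \<partial>?M) < 1"
    by (auto simp: eventually_sequentially)
  have "integrable ?M (\<lambda>t. ?a n t - ?f t)"
  proof (rule integrableI_bounded)
    show "(\<lambda>t. ?a n t - ?f t) \<in> borel_measurable ?M" by measurable
    show "(\<integral>\<^sup>+t. ennreal (cmod (?a n t - ?f t)) \<partial>?M) < \<infinity>"
      using n by (rule order.strict_trans) simp
  qed
  then have "integrable ?M (\<lambda>t. ?a n t - (?a n t - ?f t))"
    by (rule Bochner_Integration.integrable_diff[OF sc(2)])
  moreover have "(\<lambda>t. ?a n t - (?a n t - ?f t)) = ?f" by simp
  ultimately show fi: "integrable ?M ?f" by (simp only:)
  have "(\<lambda>n. integral\<^sup>L ?M (?a n)) \<longlonglongrightarrow> integral\<^sup>L ?M ?f"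
    by (rule tendsto_L1_int[OF sc(2) fi L1])
  then have 1: "(\<lambda>n. fc (simple_map_integral S (s n)) j) \<longlonglongrightarrow> integral\<^sup>L ?M ?f"
    by (simp add: sc(3))
  have "(\<lambda>n. fc (simple_map_integral S (s n)) j - fc G j) \<longlonglongrightarrow> 0"
    by (rule Lim_null_comparison[OF _ lim']) (simp add: fourier_coeff_diff_le_L2_norm sc(4) G)
  then have 2: "(\<lambda>n. fc (simple_map_integral S (s n)) j) \<longlonglongrightarrow> fc G j"
    by (simp add: Lim_null[symmetric])
  show "fc G j = (LINT t|?M. ?f t)" by (rule LIMSEQ_unique[OF 2 1])
qed

section \<open>Weighted Wiener norms bounded by the H1 norm\<close>

definition bracket :: "int \<Rightarrow> real" where
  "bracket j = 1 + 4 * pi\<^sup>2 * (of_int j)\<^sup>2 / T\<^sup>2"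

lemma bracket_ge_1: "bracket j \<ge> 1"
  by (simp add: bracket_def)

lemma bracket_nonneg [simp]: "bracket j \<ge> 0"
  using bracket_ge_1[of j] by linarith

lemma sobolev_term_eq: "sobolev_term T 1 f j = bracket j * (cmod (fc f j))\<^sup>2"
  using bracket_ge_1[of j] by (simp add: sobolev_term_def flip: bracket_def)

lemma sobolev_term_nonneg: "sobolev_term T 1 f j \<ge> 0"
  using bracket_ge_1[of j] by (simp add: sobolev_term_eq)

lemma sobolev_L2: "sobolev T s \<subseteq> L2 T"
  by (auto simp: sobolev_def)

lemma sobolev_norm_nonneg: "H1norm f \<ge> 0"
  unfolding sobolev_norm_def by (intro real_sqrt_ge_zero infsum_nonneg sobolev_term_nonneg)

lemma sum_le_sobolev_norm:
  assumes "f \<in> H1" "finite J"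
  shows "(\<Sum>j\<in>J. bracket j * (cmod (fc f j))\<^sup>2) \<le> (H1norm f)\<^sup>2"
proof -
  have "sum (sobolev_term T 1 f) J \<le> infsum (sobolev_term T 1 f) UNIV"
    by (rule finite_sum_le_infsum) (use assms sobolev_term_nonneg in \<open>auto simp: sobolev_def\<close>)
  then show ?thesis
    unfolding sobolev_norm_def sobolev_term_eq[symmetric] by (simp add: infsum_nonneg sobolev_term_nonneg)
qed

lemma fourier_coeff_le_sobolev_norm:
  assumes "f \<in> H1" shows "cmod (fc f j) \<le> H1norm f"
proof (rule power2_le_imp_le[OF _ sobolev_norm_nonneg])
  have "(cmod (fc f j))\<^sup>2 \<le> bracket j * (cmod (fc f j))\<^sup>2"
    using mult_right_mono[OF bracket_ge_1[of j], of "(cmod (fc f j))\<^sup>2"] by simp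
  also have "\<dots> \<le> (H1norm f)\<^sup>2" using sum_le_sobolev_norm[OF assms, of "{j}"] by simp
  finally show "(cmod (fc f j))\<^sup>2 \<le> (H1norm f)\<^sup>2" .
qed

lemma sobolev_diff:
  assumes "f \<in> H1" "g \<in> H1" shows "(\<lambda>x. f x - g x) \<in> H1"
proof -
  have L: "f \<in> L2 T" "g \<in> L2 T" using assms sobolev_L2 by auto
  have "(\<lambda>j. 2 * sobolev_term T 1 f j + 2 * sobolev_term T 1 g j) summable_on UNIV"
    using assms by (intro summable_on_add summable_on_cmult_right) (auto simp: sobolev_def)
  moreover have "sobolev_term T 1 (\<lambda>x. f x - g x) j \<le> 2 * sobolev_term T 1 f j + 2 * sobolev_term T 1 g j" for j
  proof -
    let ?a = "fc f j" and ?b = "fc g j"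
    have "(cmod (?a - ?b))\<^sup>2 \<le> (cmod ?a + cmod ?b)\<^sup>2" by (intro power_mono norm_triangle_ineq4) auto
    also have "\<dots> \<le> 2 * (cmod ?a)\<^sup>2 + 2 * (cmod ?b)\<^sup>2"
      using zero_le_power2[of "cmod ?a - cmod ?b"] by (simp add: power2_eq_square algebra_simps)
    finally have "bracket j * (cmod (?a - ?b))\<^sup>2 \<le> bracket j * (2 * (cmod ?a)\<^sup>2 + 2 * (cmod ?b)\<^sup>2)"
      using bracket_ge_1[of j] by (intro mult_left_mono) auto
    then show ?thesis using L by (simp add: sobolev_term_eq fourier_coeff_diff L2_integrable algebra_simps)
  qed
  ultimately have "sobolev_term T 1 (\<lambda>x. f x - g x) summable_on UNIV"
    by (rule summable_on_comparison_test) (use sobolev_term_nonneg in auto)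
  then show ?thesis using L2_diff[OF L] by (simp add: sobolev_def)
qed

lemma strongly_measurable_sobolev_coeff:
  assumes "S \<in> lmeasurable" "strongly_measurable H1 H1norm S F"
  shows "(\<lambda>t. fc (F t) j) \<in> borel_measurable (lebesgue_on S)"
proof (rule strongly_measurable_coeff[OF assms sobolev_L2])
  fix f g assume fg: "f \<in> H1" "g \<in> H1"
  then have "f \<in> L2 T" "g \<in> L2 T" using sobolev_L2 by auto
  then show "cmod (fc f j - fc g j) \<le> H1norm (\<lambda>x. f x - g x)"
    using fourier_coeff_le_sobolev_norm[OF sobolev_diff[OF fg], of j] by (simp add: fourier_coeff_diff L2_integrable)
qed

text \<open>Cauchy-Schwarz for the sequences \<open>w j / sqrt (bracket j)\<close> and
  \<open>sqrt (bracket j) * cmod (fc f j)\<close>.\<close>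

lemma wnorm_le_sobolev_norm:
  assumes f: "f \<in> H1" and K: "\<And>J. finite J \<Longrightarrow> (\<Sum>j\<in>J. (w j)\<^sup>2 / bracket j) \<le> K\<^sup>2" "K \<ge> 0"
    and w: "\<And>j. w j \<ge> 0"
  shows "wnorm w f \<le> ennreal (K * H1norm f)"
  unfolding wnorm_def
proof (rule nn_integral_int_le)
  fix J :: "int set" assume J: "finite J"
  have "(\<Sum>j\<in>J. w j * cmod (fc f j))
      = (\<Sum>j\<in>J. (w j / sqrt (bracket j)) * (sqrt (bracket j) * cmod (fc f j)))"
    using bracket_ge_1 by (intro sum.cong) (auto simp: order.strict_trans2[OF zero_less_one] less_imp_neq[symmetric])
  also have "\<dots> \<le> K * H1norm f"
  proof (rule power2_le_imp_le)
    have "(\<Sum>j\<in>J. (w j / sqrt (bracket j)) * (sqrt (bracket j) * cmod (fc f j)))\<^sup>2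
        \<le> (\<Sum>j\<in>J. (w j / sqrt (bracket j))\<^sup>2) * (\<Sum>j\<in>J. (sqrt (bracket j) * cmod (fc f j))\<^sup>2)"
      by (rule Cauchy_Schwarz_ineq_sum)
    also have "\<dots> = (\<Sum>j\<in>J. (w j)\<^sup>2 / bracket j) * (\<Sum>j\<in>J. bracket j * (cmod (fc f j))\<^sup>2)"
      by (simp add: power_divide power_mult_distrib)
    also have "\<dots> \<le> K\<^sup>2 * (H1norm f)\<^sup>2"
      by (intro mult_mono K sum_le_sobolev_norm f J sum_nonneg mult_nonneg_nonneg) auto
    finally show "(\<Sum>j\<in>J. (w j / sqrt (bracket j)) * (sqrt (bracket j) * cmod (fc f j)))\<^sup>2 \<le> (K * H1norm f)\<^sup>2"
      by (simp add: power_mult_distrib)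
  qed (use K sobolev_norm_nonneg in auto)
  finally show "(\<Sum>j\<in>J. ennreal (w j * cmod (fc f j))) \<le> ennreal (K * H1norm f)"
    using w by (simp add: sum_ennreal ennreal_leI)
qed

text \<open>The bracket grows quadratically, so the summand is at most a multiple of the power
  \<open>- p\<close>. The case \<open>p = 2\<close> serves the constant weight;
  \<open>p = 3/2\<close> leaves half a power of \<open>j\<close> to be traded for
  \<epsilon>.\<close>

lemma sum_bracket_le:
  assumes "p > 1"
  obtains C where "C \<ge> 0" "\<And>J. finite J \<Longrightarrow> (\<Sum>j\<in>J. (1 + \<bar>real_of_int j\<bar>) powr (2 - p) / bracket j) \<le> C"
proof -
  define c where "c = 4 * pi\<^sup>2 / T\<^sup>2"
  have c: "c > 0" using T_pos by (simp add: c_def)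
  \<comment> \<open>The bracket times \<open>1 + 1 / c\<close> dominates the square of
    \<open>j\<close> plus 1; the 2 is from the square of \<open>1 + \<bar>j\<bar>\<close>.\<close>
  define A where "A = 2 * (1 + 1 / c)"
  have A: "A \<ge> 0" using c by (simp add: A_def)
  let ?b = "\<lambda>j. 1 + \<bar>real_of_int j\<bar>"
  have le: "?b j powr (2 - p) / bracket j \<le> A * ?b j powr (- p)" for j
  proof -
    have "(?b j)\<^sup>2 \<le> 2 * (1 + (real_of_int j)\<^sup>2)"
      using zero_le_power2[of "1 - \<bar>real_of_int j\<bar>"] by (simp add: power2_eq_square algebra_simps)
    also have "\<dots> \<le> A * bracket j"
    proof -
      have "bracket j = 1 + c * (real_of_int j)\<^sup>2" by (simp add: bracket_def c_def)
      then have eq: "(1 + 1 / c) * bracket j = 1 + (real_of_int j)\<^sup>2 + (1 / c + c * (real_of_int j)\<^sup>2)"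
        using c by (simp add: field_simps)
      moreover have "1 / c + c * (real_of_int j)\<^sup>2 \<ge> 0" using c by simp
      ultimately have "2 * (1 + (real_of_int j)\<^sup>2) \<le> 2 * ((1 + 1 / c) * bracket j)"
        unfolding eq by (intro mult_left_mono) auto
      then show ?thesis unfolding A_def by (simp only: mult.assoc)
    qed
    finally have "(?b j)\<^sup>2 \<le> A * bracket j" .
    then have "?b j powr (- p) * (?b j)\<^sup>2 \<le> ?b j powr (- p) * (A * bracket j)" by (intro mult_left_mono) auto
    moreover have "?b j powr (- p) * (?b j)\<^sup>2 = ?b j powr (2 - p)"
      by (simp add: powr_diff powr_minus_divide add_pos_nonneg less_imp_neq[symmetric])
    ultimately show ?thesis using bracket_ge_1[of j] by (subst pos_divide_le_eq) (auto simp: mult_ac)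
  qed
  let ?I = "\<integral>\<^sup>+ j. ennreal (?b j powr (- p)) \<partial>count_space UNIV"
  have fin: "?I < \<infinity>" by (rule int_powr_summable[OF assms])
  show ?thesis
  proof (rule that[of "A * enn2real ?I"])
    show "A * enn2real ?I \<ge> 0" using A by simp
    fix J :: "int set" assume J: "finite J"
    have "ennreal (\<Sum>j\<in>J. ?b j powr (- p)) = (\<integral>\<^sup>+ j. ennreal (?b j powr (- p)) \<partial>count_space J)"
      using J by (simp add: nn_integral_count_space_finite)
    also have "\<dots> \<le> ?I"
      by (subst nn_integral_count_space_indicator) (auto intro!: nn_integral_mono simp: indicator_def)
    finally have "(\<Sum>j\<in>J. ?b j powr (- p)) \<le> enn2real ?I"
      using enn2real_mono[of "ennreal (\<Sum>j\<in>J. ?b j powr (- p))" ?I] fin by (simp add: sum_nonneg)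
    then have "A * (\<Sum>j\<in>J. ?b j powr (- p)) \<le> A * enn2real ?I" using A by (intro mult_left_mono)
    moreover have "(\<Sum>j\<in>J. ?b j powr (2 - p) / bracket j) \<le> A * (\<Sum>j\<in>J. ?b j powr (- p))"
      unfolding sum_distrib_left by (intro sum_mono le)
    ultimately show "(\<Sum>j\<in>J. ?b j powr (2 - p) / bracket j) \<le> A * enn2real ?I" by simp
  qed
qed

lemma anorm_le_sobolev_norm:
  obtains K where "K \<ge> 0" "\<And>f. f \<in> H1 \<Longrightarrow> anorm f \<le> ennreal (K * H1norm f)"
proof -
  obtain C where C: "C \<ge> 0" "\<And>J. finite J \<Longrightarrow> (\<Sum>j\<in>J. (1 + \<bar>real_of_int j\<bar>) powr (2 - 2) / bracket j) \<le> C"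
    by (rule sum_bracket_le[of 2]) auto
  have nz: "1 + \<bar>real_of_int j\<bar> \<noteq> 0" for j by linarith
  show ?thesis
  proof (rule that[of "sqrt C"])
    fix f assume "f \<in> H1"
    then show "anorm f \<le> ennreal (sqrt C * H1norm f)"
    proof (rule wnorm_le_sobolev_norm)
      fix J :: "int set" assume "finite J"
      then show "(\<Sum>j\<in>J. 1\<^sup>2 / bracket j) \<le> (sqrt C)\<^sup>2" using C nz by simp
    qed (use C(1) in auto)
  qed (use C(1) in auto)
qed

lemma sobolev_wiener: "f \<in> H1 \<Longrightarrow> f \<in> wiener"
proof -
  assume f: "f \<in> H1"
  have "anorm f < \<infinity>"
  proof (rule anorm_le_sobolev_norm)
    fix K assume "\<And>f. f \<in> H1 \<Longrightarrow> anorm f \<le> ennreal (K * H1norm f)"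
    from this[OF f] show "anorm f < \<infinity>" by (rule order.strict_trans1) simp
  qed
  then show "f \<in> wiener" using f sobolev_L2 by (auto simp: wiener_def)
qed

text \<open>With a weight proportional to |j| the sum left by Cauchy-Schwarz would diverge. The cap
  permits \<open>(min 2 x)\<^sup>2 \<le> 4 * sqrt x\<close>, which leaves |j|^(1/2) against the
  quadratic bracket and the factor \<open>sqrt \<epsilon>\<close> under the outer root.\<close>

lemma weight_le_sobolev_norm:
  obtains K where "K \<ge> 0"
    "\<And>\<epsilon> f. \<epsilon> \<ge> 0 \<Longrightarrow> f \<in> H1 \<Longrightarrow> wnorm (weight \<zeta> \<epsilon>) f \<le> ennreal (sqrt (K * sqrt \<epsilon>) * H1norm f)"
proof -
  obtain C where C: "C \<ge> 0" "\<And>J. finite J \<Longrightarrow> (\<Sum>j\<in>J. (1 + \<bar>real_of_int j\<bar>) powr (2 - 3/2) / bracket j) \<le> C"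
    by (rule sum_bracket_le[of "3/2"]) auto
  define A where "A = 2 * pi / T * (LINT v|lebesgue. \<bar>v * \<zeta> v\<bar>)"
  have A: "A \<ge> 0" using T_pos by (simp add: A_def)
  have w2: "(weight \<zeta> \<epsilon> j)\<^sup>2 \<le> 4 * sqrt (A * \<epsilon>) * (1 + \<bar>real_of_int j\<bar>) powr (2 - 3/2)" if \<epsilon>: "\<epsilon> \<ge> 0" for \<epsilon> j
  proof -
    define x where "x = A * \<epsilon> * \<bar>real_of_int j\<bar>"
    have x: "x \<ge> 0" using A \<epsilon> by (simp add: x_def)
    have "(min 2 x)\<^sup>2 \<le> 4 * sqrt x"
    proof (cases "x \<le> 1")
      case True
      have "x\<^sup>2 \<le> x" using True x by (simp add: power2_eq_square mult_left_le)
      also have "x = sqrt x * sqrt x" using x by simp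
      also have "\<dots> \<le> sqrt x" using True x by (intro mult_left_le) auto
      finally have "x\<^sup>2 \<le> sqrt x" .
      moreover have "sqrt x \<ge> 0" using x by simp
      ultimately have "x\<^sup>2 \<le> 4 * sqrt x" by linarith
      then show ?thesis using True by (simp add: min_def)
    next
      case False
      have "(min 2 x)\<^sup>2 \<le> 2\<^sup>2" using x by (intro power_mono) auto
      also have "\<dots> \<le> 4 * sqrt x" using False by simp
      finally show ?thesis .
    qed
    also have "sqrt x \<le> sqrt (A * \<epsilon>) * (1 + \<bar>real_of_int j\<bar>) powr (2 - 3/2)"
    proof -
      have "sqrt x = sqrt (A * \<epsilon>) * sqrt \<bar>real_of_int j\<bar>" by (simp add: x_def real_sqrt_mult)
      also have "\<dots> \<le> sqrt (A * \<epsilon>) * sqrt (1 + \<bar>real_of_int j\<bar>)" using A \<epsilon> by (intro mult_left_mono) auto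
      finally show ?thesis by (simp add: powr_half_sqrt)
    qed
    finally show ?thesis by (simp add: weight_def x_def A_def mult_ac)
  qed
  show ?thesis
  proof (rule that[of "4 * sqrt A * C"])
    show "4 * sqrt A * C \<ge> 0" using A C by simp
    fix \<epsilon> :: real and f assume \<epsilon>: "\<epsilon> \<ge> 0" and f: "f \<in> H1"
    show "wnorm (weight \<zeta> \<epsilon>) f \<le> ennreal (sqrt (4 * sqrt A * C * sqrt \<epsilon>) * H1norm f)"
    proof (rule wnorm_le_sobolev_norm[OF f])
      fix J :: "int set" assume J: "finite J"
      have "(\<Sum>j\<in>J. (weight \<zeta> \<epsilon> j)\<^sup>2 / bracket j) \<le> (\<Sum>j\<in>J. 4 * sqrt (A * \<epsilon>) * (1 + \<bar>real_of_int j\<bar>) powr (2 - 3/2) / bracket j)"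
        by (intro sum_mono divide_right_mono w2 \<epsilon>) auto
      also have "\<dots> = 4 * sqrt (A * \<epsilon>) * (\<Sum>j\<in>J. (1 + \<bar>real_of_int j\<bar>) powr (2 - 3/2) / bracket j)"
        by (simp add: sum_distrib_left)
      also have "\<dots> \<le> 4 * sqrt (A * \<epsilon>) * C" using A \<epsilon> by (intro mult_left_mono C J) auto
      finally show "(\<Sum>j\<in>J. (weight \<zeta> \<epsilon> j)\<^sup>2 / bracket j) \<le> (sqrt (4 * sqrt A * C * sqrt \<epsilon>))\<^sup>2"
        using A C \<epsilon> by (subst real_sqrt_pow2) (simp_all add: real_sqrt_mult mult_ac)
    qed (use A C(1) \<epsilon> T_pos in \<open>auto simp: weight_def\<close>)
  qed
qed

end

section \<open>Comparison of solutions\<close>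

lemma gronwall:
  fixes H :: "real \<Rightarrow> real"
  assumes H: "continuous_on {0..b} H" and b: "b \<ge> 0" and c: "c \<ge> 0"
    and le: "\<And>t. t \<in> {0..b} \<Longrightarrow> H t \<le> a + integral {0..t} (\<lambda>s. c * H s)"
  shows "H b \<le> a * exp (c * b)"
proof -
  define J where "J t = a + integral {0..t} (\<lambda>s. c * H s)" for t
  have cH: "continuous_on {0..b} (\<lambda>s. c * H s)" by (intro continuous_intros H)
  have dJ: "(J has_real_derivative c * H t) (at t within {0..b})" if "t \<in> {0..b}" for t
    using DERIV_add[OF DERIV_const[of a] integral_has_real_derivative[OF cH that]]
    unfolding J_def by (simp only: add_0_left)
  have cJ: "continuous_on {0..b} J"
    by (rule DERIV_continuous_on[OF dJ])
  \<comment> \<open>\<open>J\<close> is the right-hand side of the hypothesis and has derivative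
    \<open>c * H t \<le> c * J t\<close>, so its product with the decaying exponential cannot
    increase.\<close>
  have "J b * exp (- c * b) \<le> J 0 * exp (- c * 0)"
  proof (rule DERIV_nonpos_imp_decreasing_open[OF b])
    fix t assume t: "0 < t" "t < b"
    have "(J has_real_derivative c * H t) (at t)"
      using dJ[of t] t by (simp add: at_within_Icc_at)
    then have "((\<lambda>t. J t * exp (- c * t)) has_real_derivative c * (H t - J t) * exp (- c * t)) (at t)"
      by (auto intro!: derivative_eq_intros simp: algebra_simps)
    moreover have "c * (H t - J t) * exp (- c * t) \<le> 0"
      using le[of t] t c by (intro mult_nonpos_nonneg mult_nonneg_nonpos) (auto simp: J_def)
    ultimately show "\<exists>y. ((\<lambda>t. J t * exp (- c * t)) has_real_derivative y) (at t) \<and> y \<le> 0" by blast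
  qed (intro continuous_intros cJ)
  then have "J b * exp (- c * b) \<le> a" by (simp add: J_def)
  then have "J b \<le> a * exp (c * b)"
    by (simp add: exp_minus field_simps)
  then show ?thesis using le[of b] b by (simp add: J_def)
qed

text \<open>As long as \<open>h \<le> 1\<close> the cubic inequality is linear, and Gronwall's bound is below \<open>1\<close> by
  assumption, so the continuous majorant of \<open>h\<close> cannot reach \<open>1\<close>.\<close>

lemma cubic_gronwall:
  fixes h :: "real \<Rightarrow> real"
  assumes T': "T' > 0" and h: "h \<in> borel_measurable (lebesgue_on {0..T'})" "\<And>t. h t \<ge> 0"
    and bd: "AE t in lebesgue_on {0..T'}. h t \<le> B"
    and L: "L \<ge> 0" and m: "m \<ge> 0" and a: "a \<ge> 0"
    and le: "\<And>t. t \<in> {0..T'} \<Longrightarrow> h t \<le> a + (LINT s|lebesgue_on {0..t}. L * h s * (m + h s)\<^sup>2)"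
    and small: "a * exp (L * (m + 1)\<^sup>2 * T') < 1"
    and t: "t \<in> {0..T'}"
  shows "h t \<le> a * exp (L * (m + 1)\<^sup>2 * T')"
proof -
  define g where "g s = L * h s * (m + h s)\<^sup>2" for s
  define c where "c = L * (m + 1)\<^sup>2"
  have c: "c \<ge> 0" using L by (simp add: c_def)
  have g0: "g s \<ge> 0" for s using L h by (simp add: g_def)
  have [measurable]: "h \<in> borel_measurable (lebesgue_on {0..T'})" by (rule h)
  interpret finite_measure "lebesgue_on {0..T'}" by (rule finite_measure_lebesgue_on) auto
  have gi: "integrable (lebesgue_on {0..T'}) g"
  proof (rule integrable_const_bound[of _ "L * B * (m + B)\<^sup>2"])
    show "AE s in lebesgue_on {0..T'}. norm (g s) \<le> L * B * (m + B)\<^sup>2"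
      using bd
    proof eventually_elim
      case (elim s)
      have B: "B \<ge> 0" using elim h(2)[of s] by linarith
      have "g s \<le> L * B * (m + B)\<^sup>2"
        unfolding g_def using elim L m h(2)[of s] B by (intro mult_mono power_mono mult_nonneg_nonneg) auto
      with g0[of s] show ?case by simp
    qed
  qed (simp add: g_def[abs_def])
  have gT: "g integrable_on {0..T'}" using gi by (intro integrable_on_lebesgue_on) auto
  have gt: "g integrable_on {0..t}" if "t \<in> {0..T'}" for t
    by (rule integrable_on_subinterval[OF gT]) (use that in auto)
  have git: "integrable (lebesgue_on {0..t}) g" if "t \<in> {0..T'}" for t
    by (rule integrable_subinterval[OF gi]) (use that in auto)
  define H where "H t = a + integral {0..t} g" for t
  have hH: "h t \<le> H t" if "t \<in> {0..T'}" for t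
  proof -
    have "h t \<le> a + (LINT s|lebesgue_on {0..t}. g s)" unfolding g_def by (rule le[OF that])
    also have "(LINT s|lebesgue_on {0..t}. g s) = integral {0..t} g"
      by (rule lebesgue_integral_eq_integral[OF git[OF that]]) simp
    finally show ?thesis by (simp add: H_def)
  qed
  have cH: "continuous_on {0..T'} H"
    unfolding H_def by (intro continuous_intros indefinite_integral_continuous_1 gT)
  \<comment> \<open>Monotonicity lets the single condition \<open>H t \<le> 1\<close> control
    \<open>h\<close> at all earlier times.\<close>
  have mono: "H s \<le> H t" if "0 \<le> s" "s \<le> t" "t \<le> T'" for s t
    unfolding H_def using that gt[of s] gt[of t] g0
    by (intro add_left_mono integral_subset_le) auto
  have lin: "H t \<le> a * exp (c * t)" if t: "t \<in> {0..T'}" and Ht: "H t \<le> 1" for t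
  proof (rule gronwall)
    show c': "continuous_on {0..t} H" using t by (intro continuous_on_subset[OF cH]) auto
    fix r assume r: "r \<in> {0..t}"
    have ci: "(\<lambda>s. c * H s) integrable_on {0..r}"
      using r by (intro integrable_continuous_real continuous_intros continuous_on_subset[OF c']) auto
    have "integral {0..r} g \<le> integral {0..r} (\<lambda>s. c * H s)"
    proof (rule integral_le[OF _ ci])
      show "g integrable_on {0..r}" using r t by (intro gt) auto
      fix s assume s: "s \<in> {0..r}"
      have "H s \<le> 1" using mono[of s t] s r t Ht by auto
      moreover have hs: "h s \<le> H s" using s r t by (intro hH) auto
      ultimately have "(m + h s)\<^sup>2 \<le> (m + 1)\<^sup>2" using m h(2)[of s] by (intro power_mono) auto
      then have "L * h s * (m + h s)\<^sup>2 \<le> L * H s * (m + 1)\<^sup>2"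
        using L hs h(2)[of s] by (intro mult_mono) auto
      then show "g s \<le> c * H s" by (simp add: g_def c_def mult_ac)
    qed
    then show "H r \<le> a + integral {0..r} (\<lambda>s. c * H s)" by (simp add: H_def)
  qed (use t c in auto)
  have exp_le: "a * exp (c * t) \<le> a * exp (c * T')" if "t \<in> {0..T'}" for t
    using that a c by (intro mult_left_mono) (auto intro: mult_left_mono)
  have "H T' < 1"
  proof (rule ccontr)
    assume "\<not> H T' < 1"
    moreover have "H 0 \<le> 1"
    proof -
      have "a \<le> a * exp (c * T')" using a c T' by (simp add: mult_le_cancel_left1)
      then show ?thesis using small by (simp add: H_def c_def)
    qed
    \<comment> \<open>At a time where \<open>H\<close> equals 1 the linear bound still applies, and
      \<open>small\<close> makes it less than 1.\<close>
    ultimately obtain r where r: "0 \<le> r" "r \<le> T'" "H r = 1"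
      using IVT'[of H 0 1 T'] cH T' by auto
    have "H r \<le> a * exp (c * T')" using lin[of r] exp_le[of r] r by simp
    with r small show False by (simp add: c_def)
  qed
  then have "H t \<le> 1" using mono[of t T'] t by simp
  then have "H t \<le> a * exp (c * T')" using lin[OF t] exp_le[OF t] by simp
  with hH[OF t] show ?thesis by (simp add: c_def)
qed

lemma ennreal_cubic_eq:
  assumes "0 \<le> b" "0 \<le> t" "0 \<le> h" "0 \<le> X" "0 \<le> m" "0 \<le> Z"
  shows "ennreal b * (ennreal t * (ennreal h * (ennreal X * ennreal X + ennreal X * ennreal X + ennreal X * ennreal X)
       + 2 * (ennreal m * ennreal m) * ennreal Z))
    = ennreal (b * (t * (h * (X * X + X * X + X * X) + 2 * (m * m) * Z)))"
proof -
  define S where "S = X * X + X * X + X * X"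
  have XX: "X * X \<ge> 0" using assms by simp
  then have S: "S \<ge> 0" by (simp add: S_def)
  have "ennreal S = ennreal (X * X + X * X) + ennreal (X * X)"
    unfolding S_def using XX by (intro ennreal_plus) auto
  also have "ennreal (X * X + X * X) = ennreal (X * X) + ennreal (X * X)"
    using XX by (intro ennreal_plus) auto
  also have "ennreal (X * X) = ennreal X * ennreal X" using assms by (simp add: ennreal_mult)
  finally have S_eq: "ennreal X * ennreal X + ennreal X * ennreal X + ennreal X * ennreal X = ennreal S" by simp
  show ?thesis unfolding S_eq S_def[symmetric] using assms S by (simp add: ennreal_mult)
qed

lemma AE_lebesgue_on_subset:
  assumes "AE s in lebesgue_on {0..T'}. P s" "t \<in> {0..T'::real}"
  shows "AE s in lebesgue_on {0..t}. P s"
proof -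
  have "AE s in lebesgue. s \<in> {0..T'} \<longrightarrow> P s" using assms(1) by (subst (asm) AE_restrict_space_iff) auto
  then have "AE s in lebesgue. s \<in> {0..t} \<longrightarrow> P s" by eventually_elim (use assms(2) in auto)
  then show ?thesis by (subst AE_restrict_space_iff) auto
qed

context circle begin

lemma Linf_norm_le:
  assumes f: "f \<in> wiener" shows "Linf_norm T f \<le> ereal (enn2real (anorm f) / sqrt T)"
  unfolding Linf_norm_def \<mu>_def[symmetric]
proof (rule esssup_I)
  have [measurable]: "f \<in> borel_measurable \<mu>" using f by (intro measurable_\<mu> L2_measurable wiener_L2)
  show "(\<lambda>x. ereal (cmod (f x))) \<in> borel_measurable \<mu>" by measurable
  have fin: "anorm f = ennreal (enn2real (anorm f))"
    using f by (simp add: wiener_def)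
  show "AE x in \<mu>. ereal (cmod (f x)) \<le> ereal (enn2real (anorm f) / sqrt T)"
    using AE_\<mu>[OF wiener_AE_bound[OF f]]
  proof eventually_elim
    case (elim x)
    then have "ennreal (cmod (f x)) \<le> ennreal (enn2real (anorm f) / sqrt T)"
      using T_pos by (subst (asm) fin) (simp add: divide_ennreal)
    then show ?case using T_pos by (simp add: ennreal_le_iff)
  qed
qed

end

section \<open>Comparison of the nonlocal and the local flow\<close>

locale gross_pitaevskii = propagator +
  fixes \<zeta> :: "real \<Rightarrow> real"
  assumes \<zeta>_nonneg: "\<And>x. \<zeta> x \<ge> 0" and \<zeta>_integrable: "integrable lebesgue \<zeta>"
    and \<zeta>_mass: "(LINT x|lebesgue. \<zeta> x) = 1" and \<zeta>_moment: "integrable lebesgue (\<lambda>x. x * \<zeta> x)"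
begin

text \<open>A Minkowski inequality for a time integral that exists only in L2: each coefficient of
  the integral is bounded by a scalar integral of moduli, Tonelli exchanges the sum over frequencies
  with time, and the propagator bound is applied at each fixed \<open>s\<close>.\<close>

lemma duhamel_estimate:
  assumes sol: "mild_solution T U \<zeta> 1 \<epsilon> u0 u" and sol': "mild_solution T U \<zeta> 1 0 v0 v"
    and \<epsilon>: "\<epsilon> \<ge> 0" and u0: "u0 \<in> wiener" and v0: "v0 \<in> wiener"
    and t: "t \<in> {0..T'}" and B: "\<And>t f. t \<in> {0..T'} \<Longrightarrow> f \<in> wiener \<Longrightarrow> anorm (U t f) \<le> ennreal B * anorm f"
    and ae: "AE s in lebesgue_on {0..t}. u s \<in> wiener \<and> v s \<in> wiener"
  shows "anorm (\<lambda>x. u t x - v t x) \<le> ennreal B * anorm (\<lambda>x. u0 x - v0 x)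
    + (\<integral>\<^sup>+ s. ennreal B * anorm (\<lambda>x. nonlinearity \<zeta> \<epsilon> (u s) x - nonlinearity \<zeta> 0 (v s) x) \<partial>lebesgue_on {0..t})"
proof -
  let ?N = "\<lambda>s. nonlinearity \<zeta> \<epsilon> (u s)" and ?N' = "\<lambda>s. nonlinearity \<zeta> 0 (v s)"
  let ?D = "\<lambda>s x. ?N s x - ?N' s x" and ?d = "\<lambda>x. u0 x - v0 x" and ?w = "\<lambda>x. u t x - v t x"
  let ?M = "lebesgue_on {0..t}"
  have t0: "t \<ge> 0" using t by simp
  obtain G where G: "has_space_integral (L2 T) (L2_norm T) {0..t} (\<lambda>s. U (t - s) (?N s)) G"
    and uG: "AE x in lebesgue. u t x = U t u0 x - \<i> * of_real 1 * G x" and uL: "u t \<in> L2 T"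
    using sol t0 unfolding mild_solution_def by blast
  obtain G' where G': "has_space_integral (L2 T) (L2_norm T) {0..t} (\<lambda>s. U (t - s) (?N' s)) G'"
    and vG: "AE x in lebesgue. v t x = U t v0 x - \<i> * of_real 1 * G' x" and vL: "v t \<in> L2 T"
    using sol' t0 unfolding mild_solution_def by blast
  have GL: "G \<in> L2 T" "G' \<in> L2 T" using G G' by (auto simp: has_space_integral_def)
  note L0 = u0[THEN wiener_L2] v0[THEN wiener_L2]
  have S: "{0..t} \<in> lmeasurable" by simp
  define \<kappa> where "\<kappa> j s = fc (U (t - s) (?N s)) j
     - fc (U (t - s) (?N' s)) j" for j s
  have \<kappa>i: "integrable ?M (\<kappa> j)" for j
    unfolding \<kappa>_def[abs_def] by (intro Bochner_Integration.integrable_diff has_space_integral_coeff(1)[OF S G] has_space_integral_coeff(1)[OF S G'])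
  then have [measurable]: "\<kappa> j \<in> borel_measurable ?M" for j by auto
  have coeff: "fc ?w j
     = fc (U t ?d) j - \<i> * (LINT s|?M. \<kappa> j s)" for j
  proof -
    have w0: "U t ?d \<in> L2 T" by (intro U_L2 L2_diff L0)
    have GG: "(\<lambda>x. G x - G' x) \<in> L2 T" by (intro L2_diff GL)
    have "fc ?w j
        = fc (\<lambda>x. 1 * U t ?d x + (- \<i>) * (G x - G' x)) j"
    proof (rule fourier_coeff_cong)
      show "AE x in lebesgue. u t x - v t x = 1 * U t ?d x + (- \<i>) * (G x - G' x)"
        using uG vG U_diff[OF L0, of t]
      proof eventually_elim
        case (elim x)
        show ?case unfolding elim(1,2) by (simp add: elim(3) algebra_simps)
      qed
    qed (intro L2_measurable L2_diff uL vL L2_lin w0 GG)+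
    also have "\<dots> = fc (U t ?d) j - \<i> * (fc G j - fc G' j)"
      by (subst fourier_coeff_lin) (auto intro!: L2_integrable w0 GG simp: fourier_coeff_diff L2_integrable GL)
    also have "fc G j - fc G' j = (LINT s|?M. \<kappa> j s)"
      unfolding \<kappa>_def[abs_def] has_space_integral_coeff(2)[OF S G] has_space_integral_coeff(2)[OF S G']
      by (intro Bochner_Integration.integral_diff[symmetric] has_space_integral_coeff(1)[OF S G] has_space_integral_coeff(1)[OF S G'])
    finally show ?thesis .
  qed
  have "anorm ?w \<le> (\<integral>\<^sup>+ j. ennreal (cmod (fc (U t ?d) j))
      + (\<integral>\<^sup>+ s. ennreal (cmod (\<kappa> j s)) \<partial>?M) \<partial>count_space UNIV)"
    unfolding anorm_eq
  proof (rule nn_integral_mono)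
    fix j
    have "cmod (fc ?w j) \<le> cmod (fc (U t ?d) j) + cmod (LINT s|?M. \<kappa> j s)"
      unfolding coeff using norm_triangle_ineq4[of "fc (U t ?d) j" "\<i> * (LINT s|?M. \<kappa> j s)"]
      by (simp add: norm_mult)
    then have "ennreal (cmod (fc ?w j))
      \<le> ennreal (cmod (fc (U t ?d) j)) + ennreal (cmod (LINT s|?M. \<kappa> j s))"
      by (simp flip: ennreal_plus add: ennreal_leI)
    also have "ennreal (cmod (LINT s|?M. \<kappa> j s)) \<le> (\<integral>\<^sup>+ s. ennreal (cmod (\<kappa> j s)) \<partial>?M)"
      by (rule integral_norm_bound_ennreal[OF \<kappa>i])
    finally show "ennreal (cmod (fc ?w j))
      \<le> ennreal (cmod (fc (U t ?d) j)) + (\<integral>\<^sup>+ s. ennreal (cmod (\<kappa> j s)) \<partial>?M)"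
      by (simp add: add_left_mono)
  qed
  also have "\<dots> = anorm (U t ?d) + (\<integral>\<^sup>+ j. (\<integral>\<^sup>+ s. ennreal (cmod (\<kappa> j s)) \<partial>?M) \<partial>count_space UNIV)"
    unfolding anorm_eq by (rule nn_integral_add) auto
  also have "(\<integral>\<^sup>+ j. (\<integral>\<^sup>+ s. ennreal (cmod (\<kappa> j s)) \<partial>?M) \<partial>count_space UNIV)
     = (\<integral>\<^sup>+ s. (isum (\<lambda>j. ennreal (cmod (\<kappa> j s)))) \<partial>?M)"
    by (rule nn_integral_count_space_nn_integral[symmetric]) auto
  also have "\<dots> \<le> (\<integral>\<^sup>+ s. ennreal B * anorm (?D s) \<partial>?M)"
  proof (rule nn_integral_mono_AE)
    have "AE s in ?M. s \<in> {0..t}" by (rule AE_I2) simp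
    with ae show "AE s in ?M. (isum (\<lambda>j. ennreal (cmod (\<kappa> j s))))
       \<le> ennreal B * anorm (?D s)"
    proof eventually_elim
      case (elim s)
      have N: "?N s \<in> wiener" "?N' s \<in> wiener"
        using elim \<epsilon> by (auto intro!: nonlinearity_cubic(2) \<zeta>_nonneg \<zeta>_integrable \<zeta>_mass \<zeta>_moment)
      note NL = N[THEN wiener_L2]
      have "\<kappa> j s = fc (U (t - s) (?D s)) j" for j
      proof -
        have "\<kappa> j s = fc (\<lambda>x. U (t - s) (?N s) x - U (t - s) (?N' s) x) j"
          unfolding \<kappa>_def by (intro fourier_coeff_diff[symmetric] L2_integrable U_L2 NL)
        also have "\<dots> = fc (U (t - s) (?D s)) j"
        proof (rule fourier_coeff_cong)
          show "AE x in lebesgue. U (t - s) (?N s) x - U (t - s) (?N' s) x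
             = U (t - s) (?D s) x"
            using U_diff[OF NL, of "t - s"] by eventually_elim simp
        qed (intro L2_measurable L2_diff U_L2 NL)+
        finally show ?thesis .
      qed
      then have "(isum (\<lambda>j. ennreal (cmod (\<kappa> j s))))
          = anorm (U (t - s) (?D s))"
        by (simp add: anorm_eq)
      also have "\<dots> \<le> ennreal B * anorm (?D s)"
        using elim t by (intro B wiener_diff N) auto
      finally show ?case .
    qed
  qed
  also have "anorm (U t ?d) \<le> ennreal B * anorm ?d"
    by (intro B t wiener_diff u0 v0)
  finally show ?thesis by (simp add: add_left_mono add_right_mono)
qed

lemma Linf_H1_bound:
  assumes "Linf_H1 T T' u"
  obtains M where "M \<ge> 0" "AE t in lebesgue_on {0..T'}. u t \<in> H1 \<and> H1norm (u t) \<le> M"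
    "\<And>j. (\<lambda>t. fc (u t) j) \<in> borel_measurable (lebesgue_on {0..T'})"
proof -
  from assms obtain M where sm: "strongly_measurable H1 H1norm {0..T'} u"
    and M: "AE t in lebesgue_on {0..T'}. H1norm (u t) \<le> M"
    unfolding Linf_H1_def by blast
  have "AE t in lebesgue_on {0..T'}. u t \<in> H1"
    using sm unfolding strongly_measurable_def by (auto elim!: eventually_mono)
  with M have ae: "AE t in lebesgue_on {0..T'}. u t \<in> H1 \<and> H1norm (u t) \<le> max 0 M"
    by eventually_elim auto
  show ?thesis by (rule that[OF _ ae strongly_measurable_sobolev_coeff[OF _ sm]]) auto
qed

text \<open>The constants \<open>L\<close>, \<open>m\<close>, \<open>A\<close> and \<open>r\<close> depend on the local solution only; the bound on \<open>u\<close>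
  enters qualitatively, through finiteness.\<close>

lemma difference_inequality:
  assumes sol': "mild_solution T U \<zeta> 1 0 v0 v" and v0: "v0 \<in> H1" and T': "T' > 0"
  obtains L m A r where "L \<ge> 0" "m \<ge> 0" "A \<ge> 0" "\<And>\<epsilon>. r \<epsilon> \<ge> 0" "(r \<longlongrightarrow> 0) (at_right 0)"
    "\<And>\<epsilon> u0 u. \<epsilon> \<ge> 0 \<Longrightarrow> mild_solution T U \<zeta> 1 \<epsilon> u0 u \<Longrightarrow> u0 \<in> H1 \<Longrightarrow>
      \<exists>h B. h \<in> borel_measurable (lebesgue_on {0..T'}) \<and> (\<forall>t. h t \<ge> 0) \<and> (AE t in lebesgue_on {0..T'}. h t \<le> B) \<and>
        (\<forall>t\<in>{0..T'}. (\<lambda>x. u t x - v t x) \<in> wiener \<and> anorm (\<lambda>x. u t x - v t x) = ennreal (h t) \<and>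
           h t \<le> (A * H1norm (\<lambda>x. u0 x - v0 x) + r \<epsilon>) + (LINT s|lebesgue_on {0..t}. L * h s * (m + h s)\<^sup>2))"
proof -
  obtain B where B: "B > 0" "\<And>t f. t \<in> {0..T'} \<Longrightarrow> f \<in> wiener \<Longrightarrow> anorm (U t f) \<le> ennreal B * anorm f"
    using U_wiener_bounded by blast
  obtain K where K: "K \<ge> 0" "\<And>f. f \<in> H1 \<Longrightarrow> anorm f \<le> ennreal (K * H1norm f)"
    using anorm_le_sobolev_norm by blast
  obtain K' where K': "K' \<ge> 0" "\<And>\<epsilon> f. \<epsilon> \<ge> 0 \<Longrightarrow> f \<in> H1 \<Longrightarrow>
      wnorm (weight \<zeta> \<epsilon>) f \<le> ennreal (sqrt (K' * sqrt \<epsilon>) * H1norm f)"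
    using weight_le_sobolev_norm by blast
  have "Linf_H1 T T' v" using sol' T' by (simp add: mild_solution_def)
  from Linf_H1_bound[OF this] obtain M where M: "M \<ge> 0"
    and vM: "AE t in lebesgue_on {0..T'}. v t \<in> H1 \<and> H1norm (v t) \<le> M"
    and vm: "\<And>j. (\<lambda>t. fc (v t) j) \<in> borel_measurable (lebesgue_on {0..T'})" by blast
  \<comment> \<open>A bound on the Wiener norm of the local solution at almost every time.\<close>
  define m where "m = K * M"
  have m: "m \<ge> 0" using K M by (simp add: m_def)
  \<comment> \<open>\<open>B\<close> comes from the propagator, \<open>1 / T\<close> from the nested
    products in the cubic term, and 3 from its three quadratic factors, each at most
    \<open>(m + h s)\<^sup>2\<close>.\<close>
  define L where "L = 3 * B / T"
  have L: "L \<ge> 0" using B T_pos by (simp add: L_def)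
  \<comment> \<open>The rate at which the mismatch between the two multipliers, evaluated on the
    local solution, feeds the difference.\<close>
  define q where "q \<epsilon> = B / T * (2 * m\<^sup>2 * (sqrt (K' * sqrt \<epsilon>) * M))" for \<epsilon>
  \<comment> \<open>The modulus makes \<open>r\<close> nonnegative at negative arguments too, where
    the real \<open>sqrt\<close> takes negative values.\<close>
  define r where "r \<epsilon> = T' * \<bar>q \<epsilon>\<bar>" for \<epsilon>
  have q0: "q \<epsilon> \<ge> 0" if "\<epsilon> \<ge> 0" for \<epsilon> using B T_pos M K' that by (simp add: q_def)
  show ?thesis
  proof (rule that[of L m "B * K" r])
    show "L \<ge> 0" "m \<ge> 0" by fact+
    show "B * K \<ge> 0" using B K by simp
    show "r \<epsilon> \<ge> 0" for \<epsilon> using T' by (simp add: r_def)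
    have "(r \<longlongrightarrow> T' * \<bar>B / T * (2 * m\<^sup>2 * (sqrt (K' * sqrt 0) * M))\<bar>) (at_right 0)"
      unfolding r_def[abs_def] q_def[abs_def] using T_pos by (intro tendsto_intros) auto
    then show "(r \<longlongrightarrow> 0) (at_right 0)" by simp
    fix \<epsilon> :: real and u0 u
    let ?D = "\<lambda>s x. nonlinearity \<zeta> \<epsilon> (u s) x - nonlinearity \<zeta> 0 (v s) x"
    let ?d = "\<lambda>x. u0 x - v0 x" and ?w = "\<lambda>s x. u s x - v s x"
    assume \<epsilon>: "\<epsilon> \<ge> 0" and sol: "mild_solution T U \<zeta> 1 \<epsilon> u0 u" and u0: "u0 \<in> H1"
    have "Linf_H1 T T' u" using sol T' by (simp add: mild_solution_def)
    from Linf_H1_bound[OF this] obtain M' where M': "M' \<ge> 0"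
      and uM: "AE t in lebesgue_on {0..T'}. u t \<in> H1 \<and> H1norm (u t) \<le> M'"
      and um: "\<And>j. (\<lambda>t. fc (u t) j) \<in> borel_measurable (lebesgue_on {0..T'})" by blast
    \<comment> \<open>Written with countably many coefficients, each measurable in time, so that
      \<open>h\<close> is measurable; \<open>h_eq\<close> identifies it with the Wiener norm of the
      difference.\<close>
    define h where "h t = enn2real (\<Sum>n. ennreal (cmod (fc (u t) (int_decode n) - fc (v t) (int_decode n))))" for t
    have h_eq: "h t = enn2real (anorm (?w t))" if "u t \<in> L2 T" "v t \<in> L2 T" for t
      using that by (simp add: h_def anorm_eq nn_integral_int_eq_suminf fourier_coeff_diff L2_integrable)
    note um [measurable] vm [measurable]
    have hm [measurable]: "h \<in> borel_measurable (lebesgue_on {0..T'})" unfolding h_def[abs_def] by measurable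
    have h0: "h t \<ge> 0" for t by (simp add: h_def)
    have L2t: "u t \<in> L2 T" "v t \<in> L2 T" if "t \<ge> 0" for t using sol sol' that by (auto simp: mild_solution_def)
    let ?z = "sqrt (K' * sqrt \<epsilon>) * M" and ?p = "\<lambda>s. ennreal (m + h s) * ennreal (m + h s) + ennreal (m + h s) * ennreal (m + h s) + ennreal (m + h s) * ennreal (m + h s)"
    define Q where "Q s = L * h s * (m + h s)\<^sup>2 + q \<epsilon>" for s
    have facts: "AE s in lebesgue_on {0..T'}. u s \<in> wiener \<and> v s \<in> wiener \<and> h s \<le> K * (M' + M) \<and>
        ennreal B * anorm (?D s) \<le> ennreal (Q s)"
      using uM vM
    proof eventually_elim
      case (elim s)
      then have us: "u s \<in> H1" "H1norm (u s) \<le> M'" and vs: "v s \<in> H1" "H1norm (v s) \<le> M"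
        by auto
      have uw: "u s \<in> wiener" and vw: "v s \<in> wiener" using us vs by (auto intro: sobolev_wiener)
      have dw: "(?w s) \<in> wiener" by (rule wiener_diff[OF uw vw])
      have hs: "anorm (?w s) = ennreal (h s)"
        using dw by (simp add: h_eq[OF uw[THEN wiener_L2] vw[THEN wiener_L2]] wiener_def)
      have au: "anorm (u s) \<le> ennreal (K * M')"
        using order_trans[OF K(2)[OF us(1)]] mult_left_mono[OF us(2) K(1)] ennreal_leI by blast
      have av: "anorm (v s) \<le> ennreal m"
        unfolding m_def using order_trans[OF K(2)[OF vs(1)]] mult_left_mono[OF vs(2) K(1)] ennreal_leI by blast
      have "ennreal (h s) \<le> anorm (u s) + anorm (v s)"
        unfolding hs[symmetric] by (intro wnorm_diff L2_integrable wiener_L2 uw vw) auto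
      also have "\<dots> \<le> ennreal (K * M') + ennreal m" by (intro add_mono au av)
      also have "\<dots> = ennreal (K * (M' + M))" using K M M' by (simp add: m_def distrib_left)
      finally have hK: "h s \<le> K * (M' + M)" using K M M' by (simp add: ennreal_le_iff)
      \<comment> \<open>The nonlocal solution is bounded through the local one and the difference,
        which keeps its own bound \<open>M'\<close> out of \<open>L\<close> and
        \<open>m\<close>.\<close>
      have "u s = (\<lambda>x. (u s x - v s x) + v s x)" by simp
      then have "anorm (u s) \<le> anorm (?w s) + anorm (v s)"
        using wnorm_add[of "?w s" "v s" "\<lambda>_. 1"] dw vw by (simp add: L2_integrable wiener_L2)
      also have "\<dots> \<le> ennreal (h s) + ennreal m" unfolding hs by (intro add_left_mono av)
      also have "\<dots> = ennreal (m + h s)" using m h0 by (simp add: add.commute)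
      finally have au': "anorm (u s) \<le> ennreal (m + h s)" .
      have av': "anorm (v s) \<le> ennreal (m + h s)" using av by (rule order_trans) (use h0 in \<open>auto intro!: ennreal_leI\<close>)
      have "wnorm (weight \<zeta> \<epsilon>) (v s) \<le> ennreal (sqrt (K' * sqrt \<epsilon>) * H1norm (v s))" by (rule K'(2)[OF \<epsilon> vs(1)])
      also have "\<dots> \<le> ennreal ?z"
        using K' \<epsilon> vs by (intro ennreal_leI mult_left_mono) auto
      finally have wv: "wnorm (weight \<zeta> \<epsilon>) (v s) \<le> ennreal ?z" .
      have "anorm (?D s) \<le> ennreal (1 / T) *
         (anorm (?w s) * (anorm (u s) * anorm (u s) + anorm (u s) * anorm (v s) + anorm (v s) * anorm (v s))
          + 2 * (anorm (v s) * anorm (v s)) * wnorm (weight \<zeta> \<epsilon>) (v s))"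
        by (rule nonlinearity_diff[OF \<zeta>_nonneg \<zeta>_integrable \<zeta>_mass \<zeta>_moment uw vw \<epsilon>])
      also have "\<dots> \<le> ennreal (1 / T) * (ennreal (h s) * ?p s
          + 2 * (ennreal m * ennreal m) * ennreal ?z)"
        unfolding hs by (intro mult_left_mono add_mono mult_mono au' av' av wv) auto
      finally have "ennreal B * anorm (?D s)
         \<le> ennreal B * (ennreal (1 / T) * (ennreal (h s) * ?p s
          + 2 * (ennreal m * ennreal m) * ennreal ?z))"
        by (rule mult_left_mono) simp
      also have "\<dots> = ennreal (B * (1 / T * (h s * ((m + h s) * (m + h s) + (m + h s) * (m + h s) + (m + h s) * (m + h s)) + 2 * (m * m) * ?z)))"
        by (rule ennreal_cubic_eq) (use B K' \<epsilon> M m h0[of s] T_pos in auto)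
      also have "B * (1 / T * (h s * ((m + h s) * (m + h s) + (m + h s) * (m + h s) + (m + h s) * (m + h s)) + 2 * (m * m) * ?z)) = Q s"
      proof -
        have "B * (1 / T * (h s * (X * X + X * X + X * X) + 2 * (m * m) * Z)) = 3 * B / T * h s * X\<^sup>2 + B / T * (2 * m\<^sup>2 * Z)" for X Z
          using T_pos by (simp add: power2_eq_square field_simps)
        then show ?thesis by (simp only: Q_def L_def q_def)
      qed
      finally show ?case using uw vw hK by blast
    qed
    have hb: "AE s in lebesgue_on {0..T'}. h s \<le> K * (M' + M)" using facts by eventually_elim blast
    interpret finite_measure "lebesgue_on {0..T'}" by (rule finite_measure_lebesgue_on) auto
    have gi: "integrable (lebesgue_on {0..T'}) (\<lambda>s. L * h s * (m + h s)\<^sup>2)"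
    proof (rule integrable_const_bound[of _ "L * (K * (M' + M)) * (m + K * (M' + M))\<^sup>2"])
      show "AE s in lebesgue_on {0..T'}. norm (L * h s * (m + h s)\<^sup>2) \<le> L * (K * (M' + M)) * (m + K * (M' + M))\<^sup>2"
        using hb
      proof eventually_elim
        case (elim s)
        have "L * h s * (m + h s)\<^sup>2 \<le> L * (K * (M' + M)) * (m + K * (M' + M))\<^sup>2"
          using elim L m h0[of s] K M M' by (intro mult_mono power_mono mult_nonneg_nonneg) auto
        then show ?case using L h0[of s] by simp
      qed
    qed simp
    have main: "(?w t) \<in> wiener \<and> anorm (?w t) = ennreal (h t) \<and>
           h t \<le> (B * K * H1norm ?d + r \<epsilon>) + (LINT s|lebesgue_on {0..t}. L * h s * (m + h s)\<^sup>2)"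
      if t: "t \<in> {0..T'}" for t
    proof -
      have t0: "t \<ge> 0" using t by simp
      have git: "integrable (lebesgue_on {0..t}) (\<lambda>s. L * h s * (m + h s)\<^sup>2)"
        by (rule integrable_subinterval[OF gi]) (use t in auto)
      interpret t: finite_measure "lebesgue_on {0..t}" by (rule finite_measure_lebesgue_on) auto
      have ft: "AE s in lebesgue_on {0..t}. u s \<in> wiener \<and> v s \<in> wiener \<and> h s \<le> K * (M' + M) \<and>
        ennreal B * anorm (?D s) \<le> ennreal (Q s)"
        by (rule AE_lebesgue_on_subset[OF facts t])
      have Qi: "integrable (lebesgue_on {0..t}) Q" unfolding Q_def[abs_def] by (intro Bochner_Integration.integrable_add git) auto
      have Q0: "Q s \<ge> 0" for s using L h0[of s] q0[OF \<epsilon>] by (simp add: Q_def)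
      have "anorm (?w t) \<le> ennreal B * anorm ?d
         + (\<integral>\<^sup>+ s. ennreal B * anorm (?D s) \<partial>lebesgue_on {0..t})"
        by (rule duhamel_estimate[OF sol sol' \<epsilon> sobolev_wiener[OF u0] sobolev_wiener[OF v0] t B(2)])
           (use ft in \<open>auto elim!: eventually_mono\<close>)
      also have "\<dots> \<le> ennreal B * ennreal (K * H1norm ?d) + (\<integral>\<^sup>+ s. ennreal (Q s) \<partial>lebesgue_on {0..t})"
        using ft by (intro add_mono mult_left_mono K(2) sobolev_diff u0 v0 nn_integral_mono_AE) (auto elim!: eventually_mono)
      also have "(\<integral>\<^sup>+ s. ennreal (Q s) \<partial>lebesgue_on {0..t}) = ennreal (LINT s|lebesgue_on {0..t}. Q s)"
        by (rule nn_integral_eq_integral[OF Qi]) (simp add: Q0)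
      also have "ennreal B * ennreal (K * H1norm ?d) + ennreal (LINT s|lebesgue_on {0..t}. Q s)
         = ennreal (B * K * H1norm ?d + (LINT s|lebesgue_on {0..t}. Q s))"
        using B K sobolev_norm_nonneg Q0
        by (subst ennreal_plus) (auto simp: ennreal_mult mult.assoc intro!: mult_nonneg_nonneg)
      finally have est: "anorm (?w t) \<le> ennreal (B * K * H1norm ?d + (LINT s|lebesgue_on {0..t}. Q s))" .
      \<comment> \<open>Sobolev membership is known at almost every time; finiteness of the Duhamel
        bound places the difference in the algebra at every \<open>t\<close>.\<close>
      then have fin: "anorm (?w t) < \<infinity>" by (rule order.strict_trans1) simp
      then have w: "(?w t) \<in> wiener" using L2_diff[OF L2t[OF t0]] by (simp add: wiener_def)
      have ah: "anorm (?w t) = ennreal (h t)"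
        using fin by (simp add: h_eq[OF L2t[OF t0]])
      have nn: "0 \<le> B * K * H1norm ?d + (LINT s|lebesgue_on {0..t}. Q s)"
        using B K sobolev_norm_nonneg Q0 by (intro add_nonneg_nonneg mult_nonneg_nonneg integral_nonneg_AE) auto
      have "h t \<le> B * K * H1norm ?d + (LINT s|lebesgue_on {0..t}. Q s)"
        using est unfolding ah by (subst (asm) ennreal_le_iff[OF nn])
      also have "(LINT s|lebesgue_on {0..t}. Q s) = (LINT s|lebesgue_on {0..t}. L * h s * (m + h s)\<^sup>2) + t * q \<epsilon>"
        unfolding Q_def using git t0 by (subst Bochner_Integration.integral_add) (auto simp: measure_restrict_space)
      also have "t * q \<epsilon> \<le> r \<epsilon>" unfolding r_def using t q0[OF \<epsilon>] by (intro mult_mono) auto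
      finally show ?thesis using w ah by simp
    qed
    show "\<exists>h Ba. h \<in> borel_measurable (lebesgue_on {0..T'}) \<and> (\<forall>t. h t \<ge> 0) \<and> (AE t in lebesgue_on {0..T'}. h t \<le> Ba) \<and>
        (\<forall>t\<in>{0..T'}. (\<lambda>x. u t x - v t x) \<in> wiener \<and> anorm (\<lambda>x. u t x - v t x) = ennreal (h t) \<and>
           h t \<le> (B * K * H1norm (\<lambda>x. u0 x - v0 x) + r \<epsilon>) + (LINT s|lebesgue_on {0..t}. L * h s * (m + h s)\<^sup>2))"
      using hm h0 hb main by blast
  qed
qed

text \<open>\<open>b\<close> must be finite at every positive \<epsilon>, while the continuity
  argument covers only those with small \<open>a \<epsilon> * E\<close>. For the others a bound
  depending on \<epsilon> in an uncontrolled way is enough, since as \<epsilon> tends to 0 they are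
  eventually left behind.\<close>

lemma convergence:
  assumes sol': "mild_solution T U \<zeta> 1 0 (\<psi>0 0) \<psi>" and T': "T' > 0"
    and sol: "\<And>\<epsilon>. \<epsilon> > 0 \<Longrightarrow> mild_solution T U \<zeta> 1 \<epsilon> (\<psi>0 \<epsilon>) (\<psi>\<epsilon> \<epsilon>)"
    and init: "\<And>\<epsilon>. \<epsilon> \<ge> 0 \<Longrightarrow> \<psi>0 \<epsilon> \<in> H1"
    and conv: "((\<lambda>\<epsilon>. H1norm (\<lambda>x. \<psi>0 \<epsilon> x - \<psi>0 0 x)) \<longlongrightarrow> 0) (at_right 0)"
  obtains b :: "real \<Rightarrow> real" where "(b \<longlongrightarrow> 0) (at_right 0)" "\<And>\<epsilon>. \<epsilon> > 0 \<Longrightarrow> b \<epsilon> \<ge> 0"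
    "\<And>\<epsilon> t. \<epsilon> > 0 \<Longrightarrow> t \<in> {0..T'} \<Longrightarrow> Linf_norm T (\<lambda>x. \<psi>\<epsilon> \<epsilon> t x - \<psi> t x) \<le> ereal (b \<epsilon>)"
proof -
  let ?w = "\<lambda>\<epsilon> t x. \<psi>\<epsilon> \<epsilon> t x - \<psi> t x" and ?d = "\<lambda>\<epsilon> x. \<psi>0 \<epsilon> x - \<psi>0 0 x"
  show thesis
  proof (rule difference_inequality[OF sol' init[OF order_refl] T'])
  fix L m A :: real and r :: "real \<Rightarrow> real"
  assume L: "L \<ge> 0" "m \<ge> 0" "A \<ge> 0" and r: "\<And>\<epsilon>. r \<epsilon> \<ge> 0" "(r \<longlongrightarrow> 0) (at_right 0)"
    and D: "\<And>\<epsilon> u0 u. \<epsilon> \<ge> 0 \<Longrightarrow> mild_solution T U \<zeta> 1 \<epsilon> u0 u \<Longrightarrow> u0 \<in> H1 \<Longrightarrow>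
      \<exists>h B. h \<in> borel_measurable (lebesgue_on {0..T'}) \<and> (\<forall>t. h t \<ge> 0) \<and> (AE t in lebesgue_on {0..T'}. h t \<le> B) \<and>
        (\<forall>t\<in>{0..T'}. (\<lambda>x. u t x - \<psi> t x) \<in> wiener \<and> anorm (\<lambda>x. u t x - \<psi> t x) = ennreal (h t) \<and>
           h t \<le> (A * H1norm (\<lambda>x. u0 x - \<psi>0 0 x) + r \<epsilon>) + (LINT s|lebesgue_on {0..t}. L * h s * (m + h s)\<^sup>2))"
  define E where "E = exp (L * (m + 1)\<^sup>2 * T')"
  define a where "a \<epsilon> = A * H1norm (?d \<epsilon>) + r \<epsilon>" for \<epsilon>
  have a0: "a \<epsilon> \<ge> 0" for \<epsilon> using L r sobolev_norm_nonneg by (simp add: a_def)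
  have alim: "((\<lambda>\<epsilon>. a \<epsilon> * E) \<longlongrightarrow> 0) (at_right 0)"
  proof -
    have "((\<lambda>\<epsilon>. a \<epsilon> * E) \<longlongrightarrow> (A * 0 + 0) * E) (at_right 0)" unfolding a_def by (intro tendsto_intros conv r)
    then show ?thesis by simp
  qed
  have ex: "\<exists>\<beta>\<ge>0. (a \<epsilon> * E < 1 \<longrightarrow> \<beta> \<le> a \<epsilon> * E / sqrt T) \<and>
      (\<forall>t\<in>{0..T'}. Linf_norm T (?w \<epsilon> t) \<le> ereal \<beta>)" if \<epsilon>: "\<epsilon> > 0" for \<epsilon>
  proof -
    from D[OF less_imp_le[OF \<epsilon>] sol[OF \<epsilon>] init[OF less_imp_le[OF \<epsilon>]]] obtain h B
      where hm: "h \<in> borel_measurable (lebesgue_on {0..T'})" and h0: "\<And>t. h t \<ge> 0"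
        and hB: "AE t in lebesgue_on {0..T'}. h t \<le> B"
        and w: "\<And>t. t \<in> {0..T'} \<Longrightarrow> (?w \<epsilon> t) \<in> wiener"
        and ah: "\<And>t. t \<in> {0..T'} \<Longrightarrow> anorm (?w \<epsilon> t) = ennreal (h t)"
        and le: "\<And>t. t \<in> {0..T'} \<Longrightarrow> h t \<le> a \<epsilon> + (LINT s|lebesgue_on {0..t}. L * h s * (m + h s)\<^sup>2)"
      unfolding a_def by blast
    have Linf: "Linf_norm T (?w \<epsilon> t) \<le> ereal (h t / sqrt T)" if "t \<in> {0..T'}" for t
      using Linf_norm_le[OF w[OF that]] h0 by (simp add: ah[OF that])
    show ?thesis
    proof (cases "a \<epsilon> * E < 1")
      case True
      have "h t \<le> a \<epsilon> * E" if "t \<in> {0..T'}" for t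
        unfolding E_def by (rule cubic_gronwall[OF T' hm h0 hB L(1,2) a0 le _ that]) (use True in \<open>simp_all add: E_def\<close>)
      then have "h t / sqrt T \<le> a \<epsilon> * E / sqrt T" if "t \<in> {0..T'}" for t
        using that T_pos by (intro divide_right_mono) auto
      then have "Linf_norm T (?w \<epsilon> t) \<le> ereal (a \<epsilon> * E / sqrt T)" if "t \<in> {0..T'}" for t
        using order_trans[OF Linf[OF that]] that by simp
      moreover have "a \<epsilon> * E / sqrt T \<ge> 0" using a0 T_pos by (simp add: E_def)
      ultimately show ?thesis by (intro exI[of _ "a \<epsilon> * E / sqrt T"]) auto
    next
      case False
      define B' where "B' = max 0 B"
      have hB': "AE t in lebesgue_on {0..T'}. h t \<le> B'" using hB by eventually_elim (simp add: B'_def)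
      \<comment> \<open>One pass of the integral inequality with \<open>h\<close> replaced by its
        essential bound, which turns an almost everywhere bound into one at every time.\<close>
      define \<beta> where "\<beta> = (a \<epsilon> + T' * (L * B' * (m + B')\<^sup>2)) / sqrt T"
      have B'0: "B' \<ge> 0" by (simp add: B'_def)
      have "h t \<le> a \<epsilon> + T' * (L * B' * (m + B')\<^sup>2)" if t: "t \<in> {0..T'}" for t
      proof -
        have hBt: "AE s in lebesgue_on {0..t}. h s \<le> B'" by (rule AE_lebesgue_on_subset[OF hB' t])
        interpret finite_measure "lebesgue_on {0..t}" by (rule finite_measure_lebesgue_on) auto
        have "(LINT s|lebesgue_on {0..t}. L * h s * (m + h s)\<^sup>2) \<le> (LINT s|lebesgue_on {0..t}. L * B' * (m + B')\<^sup>2)"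
        proof (rule integral_mono_AE')
          show "AE s in lebesgue_on {0..t}. L * h s * (m + h s)\<^sup>2 \<le> L * B' * (m + B')\<^sup>2"
            using hBt by eventually_elim (use L h0 B'0 in \<open>auto intro!: mult_mono power_mono\<close>)
          show "AE s in lebesgue_on {0..t}. 0 \<le> L * B' * (m + B')\<^sup>2" using L B'0 by simp
        qed simp
        also have "\<dots> = t * (L * B' * (m + B')\<^sup>2)" using t by (simp add: measure_restrict_space)
        also have "\<dots> \<le> T' * (L * B' * (m + B')\<^sup>2)" using t L B'0 by (intro mult_right_mono) auto
        finally show ?thesis using le[OF t] by simp
      qed
      then have "h t / sqrt T \<le> \<beta>" if "t \<in> {0..T'}" for t
        unfolding \<beta>_def using that T_pos by (intro divide_right_mono) auto
      then have "Linf_norm T (?w \<epsilon> t) \<le> ereal \<beta>" if "t \<in> {0..T'}" for t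
        using order_trans[OF Linf[OF that]] that by simp
      moreover have "\<beta> \<ge> 0" unfolding \<beta>_def using a0[of \<epsilon>] T' L B'0 T_pos by auto
      ultimately show ?thesis using False by (intro exI[of _ \<beta>]) auto
    qed
  qed
  then have "\<forall>\<epsilon>. \<exists>\<beta>. \<epsilon> > 0 \<longrightarrow> \<beta> \<ge> 0 \<and> (a \<epsilon> * E < 1 \<longrightarrow> \<beta> \<le> a \<epsilon> * E / sqrt T) \<and>
      (\<forall>t\<in>{0..T'}. Linf_norm T (?w \<epsilon> t) \<le> ereal \<beta>)" by blast
  then obtain b where b: "\<And>\<epsilon>. \<epsilon> > 0 \<Longrightarrow> b \<epsilon> \<ge> 0" "\<And>\<epsilon>. \<epsilon> > 0 \<Longrightarrow> a \<epsilon> * E < 1 \<Longrightarrow> b \<epsilon> \<le> a \<epsilon> * E / sqrt T"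
    "\<And>\<epsilon> t. \<epsilon> > 0 \<Longrightarrow> t \<in> {0..T'} \<Longrightarrow> Linf_norm T (?w \<epsilon> t) \<le> ereal (b \<epsilon>)"
    by metis
  have pos: "eventually (\<lambda>\<epsilon>. \<epsilon> > (0::real)) (at_right 0)" by (simp add: eventually_at_right_less)
  have "((\<lambda>\<epsilon>. a \<epsilon> * E / sqrt T) \<longlongrightarrow> 0 / sqrt T) (at_right 0)" using T_pos by (intro tendsto_intros alim) auto
  then have lim: "((\<lambda>\<epsilon>. a \<epsilon> * E / sqrt T) \<longlongrightarrow> 0) (at_right 0)" by simp
  have "(b \<longlongrightarrow> 0) (at_right 0)"
  proof (rule tendsto_sandwich[OF _ _ tendsto_const lim])
    show "eventually (\<lambda>\<epsilon>. 0 \<le> b \<epsilon>) (at_right 0)" using pos by eventually_elim (rule b)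
    show "eventually (\<lambda>\<epsilon>. b \<epsilon> \<le> a \<epsilon> * E / sqrt T) (at_right 0)"
      using pos order_tendstoD(2)[OF alim zero_less_one] by eventually_elim (rule b)
  qed
  then show thesis using b(1,3) by (rule that)
  qed
qed

end

theorem theorem1:
  fixes T C C\<^sub>\<zeta> \<eta> :: real
    and V \<zeta> :: "real \<Rightarrow> real"
    and U :: "real \<Rightarrow> (real \<Rightarrow> complex) \<Rightarrow> real \<Rightarrow> complex"
    and \<psi>0 :: "real \<Rightarrow> real \<Rightarrow> complex"
    and \<psi>\<epsilon> :: "real \<Rightarrow> real \<Rightarrow> real \<Rightarrow> complex"
    and \<psi> :: "real \<Rightarrow> real \<Rightarrow> complex"
  assumes "T > 0"
    and V_smooth: "smooth V" and V_periodic: "periodic T V"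
    and zeta_nonneg: "\<And>x. \<zeta> x \<ge> 0"
    and zeta_L1: "integrable lebesgue \<zeta>" and zeta_mass: "(LINT x|lebesgue. \<zeta> x) = 1"
    and zeta_moment: "integrable lebesgue (\<lambda>x. x * \<zeta> x)"
    and "\<eta> > 0" and "C\<^sub>\<zeta> > 0"
    and zeta_fourier: "\<And>s. cmod (fourier_transform \<zeta> s) \<le> C\<^sub>\<zeta> * (1 + \<bar>s\<bar>) powr (- 1/2 - \<eta>)"
    and zeta_even: "\<And>x. \<zeta> (- x) = \<zeta> x"
    and propagator: "schroedinger_group T V U"
    and "C > 0"
    and init_H1: "\<And>\<epsilon>. \<epsilon> \<ge> 0 \<Longrightarrow> \<psi>0 \<epsilon> \<in> sobolev T 1"
    and init_bound: "\<And>\<epsilon>. \<epsilon> \<ge> 0 \<Longrightarrow> sobolev_norm T 1 (\<psi>0 \<epsilon>) \<le> C"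
    and init_conv: "((\<lambda>\<epsilon>. sobolev_norm T 1 (\<lambda>x. \<psi>0 \<epsilon> x - \<psi>0 0 x)) \<longlongrightarrow> 0) (at_right 0)"
    and NGP: "\<And>\<epsilon>. \<epsilon> > 0 \<Longrightarrow> mild_solution T U \<zeta> 1 \<epsilon> (\<psi>0 \<epsilon>) (\<psi>\<epsilon> \<epsilon>)"
    and GP: "mild_solution T U \<zeta> 1 0 (\<psi>0 0) \<psi>"
  shows "\<exists>C\<^sub>u>0. \<exists>\<rho> :: real \<Rightarrow> real \<Rightarrow> real \<Rightarrow> real.
           (\<forall>T'>0. \<forall>\<epsilon>'\<ge>0. ((\<lambda>\<epsilon>. \<rho> T' \<epsilon> \<epsilon>') \<longlongrightarrow> 0) (at \<epsilon>' within {0..})) \<and>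
           (\<forall>\<epsilon>>0. \<forall>T'>0. \<forall>t\<in>{0..T'}.
              Linf_norm T (\<lambda>x. \<psi>\<epsilon> \<epsilon> t x - \<psi> t x)
                \<le> ereal ((sobolev_norm T 1 (\<lambda>x. \<psi>0 \<epsilon> x - \<psi>0 0 x) + 3 * C\<^sub>u * T' * \<rho> T' \<epsilon> 0)
                         * exp (3 * C\<^sub>u\<^sup>2 * T')))"
proof -
  interpret gross_pitaevskii T V U \<zeta>
    by unfold_locales fact+
  \<comment> \<open>The condition \<open>T' > 0\<close> stays inside the existential, so that one
    choice over all \<open>T'\<close> yields a function of two arguments.\<close>
  have "\<exists>b :: real \<Rightarrow> real. T' > 0 \<longrightarrow> (b \<longlongrightarrow> 0) (at_right 0) \<and> (\<forall>\<epsilon>>0. b \<epsilon> \<ge> 0) \<and>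
      (\<forall>\<epsilon>>0. \<forall>t\<in>{0..T'}. Linf_norm T (\<lambda>x. \<psi>\<epsilon> \<epsilon> t x - \<psi> t x) \<le> ereal (b \<epsilon>))" for T'
    using convergence[OF GP _ NGP init_H1 init_conv, of T'] by metis
  then obtain b :: "real \<Rightarrow> real \<Rightarrow> real" where b: "\<And>T'. T' > 0 \<Longrightarrow> (b T' \<longlongrightarrow> 0) (at_right 0)"
    "\<And>T' \<epsilon>. T' > 0 \<Longrightarrow> \<epsilon> > 0 \<Longrightarrow> b T' \<epsilon> \<ge> 0"
    "\<And>T' \<epsilon> t. T' > 0 \<Longrightarrow> \<epsilon> > 0 \<Longrightarrow> t \<in> {0..T'} \<Longrightarrow> Linf_norm T (\<lambda>x. \<psi>\<epsilon> \<epsilon> t x - \<psi> t x) \<le> ereal (b T' \<epsilon>)"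
    by metis
  \<comment> \<open>With 1 as the constant \<open>C\<^sub>u\<close>, the term
    \<open>3 * 1 * T' * \<rho> T' \<epsilon> 0\<close> equals \<open>b T' \<epsilon>\<close>. Adding
    the nonnegative distance of the initial data and multiplying by an exponential of at least 1
    only enlarges this. At a nonzero third argument the value 0 has the required limit.\<close>
  define \<rho> where "\<rho> T' \<epsilon> \<epsilon>' = (if \<epsilon>' = 0 then b T' \<epsilon> / (3 * T') else 0)" for T' \<epsilon> \<epsilon>' :: real
  have "((\<lambda>\<epsilon>. \<rho> T' \<epsilon> \<epsilon>') \<longlongrightarrow> 0) (at \<epsilon>' within {0..})" if "T' > 0" "\<epsilon>' \<ge> 0" for T' \<epsilon>'
  proof (cases "\<epsilon>' = 0")
    case True
    have "((\<lambda>\<epsilon>. b T' \<epsilon> / (3 * T')) \<longlongrightarrow> 0 / (3 * T')) (at_right 0)"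
      using that by (intro tendsto_intros b) auto
    \<comment> \<open>The filter excludes the point 0 itself, so within \<open>{0..}\<close> it is
      the limit from the right, where \<open>b\<close> is controlled.\<close>
    with True show ?thesis by (simp add: \<rho>_def at_within_Ici_at_right)
  qed (simp add: \<rho>_def)
  moreover have "Linf_norm T (\<lambda>x. \<psi>\<epsilon> \<epsilon> t x - \<psi> t x)
      \<le> ereal ((sobolev_norm T 1 (\<lambda>x. \<psi>0 \<epsilon> x - \<psi>0 0 x) + 3 * 1 * T' * \<rho> T' \<epsilon> 0) * exp (3 * 1\<^sup>2 * T'))"
    if "\<epsilon> > 0" "T' > 0" "t \<in> {0..T'}" for \<epsilon> T' t
  proof -
    let ?N = "sobolev_norm T 1 (\<lambda>x. \<psi>0 \<epsilon> x - \<psi>0 0 x)"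
    have "b T' \<epsilon> \<le> ?N + b T' \<epsilon>" using sobolev_norm_nonneg by simp
    also have "\<dots> \<le> (?N + b T' \<epsilon>) * exp (3 * T')"
      using b(2)[OF that(2,1)] sobolev_norm_nonneg[of "\<lambda>x. \<psi>0 \<epsilon> x - \<psi>0 0 x"] that
        mult_left_mono[of 1 "exp (3 * T')" "?N + b T' \<epsilon>"] by simp
    finally have "b T' \<epsilon> \<le> (?N + 3 * 1 * T' * \<rho> T' \<epsilon> 0) * exp (3 * 1\<^sup>2 * T')"
      using that by (simp add: \<rho>_def)
    then show ?thesis using order_trans[OF b(3)[OF that(2,1,3)]] by simp
  qed
  ultimately show ?thesis by (intro exI[of _ 1] exI[of _ \<rho>] conjI) auto
qed

end
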